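(* Let $G$ be a group of orientation-preserving piecewise linear or piecewise projective homeomorphisms of the circle. Suppose that $G$ has a dense orbit $Y$ such that the action of $G$ on the set of circularly ordered pairs in $Y$ and on the set of circularly ordered triples in $Y$ are both transitive. Then $G$ admits a unique proximal action on the circle by orientation-preserving homeomorphisms, up to conjugacy by homeomorphisms of the circle.
   Context: Piecewise linear homeomorphisms of the circle act on $\mathbf{R}/\mathbf{Z}$ and are affine on each of finitely many arcs; piecewise projective homeomorphisms act on $\mathbf{R}\cup\{\infty\}$ (identified with the circle) and agree on each of finitely many arcs with an element of $\mathrm{PSL}_2(\mathbf{R})$. A circularly ordered $k$-tuple in $Y$ is a $k$-tuple of distinct points of $Y$ that appear in this order when travelling once around the circle in the positive direction (for $k=2$, any ordered pair of distinct points). Actions are on the right. An action of $G$ on the circle $S^1$ by orientation-preserving homeomorphisms is proximal if for each pair of nonempty open sets $I,J\subset S^1$ such that the closure of $J$ is not all of $S^1$, there is $f\in G$ with $J\cdot f\subset I$. Conjugating homeomorphisms of the circle are allowed to reverse orientation. *)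

theory Defs
  imports "HOL-Analysis.Analysis" "HOL-Algebra.Group"
begin

typedef circle = "sphere (0::complex) 1"
proof
  show "1 \<in> sphere (0::complex) 1" by simp
qed

instantiation circle :: metric_space
begin

definition dist_circle :: "circle \<Rightarrow> circle \<Rightarrow> real"
  where "dist_circle x y = dist (Rep_circle x) (Rep_circle y)"

definition uniformity_circle :: "(circle \<times> circle) filter"
  where "uniformity_circle = (INF e\<in>{0<..}. principal {(x, y). dist x y < e})"

definition open_circle :: "circle set \<Rightarrow> bool"
  where "open_circle U = (\<forall>x\<in>U. eventually (\<lambda>(x', y). x' = x \<longrightarrow> y \<in> U) uniformity)"

instance
proof
  fix x y :: circle
  show "dist x y = 0 \<longleftrightarrow> x = y"
    by (simp add: dist_circle_def Rep_circle_inject)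
next
  fix x y z :: circle
  show "dist x y \<le> dist x z + dist y z"
    unfolding dist_circle_def by (rule dist_triangle2)
qed (simp_all add: uniformity_circle_def open_circle_def)

end

text \<open>The covering map from the line to \<open>\<real>/\<int>\<close>, the latter identified with the unit
  circle. It is positively oriented: increasing reals travel counterclockwise.\<close>

definition circle_of_real :: "real \<Rightarrow> circle"
  where "circle_of_real t = Abs_circle (cis (2 * pi * t))"

text \<open>For a homeomorphism, a continuous strictly increasing lift automatically satisfies
  \<open>F (t + 1) = F t + 1\<close>.\<close>

definition orientation_preserving :: "(circle \<Rightarrow> circle) \<Rightarrow> bool"
  where "orientation_preserving f \<longleftrightarrow>
    (\<exists>F. continuous_on UNIV F \<and> strict_mono F \<and>
         (\<forall>t. f (circle_of_real t) = circle_of_real (F t)))"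

text \<open>Actions are on the right, so the product \<open>f \<otimes> g\<close> applies \<open>f\<close> first.\<close>

definition homeo_plus :: "(circle \<Rightarrow> circle) monoid"
  where "homeo_plus =
    \<lparr>carrier = {f. (\<exists>g. homeomorphism UNIV UNIV f g) \<and> orientation_preserving f},
     monoid.mult = (\<lambda>f g. g \<circ> f),
     one = id\<rparr>"

text \<open>An arc \<open>circle_of_real ` {a..b}\<close> is encoded by a pair \<open>(a, b)\<close> of lifts of its endpoints.
  The arcs below may overlap; this is no more general than a subdivision into arcs with
  disjoint interiors.\<close>

definition arc_cover :: "(real \<times> real) set \<Rightarrow> bool"
  where "arc_cover A \<longleftrightarrow> finite A \<and> (\<forall>(a, b)\<in>A. a < b \<and> b < a + 1) \<and>
    (\<Union>(a, b)\<in>A. circle_of_real ` {a..b}) = UNIV"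

definition piecewise_linear :: "(circle \<Rightarrow> circle) \<Rightarrow> bool"
  where "piecewise_linear f \<longleftrightarrow>
    (\<exists>A. arc_cover A \<and>
      (\<forall>(a, b)\<in>A. \<exists>m c. \<forall>t\<in>{a..b}. f (circle_of_real t) = circle_of_real (m * t + c)))"

text \<open>The real projective line \<open>\<real> \<union> {\<infinity>}\<close> is \<^typ>\<open>real option\<close>, with \<^const>\<open>None\<close> as the point at
  infinity. It is identified with the circle by the Cayley transform.\<close>

definition cayley :: "real option \<Rightarrow> circle"
  where "cayley p = Abs_circle
    (case p of None \<Rightarrow> 1 | Some x \<Rightarrow> (of_real x - \<i>) / (of_real x + \<i>))"

definition moebius :: "real \<Rightarrow> real \<Rightarrow> real \<Rightarrow> real \<Rightarrow> real option \<Rightarrow> real option"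
  where "moebius a b c d p =
    (case p of
       None \<Rightarrow> (if c = 0 then None else Some (a / c))
     | Some x \<Rightarrow> (if c * x + d = 0 then None else Some ((a * x + b) / (c * x + d))))"

definition PSL2 :: "(real option \<Rightarrow> real option) set"
  where "PSL2 = {moebius a b c d | a b c d. a * d - b * c = 1}"

definition piecewise_projective :: "(circle \<Rightarrow> circle) \<Rightarrow> bool"
  where "piecewise_projective f \<longleftrightarrow>
    (\<exists>A. arc_cover A \<and>
      (\<forall>(a, b)\<in>A. \<exists>\<mu>\<in>PSL2. \<forall>p. cayley p \<in> circle_of_real ` {a..b} \<longrightarrow>
         f (cayley p) = cayley (\<mu> p)))"

text \<open>A tuple is circularly ordered if it lifts to an increasing tuple within one period.\<close>

definition circularly_ordered :: "circle list \<Rightarrow> bool"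
  where "circularly_ordered xs \<longleftrightarrow>
    (\<exists>a ts. sorted_wrt (<) ts \<and> set ts \<subseteq> {a..<a + 1} \<and> xs = map circle_of_real ts)"

definition circular_tuples :: "nat \<Rightarrow> circle set \<Rightarrow> circle list set"
  where "circular_tuples k Y = {xs. length xs = k \<and> set xs \<subseteq> Y \<and> circularly_ordered xs}"

definition transitive_on_circular_tuples :: "(circle \<Rightarrow> circle) set \<Rightarrow> nat \<Rightarrow> circle set \<Rightarrow> bool"
  where "transitive_on_circular_tuples G k Y \<longleftrightarrow>
    (\<forall>xs\<in>circular_tuples k Y. \<forall>ys\<in>circular_tuples k Y. \<exists>g\<in>G. map g xs = ys)"

definition circle_action :: "('g, 'm) monoid_scheme \<Rightarrow> ('g \<Rightarrow> circle \<Rightarrow> circle) \<Rightarrow> bool"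
  where "circle_action G \<rho> \<longleftrightarrow> \<rho> \<in> hom G homeo_plus"

definition proximal :: "('g, 'm) monoid_scheme \<Rightarrow> ('g \<Rightarrow> circle \<Rightarrow> circle) \<Rightarrow> bool"
  where "proximal G \<rho> \<longleftrightarrow>
    (\<forall>I J. open I \<and> I \<noteq> {} \<and> open J \<and> J \<noteq> {} \<and> closure J \<noteq> UNIV \<longrightarrow>
      (\<exists>g\<in>carrier G. \<rho> g ` J \<subseteq> I))"

text \<open>The conjugating homeomorphism may reverse orientation.\<close>

definition conjugate_actions ::
    "('g, 'm) monoid_scheme \<Rightarrow> ('g \<Rightarrow> circle \<Rightarrow> circle) \<Rightarrow> ('g \<Rightarrow> circle \<Rightarrow> circle) \<Rightarrow> bool"
  where "conjugate_actions G \<rho> \<sigma> \<longleftrightarrow>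
    (\<exists>h h'. homeomorphism UNIV UNIV h h' \<and> (\<forall>g\<in>carrier G. h \<circ> \<rho> g = \<sigma> g \<circ> h))"

end

theory Submission
  imports Defs
begin

text \<open>
  Fix a proximal action \<open>\<rho>\<close> of \<open>G\<close> and a point \<open>y\<close> of \<open>Y\<close>. Elements supported in disjoint arcs
  commute, and the groups of elements supported in two complementary arcs are conjugate. If two
  commuting conjugate groups act on a circle, then by Hoelder's theorem, applied to a minimal set, the
  commutators of either of them have a common fixed point. Hence, by compactness, the commutators
  of elements of the stabilizer of \<open>y\<close> that are trivial near \<open>y\<close> have a common fixed point under
  \<open>\<rho>\<close>. If no such elements exist, then the stabilizer is metabelian, as its germs at \<open>y\<close> are
  affine in a suitable chart, and an abelian normal subgroup of it is used instead: each of its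
  elements \<open>a\<close> is conjugate to \<open>a\<^sup>2\<close>, so it has translation number zero under \<open>\<rho>\<close>.

  Proximality and the transitivity of normal subgroups of the stabilizer on \<open>Y - {y}\<close> force the
  common fixed set to be a single point. This gives an equivariant injection of \<open>Y\<close> into the circle
  with dense image. By transitivity on triples it preserves or reverses the circular order, so it
  extends to a homeomorphism that conjugates the given action of \<open>G\<close> to \<open>\<rho>\<close>.
\<close>

section \<open>Lifts of circle homeomorphisms\<close>

text \<open>The action \<open>\<rho>\<close> is a bare homomorphism, so nothing topological passes
  from \<open>G\<close> to it; only algebraic relations do, such as commuting, being conjugate or
  lying in a stabilizer. This is why supports have to be translated into commutation relations. The
  obstacle is the kernel of \<open>\<rho>\<close>: the common fixed set might be the whole circle.
  Then a nontrivial normal subgroup of \<open>G\<close> acts trivially under \<open>\<rho>\<close>.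
  It is transitive on \<open>Y\<close>, so the stabilizer of \<open>y\<close> has the same image
  under \<open>\<rho>\<close> as \<open>G\<close>. Second commutators in the stabilizer are trivial
  near \<open>y\<close>, so third commutators of \<open>G\<close> would act trivially, whereas a
  group with a proximal action is not solvable. Existence costs little: transitivity on pairs makes
  the given action proximal. Two arbitrary proximal actions are never compared directly, but only
  through the given one.\<close>

abbreviation cr :: "real \<Rightarrow> circle"
  where "cr \<equiv> circle_of_real"

abbreviation invf :: "('a \<Rightarrow> 'b) \<Rightarrow> 'b \<Rightarrow> 'a"
  where "invf \<equiv> inv_into UNIV"

section \<open>The covering map, its fibres, and arcs of the circle\<close>

lemma Rep_circle_of_real: "Rep_circle (cr t) = cis (2 * pi * t)"
  unfolding circle_of_real_def by (rule Abs_circle_inverse) simp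

lemma circle_of_real_eq_iff:
  "cr s = cr t \<longleftrightarrow> (\<exists>n::int. s = t + of_int n)"
proof
  assume "cr s = cr t"
  then have "cis (2 * pi * s) = cis (2 * pi * t)"
    by (metis Rep_circle_of_real)
  then have "exp (\<i> * of_real (2 * pi * s)) = exp (\<i> * of_real (2 * pi * t))"
    by (simp add: cis_conv_exp)
  then obtain n :: int where
    "\<i> * of_real (2 * pi * s) = \<i> * of_real (2 * pi * t) + (of_int (2 * n) * pi) * \<i>"
    unfolding exp_eq by blast
  then have "\<i> * of_real (2 * pi * s) = \<i> * of_real (2 * pi * t + 2 * n * pi)"
    by (simp add: algebra_simps)
  then have "2 * pi * s = 2 * pi * t + 2 * n * pi"
    by (metis complex_i_not_zero mult_left_cancel of_real_eq_iff)
  then have "2 * pi * s = 2 * pi * (t + n)" by (simp add: algebra_simps)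
  then have "s = t + of_int n" by simp
  then show "\<exists>n::int. s = t + of_int n" ..
next
  assume "\<exists>n::int. s = t + of_int n"
  then obtain n :: int where n: "s = t + of_int n" ..
  have "cis (2 * pi * s) = cis (2 * pi * t) * cis (2 * pi * of_int n)"
    unfolding n by (simp add: cis_mult algebra_simps)
  also have "cis (2 * pi * of_int n) = 1"
    by (rule cis_multiple_2pi) simp
  finally show "cr s = cr t"
    by (simp add: circle_of_real_def)
qed

lemma circle_of_real_add_int [simp]: "cr (t + of_int n) = cr t"
  by (auto simp: circle_of_real_eq_iff)

lemma circle_of_real_add_1 [simp]: "cr (t + 1) = cr t"
  using circle_of_real_add_int[of t 1] by simp

lemma circle_of_real_eqD:
  assumes "cr s = cr t" "\<bar>s - t\<bar> < 1"
  shows "s = t"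
proof -
  obtain n :: int where "s = t + of_int n" using assms(1) circle_of_real_eq_iff by blast
  then show ?thesis using assms(2) by auto
qed

lemma circle_cases:
  obtains t where "a \<le> t" "t < a + 1" "x = cr t"
proof -
  have "norm (Rep_circle x) = 1" using Rep_circle[of x] by simp
  then have x: "Rep_circle x = cis (Arg (Rep_circle x))"
    using rcis_cmod_Arg[of "Rep_circle x"] by (simp add: rcis_def)
  define s where "s = Arg (Rep_circle x) / (2 * pi)"
  have "Rep_circle x = Rep_circle (cr s)"
    unfolding Rep_circle_of_real s_def using x by simp
  then have xs: "x = cr s" by (simp add: Rep_circle_inject)
  define t where "t = s + of_int (- \<lfloor>s - a\<rfloor>)"
  have "x = cr t" unfolding t_def xs by (simp only: circle_of_real_add_int)
  moreover have "a \<le> t" "t < a + 1" unfolding t_def by (simp; linarith)+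
  ultimately show ?thesis using that by blast
qed

lemma circle_lift_exists: "\<exists>t. x = cr t"
  using circle_cases by metis

lemma continuous_circle_of_real: "continuous_on S cr"
proof -
  have "continuous_on S (\<lambda>t. cis (2 * pi * t))"
    by (intro continuous_intros)
  then show ?thesis
    unfolding continuous_on_iff dist_circle_def Rep_circle_of_real .
qed

lemma isCont_circle_of_real: "isCont cr t"
  using continuous_circle_of_real[of UNIV] by (simp add: continuous_on_eq_continuous_at)

lemma tendsto_circle_of_real: "(f \<longlongrightarrow> l) F \<Longrightarrow> ((\<lambda>x. cr (f x)) \<longlongrightarrow> cr l) F"
  using isCont_tendsto_compose[OF isCont_circle_of_real] .

lemma circle_of_real_interval_UNIV: "cr ` {a..a+1} = UNIV"
proof -
  have "x \<in> cr ` {a..a+1}" for x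
    by (rule circle_cases[of a x]) auto
  then show ?thesis by blast
qed

lemma compact_circle: "compact (UNIV :: circle set)"
  using compact_continuous_image[OF continuous_circle_of_real compact_Icc, of 0 1]
  by (metis circle_of_real_interval_UNIV add_0)

lemma closed_imp_compact_circle: "closed (S :: circle set) \<Longrightarrow> compact S"
  using closed_Int_compact[OF _ compact_circle, of S] by simp

text \<open>One period covers the circle, so \<open>M\<close> is the image of the compact part of
  its preimage inside \<open>{0..1}\<close>. Topological questions about the circle thereby move to
  the line.\<close>

lemma closed_circle_iff: "closed M \<longleftrightarrow> closed (cr -` M)"
proof
  assume "closed M" then show "closed (cr -` M)"
    by (rule closed_vimage) (rule continuous_circle_of_real)
next
  assume "closed (cr -` M)"
  then have "compact (cr -` M \<inter> {0..1})"
    by (rule closed_Int_compact) simp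
  then have "compact (cr ` (cr -` M \<inter> {0..1}))"
    by (rule compact_continuous_image[OF continuous_circle_of_real])
  moreover have "cr ` (cr -` M \<inter> {0..1}) = M"
  proof -
    have "x \<in> cr ` (cr -` M \<inter> {0..1})" if "x \<in> M" for x
      by (rule circle_cases[of 0 x]) (use that in auto)
    then show ?thesis by auto
  qed
  ultimately show "closed M" by (metis compact_imp_closed)
qed

lemma open_circle_iff: "open M \<longleftrightarrow> open (cr -` M)"
  using closed_circle_iff[of "- M"] by (simp add: open_closed vimage_Compl)

lemma open_circle_of_real_image:
  assumes "open U" shows "open (cr ` U)"
proof -
  have "cr -` cr ` U = (\<Union>n::int. (\<lambda>t. t - of_int n) -` U)"
  proof (intro subset_antisym subsetI)
    fix x assume "x \<in> cr -` cr ` U"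
    then show "x \<in> (\<Union>n::int. (\<lambda>t. t - of_int n) -` U)"
      by (auto simp: circle_of_real_eq_iff) (metis add_diff_cancel_right')
  next
    fix x assume "x \<in> (\<Union>n::int. (\<lambda>t. t - of_int n) -` U)"
    then obtain n :: int where "x - of_int n \<in> U" by auto
    moreover have "cr x = cr (x - of_int n)"
      using circle_of_real_add_int[of "x - of_int n" n] by simp
    ultimately show "x \<in> cr -` cr ` U" by auto
  qed
  moreover have "open ((\<lambda>t. t - of_int n) -` U)" for n :: int
    by (rule open_vimage[OF assms]) (intro continuous_intros)
  ultimately show ?thesis by (simp add: open_circle_iff open_UN)
qed

lemma closed_arc: "closed (cr ` {a..b})"
  by (intro compact_imp_closed compact_continuous_image continuous_circle_of_real compact_Icc)

lemma in_arc_iff: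
  assumes "a \<le> t" "t < a + 1"
  shows "b < a + 1 \<Longrightarrow> cr t \<in> cr ` {a..b} \<longleftrightarrow> t \<le> b"
    and "b \<le> a + 1 \<Longrightarrow> cr t \<in> cr ` {a<..<b} \<longleftrightarrow> a < t \<and> t < b"
  using assms by (auto dest!: circle_of_real_eqD)

lemma Compl_arc:
  assumes "a < b" "b < a + 1"
  shows "- cr ` {a..b} = cr ` {b<..<a+1}"
proof (rule Set.set_eqI)
  fix x
  obtain t where t: "a \<le> t" "t < a + 1" "x = cr t" by (rule circle_cases)
  have 1: "x \<in> cr ` {a..b} \<longleftrightarrow> t \<le> b"
    using in_arc_iff(1)[OF t(1,2) assms(2)] t by simp
  show "x \<in> - cr ` {a..b} \<longleftrightarrow> x \<in> cr ` {b<..<a+1}"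
  proof (cases "t \<le> b")
    case False then show ?thesis using 1 t by auto
  next
    case True
    have "x \<notin> cr ` {b<..<a+1}"
    proof
      assume "x \<in> cr ` {b<..<a+1}"
      then obtain s where s: "b < s" "s < a + 1" "cr t = cr s" using t by auto
      then have "t = s" using t True assms by (intro circle_of_real_eqD) auto
      then show False using True s by simp
    qed
    then show ?thesis using 1 True by simp
  qed
qed

lemma open_circle_arcE:
  assumes "open U" "x \<in> U"
  obtains t e where "e > 0" "x = cr t" "\<And>s. \<bar>s - t\<bar> < e \<Longrightarrow> cr s \<in> U"
proof -
  obtain t where t: "x = cr t" using circle_lift_exists by blast
  have "open (cr -` U)" using assms open_circle_iff by blast
  then obtain e where "e > 0" "\<forall>s. dist s t < e \<longrightarrow> s \<in> cr -` U"
    using assms(2) t unfolding open_dist by blast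
  then show ?thesis using that t by (auto simp: dist_real_def)
qed

section \<open>Lifts to the line and the group of orientation-preserving homeomorphisms\<close>

definition is_lift :: "(circle \<Rightarrow> circle) \<Rightarrow> (real \<Rightarrow> real) \<Rightarrow> bool"
  where "is_lift f F \<longleftrightarrow>
    continuous_on UNIV F \<and> strict_mono F \<and> (\<forall>t. f (cr t) = cr (F t))"

abbreviation Homeo :: "(circle \<Rightarrow> circle) set"
  where "Homeo \<equiv> carrier homeo_plus"

lemma Homeo_iff: "f \<in> Homeo \<longleftrightarrow> (\<exists>g. homeomorphism UNIV UNIV f g) \<and> (\<exists>F. is_lift f F)"
  by (simp add: homeo_plus_def orientation_preserving_def is_lift_def)

lemma Homeo_bij: "f \<in> Homeo \<Longrightarrow> bij f"
  unfolding Homeo_iff homeomorphism_def bij_def by (auto intro!: inj_on_inverseI)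

lemma Homeo_inj: "f \<in> Homeo \<Longrightarrow> inj f" using Homeo_bij bij_is_inj by blast

lemma Homeo_continuous: "f \<in> Homeo \<Longrightarrow> continuous_on S f"
  unfolding Homeo_iff homeomorphism_def using continuous_on_subset by blast

lemma Homeo_lift: "f \<in> Homeo \<Longrightarrow> \<exists>F. is_lift f F"
  unfolding Homeo_iff by blast

lemma is_lift_eq: "is_lift f F \<Longrightarrow> f (cr t) = cr (F t)"
  unfolding is_lift_def by blast

lemma is_lift_less: "is_lift f F \<Longrightarrow> F s < F t \<longleftrightarrow> s < t"
  unfolding is_lift_def using strict_mono_less by blast

lemma is_lift_le: "is_lift f F \<Longrightarrow> F s \<le> F t \<longleftrightarrow> s \<le> t"
  unfolding is_lift_def using strict_mono_less_eq by blast

lemma is_lift_isCont: "is_lift f F \<Longrightarrow> isCont F t"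
  unfolding is_lift_def by (simp add: continuous_on_eq_continuous_at)

lemma is_lift_continuous: "is_lift f F \<Longrightarrow> continuous_on S F"
  unfolding is_lift_def using continuous_on_subset by blast

text \<open>Injectivity of \<open>f\<close> excludes a lift of higher degree.\<close>

lemma is_lift_add_1:
  assumes "inj f" "is_lift f F"
  shows "F (t + 1) = F t + 1"
proof -
  have "cr (F (t + 1)) = cr (F t)"
    using is_lift_eq[OF assms(2)] by (metis circle_of_real_add_1)
  then obtain n :: int where n: "F (t + 1) = F t + of_int n" using circle_of_real_eq_iff by blast
  have "F t < F (t + 1)" using is_lift_less[OF assms(2)] by simp
  then have "n \<ge> 1" using n by simp
  moreover have "\<not> n \<ge> 2"
  proof
    assume "n \<ge> 2"
    then have "F t \<le> F t + 1" "F t + 1 \<le> F (t + 1)" using n by auto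
    then obtain s where s: "t \<le> s" "s \<le> t + 1" "F s = F t + 1"
      using IVT'[of F t "F t + 1" "t + 1"] is_lift_continuous[OF assms(2)] by auto
    have "F s < F (t + 1)" using s n \<open>n \<ge> 2\<close> by simp
    then have "s < t + 1" using is_lift_less[OF assms(2)] by simp
    have "f (cr s) = f (cr t)"
      unfolding is_lift_eq[OF assms(2)] s by simp
    then have "cr s = cr t" using assms(1) by (simp add: inj_eq)
    then have "s = t" using s \<open>s < t + 1\<close> by (intro circle_of_real_eqD) auto
    then show False using s by simp
  qed
  ultimately have "n = 1" by simp
  then show ?thesis using n by simp
qed

lemma is_lift_add_int:
  assumes "inj f" "is_lift f F"
  shows "F (t + of_int n) = F t + of_int n"
proof -
  have *: "F (t + of_nat k) = F t + of_nat k" for k :: nat and t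
  proof (induction k)
    case (Suc k)
    have "F (t + of_nat (Suc k)) = F ((t + of_nat k) + 1)" by (simp add: algebra_simps)
    also have "\<dots> = F t + of_nat (Suc k)" unfolding is_lift_add_1[OF assms] Suc by simp
    finally show ?case .
  qed simp
  show ?thesis
  proof (cases "n \<ge> 0")
    case True then show ?thesis using *[of t "nat n"] by simp
  next
    case False
    have "F t = F ((t + of_int n) + of_nat (nat (- n)))" using False by simp
    also have "\<dots> = F (t + of_int n) + of_nat (nat (- n))" by (rule *)
    finally show ?thesis using False by simp
  qed
qed

lemma is_lift_shift: "is_lift f F \<Longrightarrow> is_lift f (\<lambda>t. F t + of_int n)"
  unfolding is_lift_def by (auto intro!: continuous_intros simp: strict_mono_def)

text \<open>Lifts may be shifted by integers, and this freedom prescribes one value. At a fixed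
  point it yields a lift that fixes \<open>t\<close>, which keeps the period from \<open>t\<close>
  to \<open>t + 1\<close> invariant.\<close>

lemma lift_through:
  assumes "f \<in> Homeo" "f (cr t) = cr s"
  obtains F where "is_lift f F" "F t = s"
proof -
  obtain F where F: "is_lift f F" using Homeo_lift assms by blast
  then have "cr s = cr (F t)" using assms is_lift_eq by metis
  then obtain n :: int where "s = F t + of_int n" using circle_of_real_eq_iff by blast
  then show ?thesis using that[OF is_lift_shift[OF F, of n]] by simp
qed

lemma is_lift_surj:
  assumes "inj f" "is_lift f F" shows "surj F"
proof -
  have "\<exists>t. F t = y" for y
  proof -
    obtain n :: int where n: "of_int n > \<bar>y - F 0\<bar>"
      using ex_less_of_int by blast
    have "F (- of_int n) \<le> y" "y \<le> F (of_int n)"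
      using is_lift_add_int[OF assms, of 0 n] is_lift_add_int[OF assms, of 0 "-n"] n by auto
    moreover have "- of_int n \<le> real_of_int n" using n by linarith
    ultimately show ?thesis
      using IVT'[of F "- of_int n" y "of_int n"] is_lift_continuous[OF assms(2)] by auto
  qed
  then show ?thesis unfolding surj_def by metis
qed

lemma strict_mono_inv:
  assumes "strict_mono (F :: real \<Rightarrow> real)" "surj F" shows "strict_mono (invf F)"
proof (rule strict_monoI)
  fix x y :: real assume "x < y"
  then have "F (invf F x) < F (invf F y)" by (simp add: surj_f_inv_f[OF assms(2)])
  then show "invf F x < invf F y" using strict_mono_less[OF assms(1)] by blast
qed

text \<open>A jump of an increasing function would leave a gap in its range.\<close>

lemma strict_mono_surj_continuous:
  assumes "strict_mono (F :: real \<Rightarrow> real)" "surj F" shows "continuous_on UNIV F"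
  by (rule continuous_onI_mono) (use assms in \<open>auto simp: strict_mono_less_eq\<close>)

lemma is_lift_inv:
  assumes "f \<in> Homeo" "is_lift f F"
  shows "is_lift (invf f) (invf F)"
proof -
  have s: "surj F" using is_lift_surj assms Homeo_inj by blast
  have m: "strict_mono F" using assms unfolding is_lift_def by blast
  have mi: "strict_mono (invf F)" using strict_mono_inv s m by blast
  have "surj (invf F)" using m strict_mono_imp_inj_on inj_imp_surj_inv by blast
  then have "continuous_on UNIV (invf F)" using mi strict_mono_surj_continuous by blast
  moreover have "invf f (cr t) = cr (invf F t)" for t
    using is_lift_eq[OF assms(2), of "invf F t"] Homeo_inj[OF assms(1)]
    by (simp add: surj_f_inv_f[OF s] inv_f_eq)
  ultimately show ?thesis unfolding is_lift_def using mi by blast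
qed

lemma is_lift_comp:
  assumes "is_lift f F" "is_lift g H" shows "is_lift (f \<circ> g) (F \<circ> H)"
  using assms continuous_on_compose[of UNIV H F] continuous_on_subset[of UNIV F "range H"]
  unfolding is_lift_def by (auto simp: strict_mono_def)

lemma Homeo_comp: "f \<in> Homeo \<Longrightarrow> g \<in> Homeo \<Longrightarrow> f \<circ> g \<in> Homeo"
  unfolding Homeo_iff using is_lift_comp homeomorphism_compose by blast

lemma Homeo_id: "id \<in> Homeo"
proof -
  have "is_lift id id" by (simp add: is_lift_def strict_mono_def)
  moreover have "homeomorphism UNIV UNIV id (id :: circle \<Rightarrow> circle)" by (simp add: homeomorphism_def)
  ultimately show ?thesis unfolding Homeo_iff by blast
qed

lemma Homeo_inv: assumes "f \<in> Homeo" shows "invf f \<in> Homeo"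
proof -
  obtain g where g: "homeomorphism UNIV UNIV f g" using assms Homeo_iff by blast
  then have "invf f = g"
    using Homeo_inj[OF assms] homeomorphism_apply2[OF g] by (intro ext inv_f_eq) auto
  then have "homeomorphism UNIV UNIV (invf f) f" using g homeomorphism_sym by blast
  then show ?thesis using is_lift_inv assms Homeo_iff by blast
qed

lemma Homeo_inv_f [simp]: "f \<in> Homeo \<Longrightarrow> invf f (f x) = x"
  by (simp add: Homeo_inj)

lemma Homeo_f_inv [simp]: "f \<in> Homeo \<Longrightarrow> f (invf f x) = x"
  by (simp add: Homeo_bij bij_is_surj surj_f_inv_f)

lemma Homeo_eq_iff: "f \<in> Homeo \<Longrightarrow> f x = f y \<longleftrightarrow> x = y"
  using Homeo_inj by (simp add: inj_eq)

lemma Homeo_closed_image: assumes "f \<in> Homeo" "closed M" shows "closed (f ` M)"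
  by (rule compact_imp_closed[OF compact_continuous_image[OF Homeo_continuous[OF assms(1)]
        closed_imp_compact_circle[OF assms(2)]]])

lemma Homeo_fixed_closed: assumes "f \<in> Homeo" shows "closed {x. f x = x}"
  by (intro closed_Collect_eq Homeo_continuous assms continuous_on_id)

lemma homeo_plus_simps [simp]:
  "f \<otimes>\<^bsub>homeo_plus\<^esub> g = g \<circ> f" "\<one>\<^bsub>homeo_plus\<^esub> = id"
  by (simp_all add: homeo_plus_def)

text \<open>Computed from the definite description that defines \<open>m_inv\<close>;
  \<open>homeo_plus\<close> is treated as a mere record of operations.\<close>

lemma m_inv_homeo_plus:
  assumes f: "f \<in> Homeo" shows "m_inv homeo_plus f = invf f"
  unfolding m_inv_def
proof (rule the_equality)
  show "invf f \<in> Homeo \<and> f \<otimes>\<^bsub>homeo_plus\<^esub> invf f = \<one>\<^bsub>homeo_plus\<^esub> \<and> invf f \<otimes>\<^bsub>homeo_plus\<^esub> f = \<one>\<^bsub>homeo_plus\<^esub>"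
    using f Homeo_inv by (auto simp: fun_eq_iff)
  fix g assume "g \<in> Homeo \<and> f \<otimes>\<^bsub>homeo_plus\<^esub> g = \<one>\<^bsub>homeo_plus\<^esub> \<and> g \<otimes>\<^bsub>homeo_plus\<^esub> f = \<one>\<^bsub>homeo_plus\<^esub>"
  then have "g (f x) = x" "f (g x) = x" for x by (auto simp: fun_eq_iff)
  then show "g = invf f" using Homeo_inj[OF f] by (intro ext inv_f_eq[symmetric]) auto
qed

lemma subgroup_closed:
  assumes "subgroup G homeo_plus"
  shows "G \<subseteq> Homeo" "id \<in> G" "f \<in> G \<Longrightarrow> g \<in> G \<Longrightarrow> f \<circ> g \<in> G" "f \<in> G \<Longrightarrow> invf f \<in> G"
proof -
  show s: "G \<subseteq> Homeo" using assms subgroup.subset by blast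
  show "id \<in> G" using subgroup.one_closed[OF assms] by simp
  show "f \<circ> g \<in> G" if "f \<in> G" "g \<in> G" using subgroup.m_closed[OF assms that(2,1)] by simp
  show "invf f \<in> G" if "f \<in> G"
  proof -
    have f: "f \<in> Homeo" using that s by blast
    have "m_inv homeo_plus f = invf f" using m_inv_homeo_plus f .
    then show ?thesis using subgroup.m_inv_closed[OF assms that] by simp
  qed
qed

lemma subgroup_homeo_plusI:
  assumes "A \<subseteq> Homeo" "id \<in> A" "\<And>f g. f \<in> A \<Longrightarrow> g \<in> A \<Longrightarrow> f \<circ> g \<in> A" "\<And>f. f \<in> A \<Longrightarrow> invf f \<in> A"
  shows "subgroup A homeo_plus"
proof (rule subgroup.intro)
  show "m_inv homeo_plus f \<in> A" if "f \<in> A" for f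
  proof -
    have "f \<in> Homeo" using that assms(1) by blast
    then show ?thesis using m_inv_homeo_plus assms(4)[OF that] by simp
  qed
qed (use assms in auto)

text \<open>On the period that starts at \<open>t\<close>, both lifts take values from
  \<open>F t\<close> up to, but excluding, \<open>F t + 1\<close>, and these agree modulo 1.
  Equivariance under integer translations does the rest.\<close>

lemma lift_unique:
  assumes f: "inj f" and F: "is_lift f F" and K: "is_lift f K" and t: "F t = K t"
  shows "F = K"
proof
  fix s
  define n where "n = \<lfloor>s - t\<rfloor>"
  define u where "u = s - of_int n"
  have su: "s = u + of_int n" by (simp add: u_def)
  have u: "t \<le> u" "u < t + 1" unfolding u_def n_def by linarith+
  have "F t \<le> F u" "F u < F t + 1" "F t \<le> K u" "K u < F t + 1"
    using is_lift_le[OF F, of t u] is_lift_less[OF F, of u "t + 1"] is_lift_le[OF K, of t u]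
      is_lift_less[OF K, of u "t + 1"] u t is_lift_add_1[OF f F, of t] is_lift_add_1[OF f K, of t] by auto
  moreover have "cr (F u) = cr (K u)"
    using is_lift_eq[OF F, of u] is_lift_eq[OF K, of u] by simp
  ultimately have "F u = K u" by (intro circle_of_real_eqD) auto
  then show "F s = K s" unfolding su is_lift_add_int[OF f F] is_lift_add_int[OF f K] by simp
qed

section \<open>Hoelder's theorem on invariant sets\<close>

text \<open>Freeness is relative to \<open>S\<close>: an element fixing one point of
  \<open>S\<close> fixes \<open>S\<close> pointwise, but may move points elsewhere. Comparing values
  at any point of \<open>S\<close> then gives a bi-invariant Archimedean order on \<open>L\<close>
  modulo the elements trivial on \<open>S\<close>, and such a group is abelian.\<close>

locale hoelder =
  fixes L :: "(real \<Rightarrow> real) set" and S :: "real set"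
  assumes id_L: "id \<in> L"
    and comp_L: "F \<in> L \<Longrightarrow> K \<in> L \<Longrightarrow> F \<circ> K \<in> L"
    and inverse_L: "F \<in> L \<Longrightarrow> \<exists>K\<in>L. (\<forall>x. K (F x) = x) \<and> (\<forall>x. F (K x) = x)"
    and mono_L: "F \<in> L \<Longrightarrow> strict_mono F"
    and cont_L: "F \<in> L \<Longrightarrow> isCont F x"
    and closed_S: "closed S"
    and invariant_S: "F \<in> L \<Longrightarrow> x \<in> S \<Longrightarrow> F x \<in> S"
    and fixed_S: "F \<in> L \<Longrightarrow> x \<in> S \<Longrightarrow> F x = x \<Longrightarrow> y \<in> S \<Longrightarrow> F y = y"
begin

lemma less_L: "F \<in> L \<Longrightarrow> F x < F y \<longleftrightarrow> x < y"
  using mono_L strict_mono_less by blast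

lemma le_L: "F \<in> L \<Longrightarrow> F x \<le> F y \<longleftrightarrow> x \<le> y"
  using mono_L strict_mono_less_eq by blast

lemma pow_L: "F \<in> L \<Longrightarrow> F ^^ n \<in> L"
  by (induction n) (auto intro: id_L comp_L)

text \<open>The Archimedean property. A bounded increasing orbit would converge to a fixed point of
  \<open>F\<close>, which lies in \<open>S\<close> because \<open>S\<close> is closed; by freeness
  \<open>x\<close> would be fixed as well.\<close>

lemma iterate_unbounded:
  assumes F: "F \<in> L" and x: "x \<in> S" "x < F x"
  shows "\<exists>n. z < (F ^^ n) x"
proof (rule ccontr)
  assume "\<nexists>n. z < (F ^^ n) x"
  then have bd: "(F ^^ n) x \<le> z" for n by (simp add: not_less)
  have inc: "(F ^^ n) x \<le> (F ^^ Suc n) x" for n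
    using le_L[OF pow_L[OF F, of n], of x "F x"] x by (simp add: funpow_swap1)
  then have "incseq (\<lambda>n. (F ^^ n) x)" by (intro incseq_SucI)
  then obtain l where l: "(\<lambda>n. (F ^^ n) x) \<longlonglongrightarrow> l"
    using incseq_convergent bd by blast
  have "l \<in> S"
    using closed_sequentially[OF closed_S _ l] invariant_S[OF pow_L[OF F] x(1)] by blast
  have "(\<lambda>n. F ((F ^^ n) x)) \<longlonglongrightarrow> F l" using isCont_tendsto_compose[OF cont_L[OF F] l] .
  moreover have "(\<lambda>n. F ((F ^^ n) x)) \<longlonglongrightarrow> l" using LIMSEQ_Suc[OF l] by simp
  ultimately have "F l = l" using LIMSEQ_unique by blast
  then have "F x = x" using fixed_S F \<open>l \<in> S\<close> x by blast
  then show False using x by simp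
qed

text \<open>If \<open>F y \<le> y\<close>, then \<open>y\<close> bounds the whole orbit of
  \<open>x\<close>.\<close>

lemma sign_aux:
  assumes F: "F \<in> L" and xy: "x \<in> S" "y \<in> S" "x < y" "x < F x" shows "y < F y"
proof (rule ccontr)
  assume "\<not> y < F y"
  have "(F ^^ n) x \<le> y" for n
  proof (induction n)
    case (Suc n)
    then have "F ((F ^^ n) x) \<le> F y" using le_L[OF F] by blast
    then show ?case using \<open>\<not> y < F y\<close> by simp
  qed (use xy in simp)
  then show False using iterate_unbounded[OF F xy(1,4), of y] by (auto simp: not_less[symmetric])
qed

text \<open>\<open>sign_aux\<close> propagates only to the right. If \<open>y\<close> lies to the
  left of \<open>x\<close> and is moved to the left, then the inverse of \<open>F\<close> moves
  \<open>y\<close> to the right, hence also \<open>x\<close>.\<close>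

lemma sign_constant:
  assumes F: "F \<in> L" and xy: "x \<in> S" "y \<in> S" "x < F x" shows "y < F y"
proof (rule ccontr)
  assume n: "\<not> y < F y"
  then have "\<not> x < y" "x \<noteq> y" using sign_aux[OF F xy(1,2) _ xy(3)] xy(3) by auto
  then have "y < x" by simp
  have "F y \<noteq> y" using fixed_S[OF F xy(2) _ xy(1)] xy(3) by auto
  then have "F y < y" using n by simp
  obtain K where K: "K \<in> L" "\<And>x. K (F x) = x" "\<And>x. F (K x) = x" using inverse_L[OF F] by blast
  have "y < K y" using less_L[OF F, of y "K y"] K \<open>F y < y\<close> by simp
  then have "x < K x" using sign_aux[OF K(1) xy(2,1) \<open>y < x\<close>] by simp
  then have "F x < x" using less_L[OF F, of x "K x"] K by simp
  then show False using xy by simp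
qed

lemma compare_constant:
  assumes F: "F \<in> L" and K: "K \<in> L" and xy: "x \<in> S" "y \<in> S" "F x < K x" shows "F y < K y"
proof -
  obtain F' where F': "F' \<in> L" "\<And>x. F' (F x) = x" "\<And>x. F (F' x) = x" using inverse_L[OF F] by blast
  have "x < (F' \<circ> K) x" using less_L[OF F, of x "F' (K x)"] F' xy by simp
  then have "y < (F' \<circ> K) y" using sign_constant[OF comp_L[OF F'(1) K] xy(1,2)] by simp
  then show ?thesis using less_L[OF F, of y "F' (K y)"] F' by simp
qed

lemma compare_constant_le:
  assumes F: "F \<in> L" and K: "K \<in> L" and xy: "x \<in> S" "y \<in> S" "F x \<le> K x" shows "F y \<le> K y"
  using compare_constant[OF K F xy(2,1)] xy(3) by (auto simp: not_less[symmetric])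

lemma pow_bracket:
  assumes D: "D \<in> L" and F: "F \<in> L" and x: "x \<in> S" "x < D x" "x \<le> F x"
  obtains n where "(D ^^ n) x \<le> F x" "F x < (D ^^ Suc n) x"
proof -
  define n where "n = (LEAST n. F x < (D ^^ n) x)"
  have ex: "\<exists>n. F x < (D ^^ n) x" using iterate_unbounded[OF D x(1,2)] .
  then have 1: "F x < (D ^^ n) x" unfolding n_def by (rule LeastI_ex)
  then have "n \<noteq> 0" using x(3) by (intro notI) simp
  then obtain m where m: "n = Suc m" using not0_implies_Suc by blast
  then have "\<not> F x < (D ^^ m) x" using not_less_Least[of m "\<lambda>n. F x < (D ^^ n) x"] unfolding n_def by simp
  then show ?thesis using that[of m] 1 m by simp
qed

text \<open>The dichotomy in Hoelder's theorem, for a positive commutator \<open>C\<close>. If some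
  positive \<open>D\<close> has \<open>D\<^sup>2 \<le> C\<close>, then \<open>F\<close> and
  \<open>K\<close> lie between consecutive powers of \<open>D\<close>, which makes their commutator
  smaller than \<open>D\<^sup>2\<close>. Otherwise the order is discrete, and \<open>F\<close> and
  \<open>K\<close> agree on \<open>S\<close> with powers of \<open>C\<close>, which commute.\<close>

lemma no_positive_commutator:
  assumes F: "F \<in> L" and K: "K \<in> L" and x: "x \<in> S" "x < F x" "x < K x"
  shows "\<not> K (F x) < F (K x)"
proof
  assume c: "K (F x) < F (K x)"
  obtain F' where F': "F' \<in> L" "\<And>x. F' (F x) = x" "\<And>x. F (F' x) = x" using inverse_L[OF F] by blast
  obtain K' where K': "K' \<in> L" "\<And>x. K' (K x) = x" "\<And>x. K (K' x) = x" using inverse_L[OF K] by blast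
  define C where "C = F \<circ> K \<circ> F' \<circ> K'"
  have C: "C \<in> L" unfolding C_def by (intro comp_L F K F'(1) K'(1))
  have Ceq: "C (K (F y)) = F (K y)" for y by (simp add: C_def F' K')
  have KF: "K (F y) \<in> S" if "y \<in> S" for y using that F K invariant_S by blast
  have Cpos: "y < C y" if "y \<in> S" for y
    using sign_constant[OF C KF[OF x(1)] that] c Ceq by simp
  show False
  proof (cases "\<exists>D\<in>L. x < D x \<and> D (D x) \<le> C x")
    case True
    then obtain D where D: "D \<in> L" "x < D x" "D (D x) \<le> C x" by blast
    have DD: "D (D y) \<le> C y" if "y \<in> S" for y
      using compare_constant_le[OF comp_L[OF D(1) D(1)] C x(1) that] D by simp
    obtain m where m: "(D ^^ m) x \<le> F x" "F x < (D ^^ Suc m) x"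
      using pow_bracket[OF D(1) F x(1) D(2)] x by auto
    obtain n where n: "(D ^^ n) x \<le> K x" "K x < (D ^^ Suc n) x"
      using pow_bracket[OF D(1) K x(1) D(2)] x by auto
    have S: "K x \<in> S" "F x \<in> S" using F K invariant_S x by auto
    \<comment> \<open>The brackets give \<open>F K < D ^^ (m + n + 2)\<close> and
      \<open>D ^^ (n + m) \<le> K F\<close>. The two surplus factors \<open>D\<close> are absorbed
      by \<open>C\<close>, and \<open>C K F = F K\<close> closes the circle.\<close>
    have "F (K x) < (D ^^ Suc m) (K x)"
      using compare_constant[OF F pow_L[OF D(1)] x(1) S(1) m(2)] .
    also have "\<dots> < (D ^^ Suc m) ((D ^^ Suc n) x)"
      using less_L[OF pow_L[OF D(1)]] n(2) by blast
    also have "\<dots> = D (D ((D ^^ n) ((D ^^ m) x)))"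
    proof -
      have "(D ^^ Suc m) ((D ^^ Suc n) x) = (D ^^ (Suc m + Suc n)) x"
        by (simp only: funpow_add comp_apply)
      also have "Suc m + Suc n = Suc (Suc (n + m))" by simp
      finally show ?thesis by (simp only: funpow_add funpow.simps comp_apply)
    qed
    also have "\<dots> \<le> D (D ((D ^^ n) (F x)))"
      using m(1) le_L[OF D(1)] le_L[OF pow_L[OF D(1)]] by simp
    also have "\<dots> \<le> D (D (K (F x)))"
      using compare_constant_le[OF pow_L[OF D(1)] K x(1) S(2) n(1)] le_L[OF D(1)] by simp
    also have "\<dots> \<le> C (K (F x))" using DD KF x by blast
    also have "\<dots> = F (K x)" by (rule Ceq)
    finally show False by simp
  next
    case False
    text \<open>Then \<open>C\<close> is the least positive element, so \<open>F\<close> and \<open>K\<close> act as powers of \<open>C\<close>.\<close>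
    have least: "C x \<le> D x" if D: "D \<in> L" "x < D x" for D
    proof (rule ccontr)
      assume "\<not> C x \<le> D x"
      obtain D' where D': "D' \<in> L" "\<And>x. D' (D x) = x" "\<And>x. D (D' x) = x" using inverse_L[OF D(1)] by blast
      \<comment> \<open>From \<open>D < C < D\<^sup>2\<close> the quotient \<open>E\<close> of
        \<open>C\<close> by \<open>D\<close> is positive and smaller than \<open>D\<close>, so
        \<open>E\<^sup>2 < E D = C\<close>, against the assumption of this case.\<close>
      define E where "E = C \<circ> D'"
      have E: "E \<in> L" unfolding E_def by (intro comp_L C D')
      have Dx: "D x \<in> S" "D' x \<in> S" using D D' invariant_S x by auto
      have "D x < E (D x)" using \<open>\<not> C x \<le> D x\<close> by (simp add: E_def D')
      then have "x < E x" using sign_constant[OF E Dx(1) x(1)] by simp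
      have "C x < D (D x)" using False D by auto
      then have "C (D' x) < D (D (D' x))"
        using compare_constant[OF C comp_L[OF D(1) D(1)] x(1) Dx(2)] by simp
      then have "E x < D x" by (simp add: E_def D')
      have Ex: "E x \<in> S" using E invariant_S x by auto
      have "E (E x) < E (D x)" using less_L[OF E] \<open>E x < D x\<close> by blast
      also have "\<dots> = C x" by (simp add: E_def D')
      finally show False using False E \<open>x < E x\<close> by force
    qed
    have pw: "\<exists>n. \<forall>y\<in>S. H y = (C ^^ n) y" if H: "H \<in> L" "x < H x" for H
    proof -
      obtain n where n: "(C ^^ n) x \<le> H x" "H x < (C ^^ Suc n) x"
        using pow_bracket[OF C H(1) x(1) Cpos[OF x(1)]] H by auto
      \<comment> \<open>Dividing \<open>H\<close> by the bracketing power of \<open>C\<close> leaves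
        an element that sends \<open>x\<close> to a point at or after \<open>x\<close> and before
        \<open>C x\<close>. As \<open>C\<close> is least, this element fixes \<open>x\<close>, hence
        all of \<open>S\<close>.\<close>
      obtain P where P: "P \<in> L" "\<And>x. P ((C ^^ n) x) = x" "\<And>x. (C ^^ n) (P x) = x"
        using inverse_L[OF pow_L[OF C]] by blast
      have "(C ^^ n) (P (H x)) < (C ^^ n) (C x)"
        using n P by (simp add: funpow_swap1)
      then have "P (H x) < C x" using less_L[OF pow_L[OF C]] by blast
      then have "P (H x) \<le> x" using least[OF comp_L[OF P(1) H(1)]] by fastforce
      moreover have "(C ^^ n) x \<le> (C ^^ n) (P (H x))" using n P by simp
      then have "x \<le> P (H x)" using le_L[OF pow_L[OF C]] by blast
      ultimately have "(P \<circ> H) x = x" by simp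
      then have "(P \<circ> H) y = y" if "y \<in> S" for y
        using fixed_S[OF comp_L[OF P(1) H(1)] x(1) _ that] by simp
      then have "H y = (C ^^ n) y" if "y \<in> S" for y using that P(3)[of "H y"] by simp
      then show ?thesis by blast
    qed
    obtain m where m: "\<And>y. y \<in> S \<Longrightarrow> F y = (C ^^ m) y" using pw[OF F x(2)] by blast
    obtain n where n: "\<And>y. y \<in> S \<Longrightarrow> K y = (C ^^ n) y" using pw[OF K x(3)] by blast
    have S: "(C ^^ n) x \<in> S" "(C ^^ m) x \<in> S" using pow_L[OF C] invariant_S x by auto
    have "F (K x) = (C ^^ (m + n)) x" using m n x S by (simp add: funpow_add)
    also have "\<dots> = K (F x)" using m n x S by (simp add: add.commute[of m] funpow_add)
    finally show False using c by simp
  qed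
qed

lemma commute_positive:
  assumes F: "F \<in> L" and K: "K \<in> L" and x: "x \<in> S" "x < F x" "x < K x"
  shows "F (K x) = K (F x)"
  using no_positive_commutator[OF F K x] no_positive_commutator[OF K F x(1,3,2)] by simp

lemma commute_if_inverse_commutes:
  assumes F: "F \<in> L" and K: "K \<in> L" "\<And>x. K (F x) = x" "\<And>x. F (K x) = x"
    and H: "\<And>x. x \<in> S \<Longrightarrow> H (K x) = K (H x)" and x: "x \<in> S"
  shows "H (F x) = F (H x)"
proof -
  have "F x \<in> S" using F x invariant_S by blast
  then have "H (K (F x)) = K (H (F x))" using H by blast
  then have "F (H x) = F (K (H (F x)))" using K by simp
  then show ?thesis using K by simp
qed

theorem commute:
  assumes F: "F \<in> L" and K: "K \<in> L" and x: "x \<in> S"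
  shows "F (K x) = K (F x)"
proof -
  have pos: "x < K x \<Longrightarrow> F (K x) = K (F x)" if K: "K \<in> L" and x: "x \<in> S" for K x
  proof -
    assume Kx: "x < K x"
    consider "F x = x" | "x < F x" | "F x < x" by linarith
    then show "F (K x) = K (F x)"
    proof cases
      case 1
      then have "F (K x) = K x" using fixed_S[OF F x _ invariant_S[OF K x]] by blast
      then show ?thesis using 1 by simp
    next
      case 2 then show ?thesis using commute_positive[OF F K x _ Kx] by blast
    next
      case 3
      obtain F' where F': "F' \<in> L" "\<And>x. F' (F x) = x" "\<And>x. F (F' x) = x" using inverse_L[OF F] by blast
      have "x < F' x" using 3 less_L[OF F, of x "F' x"] F' by simp
      then have "F' (K y) = K (F' y)" if "y \<in> S" for y
        using commute_positive[OF F'(1) K that] sign_constant[OF K x that Kx] sign_constant[OF F'(1) x that]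
        by blast
      then show ?thesis using commute_if_inverse_commutes[OF F F', of K] x by simp
    qed
  qed
  consider "K x = x" | "x < K x" | "K x < x" by linarith
  then show ?thesis
  proof cases
    case 1
    then have "K (F x) = F x" using fixed_S[OF K x _ invariant_S[OF F x]] by blast
    then show ?thesis using 1 by simp
  next
    case 2 then show ?thesis using pos K x by blast
  next
    case 3
    obtain K' where K': "K' \<in> L" "\<And>x. K' (K x) = x" "\<And>x. K (K' x) = x" using inverse_L[OF K] by blast
    have "x < K' x" using 3 less_L[OF K, of x "K' x"] K' by simp
    then have "F (K' y) = K' (F y)" if "y \<in> S" for y
      using pos[OF K'(1) that] sign_constant[OF K'(1) x that] by blast
    then show ?thesis using commute_if_inverse_commutes[OF K K', of F] x by simp
  qed
qed

end

text \<open>The order argument lives on the line, so it is applied to all lifts of elements of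
  \<open>A\<close>, acting on the preimage of \<open>M\<close>.\<close>

lemma hoelder_circle:
  assumes A: "subgroup A homeo_plus" and M: "closed M"
    and inv: "\<And>a x. a \<in> A \<Longrightarrow> x \<in> M \<Longrightarrow> a x \<in> M"
    and free: "\<And>a x y. a \<in> A \<Longrightarrow> x \<in> M \<Longrightarrow> a x = x \<Longrightarrow> y \<in> M \<Longrightarrow> a y = y"
    and ab: "a \<in> A" "b \<in> A" "x \<in> M"
  shows "a (b x) = b (a x)"
proof -
  define L where "L = {F. \<exists>f\<in>A. is_lift f F}"
  define S where "S = cr -` M"
  note sub = subgroup_closed[OF A]
  have LE: "\<exists>f\<in>A. f \<in> Homeo \<and> is_lift f F" if "F \<in> L" for F
    using that sub(1) unfolding L_def by blast
  interpret hoelder L S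
  proof
    have "is_lift id id" by (simp add: is_lift_def strict_mono_def)
    then show "id \<in> L" using sub(2) unfolding L_def by blast
    show "F \<circ> K \<in> L" if "F \<in> L" "K \<in> L" for F K
      using that is_lift_comp sub(3) unfolding L_def by blast
    show "\<exists>K\<in>L. (\<forall>x. K (F x) = x) \<and> (\<forall>x. F (K x) = x)" if F: "F \<in> L" for F
    proof -
      obtain f where f: "f \<in> A" "f \<in> Homeo" "is_lift f F" using LE[OF F] by blast
      have "invf F \<in> L" using f is_lift_inv sub(4) unfolding L_def by blast
      moreover have "invf F (F x) = x" for x
        using f(3) strict_mono_imp_inj_on[of F] unfolding is_lift_def by simp
      moreover have "F (invf F x) = x" for x
        using is_lift_surj[OF Homeo_inj f(3)] f(2) by (simp add: surj_f_inv_f)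
      ultimately show ?thesis by blast
    qed
    show "strict_mono F" if "F \<in> L" for F using LE[OF that] unfolding is_lift_def by blast
    show "isCont F x" if "F \<in> L" for F x using LE[OF that] is_lift_isCont by blast
    show "closed S" unfolding S_def using M closed_circle_iff by blast
    show "F x \<in> S" if F: "F \<in> L" and x: "x \<in> S" for F x
    proof -
      obtain f where f: "f \<in> A" "is_lift f F" using LE[OF F] by blast
      have "f (cr x) \<in> M" using inv f(1) x unfolding S_def by blast
      then show ?thesis using is_lift_eq[OF f(2)] unfolding S_def by simp
    qed
    show "F y = y" if F: "F \<in> L" and x: "x \<in> S" "F x = x" and y: "y \<in> S" for F x y
    proof -
      obtain f where f: "f \<in> A" "f \<in> Homeo" "is_lift f F" using LE[OF F] by blast
      have "f (cr x) = cr x" using is_lift_eq[OF f(3), of x] x by simp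
      then have fy: "f (cr y) = cr y"
        using free f(1) x(1) y unfolding S_def by blast
      \<comment> \<open>That \<open>f\<close> fixes \<open>cr y\<close> only makes
        \<open>F y - y\<close> an integer. The fixed point \<open>x\<close> of \<open>F\<close>
        keeps the period starting at \<open>x\<close> invariant, which forces this integer to be
        zero.\<close>
      define n where "n = \<lfloor>y - x\<rfloor>"
      define s where "s = y - of_int n"
      have ys: "y = s + of_int n" by (simp add: s_def)
      have s: "x \<le> s" "s < x + 1" unfolding s_def n_def by linarith+
      have "x \<le> F s" "F s < x + 1"
        using is_lift_le[OF f(3), of x s] is_lift_less[OF f(3), of s "x + 1"] s x(2)
          is_lift_add_1[OF Homeo_inj[OF f(2)] f(3), of x] by auto
      moreover have "cr (F s) = cr s"
        using fy is_lift_eq[OF f(3), of s] unfolding ys by simp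
      ultimately have "F s = s" using s by (intro circle_of_real_eqD) auto
      then show "F y = y" unfolding ys using is_lift_add_int[OF Homeo_inj[OF f(2)] f(3)] by simp
    qed
  qed
  obtain t where t: "x = cr t" using circle_lift_exists by blast
  obtain F where F: "is_lift a F" using Homeo_lift ab sub(1) by blast
  obtain K where K: "is_lift b K" using Homeo_lift ab sub(1) by blast
  have "F (K t) = K (F t)"
    by (rule commute) (use F K ab t in \<open>auto simp: L_def S_def\<close>)
  then show ?thesis unfolding t using is_lift_eq[OF F] is_lift_eq[OF K] by simp
qed

section \<open>Minimal sets and commuting conjugate groups\<close>

text \<open>Zorn's lemma is run on the open complements. Compactness keeps the union of a nonempty
  chain proper: a finite subcover taken from a chain would reduce to a single member.\<close>

lemma minimal_set_exists:
  fixes A :: "('a::topological_space \<Rightarrow> 'a) set"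
  assumes comp: "compact (UNIV :: 'a set)"
  obtains M where "closed M" "M \<noteq> {}" "\<And>a x. a \<in> A \<Longrightarrow> x \<in> M \<Longrightarrow> a x \<in> M"
    "\<And>N. closed N \<Longrightarrow> N \<noteq> {} \<Longrightarrow> N \<subseteq> M \<Longrightarrow> (\<And>a x. a \<in> A \<Longrightarrow> x \<in> N \<Longrightarrow> a x \<in> N) \<Longrightarrow> N = M"
proof -
  define \<U> where "\<U> = {U :: 'a set. open U \<and> U \<noteq> UNIV \<and> (\<forall>a\<in>A. \<forall>x. x \<notin> U \<longrightarrow> a x \<notin> U)}"
  have "\<exists>W\<in>\<U>. \<forall>X\<in>C. X \<subseteq> W" if C: "subset.chain \<U> C" for C
  proof (cases "C = {}")
    case True
    have "{} \<in> \<U>" by (simp add: \<U>_def)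
    then show ?thesis using True by blast
  next
    case False
    have CU: "C \<subseteq> \<U>" using C by (simp add: subset_chain_def)
    have "\<Union>C \<noteq> UNIV"
    proof
      assume "\<Union>C = UNIV"
      moreover have "open X" if "X \<in> C" for X using that CU by (auto simp: \<U>_def)
      ultimately obtain D where D: "D \<subseteq> C" "finite D" "UNIV \<subseteq> \<Union>D"
        by (metis compactE[OF comp, of C] order_refl)
      have "D \<noteq> {}" using D(3) by auto
      moreover have "subset.chain \<U> D"
        using C D(1) unfolding subset_chain_def by (meson subsetD subset_trans)
      ultimately have "\<Union>D \<in> D" using D(2) Union_in_chain by blast
      then have "UNIV \<in> \<U>" using D CU top.extremum_uniqueI[OF D(3)] by auto
      then show False by (simp add: \<U>_def)
    qed
    moreover have "open (\<Union>C)" using CU unfolding \<U>_def by blast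
    moreover have "\<forall>a\<in>A. \<forall>x. x \<notin> \<Union>C \<longrightarrow> a x \<notin> \<Union>C" using CU unfolding \<U>_def by blast
    ultimately have "\<Union>C \<in> \<U>" by (simp add: \<U>_def)
    then show ?thesis by blast
  qed
  then have "\<exists>W\<in>\<U>. \<forall>X\<in>\<U>. W \<subseteq> X \<longrightarrow> X = W" by (rule subset_Zorn)
  then obtain W where W: "W \<in> \<U>" "\<And>X. X \<in> \<U> \<Longrightarrow> W \<subseteq> X \<Longrightarrow> X = W" by blast
  show ?thesis
  proof (rule that[of "- W"])
    show "closed (- W)" "- W \<noteq> {}" using W(1) by (auto simp: \<U>_def)
    show "a x \<in> - W" if "a \<in> A" "x \<in> - W" for a x using that W(1) by (auto simp: \<U>_def)
    show "N = - W" if N: "closed N" "N \<noteq> {}" "N \<subseteq> - W" "\<And>a x. a \<in> A \<Longrightarrow> x \<in> N \<Longrightarrow> a x \<in> N" for N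
    proof -
      have "- N \<in> \<U>" using N by (auto simp: \<U>_def)
      moreover have "W \<subseteq> - N" using N(3) by blast
      ultimately show ?thesis using W(2)[of "- N"] by blast
    qed
  qed
qed

lemma real_shift_into:
  fixes a t :: real
  obtains n :: int where "a \<le> t + of_int n" "t + of_int n < a + 1"
proof -
  have "a \<le> t + of_int (- \<lfloor>t - a\<rfloor>)" "t + of_int (- \<lfloor>t - a\<rfloor>) < a + 1" by (simp; linarith)+
  then show ?thesis using that by blast
qed

text \<open>The preimages are not compact, but both are invariant under integer translations, so
  \<open>s\<close> can be moved into \<open>{0..1}\<close>.\<close>

lemma disjoint_closed_lifts_separated:
  assumes "closed M" "closed N" "M \<inter> N = {}"
  obtains d where "d > 0"
    "\<And>s t. cr s \<in> M \<Longrightarrow> cr t \<in> N \<Longrightarrow> d \<le> \<bar>s - t\<bar>"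
proof -
  have "compact (cr -` M \<inter> {0..1})"
    using assms(1) closed_circle_iff by (intro closed_Int_compact) auto
  moreover have "closed (cr -` N)" using assms(2) closed_circle_iff by blast
  moreover have "cr -` M \<inter> {0..1} \<inter> cr -` N = {}" using assms(3) by auto
  ultimately obtain d where d: "d > 0"
    "\<And>s t. s \<in> cr -` M \<inter> {0..1} \<Longrightarrow> t \<in> cr -` N \<Longrightarrow> d \<le> dist s t"
    using separate_compact_closed by metis
  have "d \<le> \<bar>s - t\<bar>" if "cr s \<in> M" "cr t \<in> N" for s t
  proof -
    obtain n :: int where n: "0 \<le> s + of_int n" "s + of_int n < 0 + 1" by (rule real_shift_into)
    have "d \<le> dist (s + of_int n) (t + of_int n)" by (rule d(2)) (use n that in auto)
    then show ?thesis by (simp add: dist_real_def)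
  qed
  then show ?thesis using that d(1) by blast
qed

text \<open>The fixed point of the lift traps the orbit in one period, and since \<open>F\<close> is
  increasing, the first step decides the direction of all later ones.\<close>

lemma orbit_converges:
  assumes f: "inj f" and F: "is_lift f F" "F t = t" and s: "t \<le> s" "s < t + 1"
  obtains l where "(\<lambda>n. (F ^^ n) s) \<longlonglongrightarrow> l" "F l = l"
proof -
  have F1: "F (t + 1) = t + 1" using is_lift_add_1[OF f F(1), of t] F(2) by simp
  have bd: "t \<le> (F ^^ n) s \<and> (F ^^ n) s < t + 1" for n
  proof (induction n)
    case (Suc n)
    then show ?case
      using is_lift_le[OF F(1), of t "(F ^^ n) s"] is_lift_less[OF F(1), of "(F ^^ n) s" "t + 1"] F1 F(2)
      by simp
  qed (use s in simp)
  have powle: "(F ^^ n) u \<le> (F ^^ n) v" if "u \<le> v" for n u v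
  proof (induction n)
    case (Suc n) then show ?case using is_lift_le[OF F(1)] by simp
  qed (use that in simp)
  have step: "(F ^^ Suc n) s = (F ^^ n) (F s)" for n by (simp add: funpow_swap1)
  have "monoseq (\<lambda>n. (F ^^ n) s)"
  proof (cases "s \<le> F s")
    case True
    then have "(F ^^ n) s \<le> (F ^^ Suc n) s" for n unfolding step by (rule powle)
    then have "incseq (\<lambda>n. (F ^^ n) s)" by (rule incseq_SucI)
    then show ?thesis by (simp add: monoseq_iff)
  next
    case False
    then have "(F ^^ Suc n) s \<le> (F ^^ n) s" for n unfolding step by (intro powle) simp
    then have "decseq (\<lambda>n. (F ^^ n) s)" by (rule decseq_SucI)
    then show ?thesis by (simp add: monoseq_iff)
  qed
  moreover have "Bseq (\<lambda>n. (F ^^ n) s)"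
    by (rule BseqI'[of _ "\<bar>t\<bar> + 1"]) (use bd in \<open>simp add: abs_le_iff, smt (verit)\<close>)
  ultimately obtain l where l: "(\<lambda>n. (F ^^ n) s) \<longlonglongrightarrow> l"
    using Bseq_monoseq_convergent unfolding convergent_def by blast
  have "(\<lambda>n. F ((F ^^ n) s)) \<longlonglongrightarrow> F l"
    using isCont_tendsto_compose[OF is_lift_isCont[OF F(1)] l] .
  moreover have "(\<lambda>n. F ((F ^^ n) s)) \<longlonglongrightarrow> l" using LIMSEQ_Suc[OF l] by simp
  ultimately have "F l = l" using LIMSEQ_unique by blast
  then show ?thesis using that l by blast
qed

lemma orbit_invariant:
  assumes F: "is_lift f F" and M: "\<And>x. x \<in> M \<Longrightarrow> f x \<in> M" and s: "cr s \<in> M"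
  shows "cr ((F ^^ n) s) \<in> M"
proof (induction n)
  case (Suc n)
  then have "f (cr ((F ^^ n) s)) \<in> M" by (rule M)
  then show ?case using is_lift_eq[OF F] by simp
qed (use s in simp)

text \<open>The given fixed point may lie outside \<open>M\<close>. It serves to make the orbits of
  a suitable lift converge, and an orbit that starts in the closed set \<open>M\<close> has its
  limit there.\<close>

lemma fixed_point_in_invariant_set:
  assumes f: "f \<in> Homeo" "f x = x" and M: "closed M" "M \<noteq> {}" "\<And>x. x \<in> M \<Longrightarrow> f x \<in> M"
  obtains z where "z \<in> M" "f z = z"
proof -
  obtain t where t: "x = cr t" using circle_lift_exists by blast
  obtain F where F: "is_lift f F" "F t = t" using lift_through[OF f(1), of t t] f(2) t by blast
  obtain y where y: "y \<in> M" using M(2) by blast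
  obtain s where s: "t \<le> s" "s < t + 1" "y = cr s" by (rule circle_cases)
  obtain l where l: "(\<lambda>n. (F ^^ n) s) \<longlonglongrightarrow> l" "F l = l"
    using orbit_converges[OF Homeo_inj[OF f(1)] F s(1,2)] by blast
  have "cr s \<in> M" using y s by simp
  then have inM: "cr ((F ^^ n) s) \<in> M" for n using orbit_invariant[OF F(1) M(3)] by blast
  have "cr l \<in> M"
    using closed_sequentially[OF M(1) inM tendsto_circle_of_real[OF l(1)]] .
  moreover have "f (cr l) = cr l" using is_lift_eq[OF F(1), of l] l(2) by simp
  ultimately show ?thesis using that by blast
qed

text \<open>Because \<open>a\<close> has a fixed point, the orbit of \<open>y\<close> converges. In
  a uniformly discrete set it is then eventually constant, and injectivity makes it constant from
  the start.\<close>

lemma free_on_discrete: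
  assumes a: "a \<in> Homeo" "\<And>x. x \<in> M \<Longrightarrow> a x \<in> M"
    and d: "d > 0" "\<And>s t. cr s \<in> M \<Longrightarrow> cr t \<in> M \<Longrightarrow> s < t \<Longrightarrow> d \<le> t - s"
    and xy: "x \<in> M" "a x = x" "y \<in> M"
  shows "a y = y"
proof -
  obtain t where t: "x = cr t" using circle_lift_exists by blast
  obtain F where F: "is_lift a F" "F t = t" using lift_through[OF a(1), of t t] xy t by metis
  obtain s where s: "t \<le> s" "s < t + 1" "y = cr s" by (rule circle_cases)
  have "cr s \<in> M" using xy(3) s by simp
  then have inM: "cr ((F ^^ n) s) \<in> M" for n using orbit_invariant[OF F(1) a(2)] by blast
  obtain l where "(\<lambda>n. (F ^^ n) s) \<longlonglongrightarrow> l"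
    using orbit_converges[OF Homeo_inj[OF a(1)] F s(1,2)] by blast
  then have "Cauchy (\<lambda>n. (F ^^ n) s)" using LIMSEQ_imp_Cauchy by blast
  then obtain N where N: "\<And>m n. m \<ge> N \<Longrightarrow> n \<ge> N \<Longrightarrow> dist ((F ^^ m) s) ((F ^^ n) s) < d"
    using d(1) unfolding Cauchy_def by blast
  have close: "\<bar>(F ^^ Suc N) s - (F ^^ N) s\<bar> < d" using N[of "Suc N" N] by (simp add: dist_real_def)
  have "(F ^^ Suc N) s = (F ^^ N) s"
    using d(2)[OF inM[of N] inM[of "Suc N"]] d(2)[OF inM[of "Suc N"] inM[of N]] close by linarith
  then have "(F ^^ N) (F s) = (F ^^ N) s" by (simp add: funpow_swap1)
  moreover have "inj (F ^^ N)"
    using F(1) strict_mono_imp_inj_on unfolding is_lift_def by (intro inj_fn) blast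
  ultimately have "F s = s" by (simp add: inj_eq)
  then show ?thesis using is_lift_eq[OF F(1), of s] s by simp
qed

text \<open>Let \<open>M\<close> be a minimal set of \<open>A\<close>. If \<open>B\<close> preserves
  \<open>M\<close>, then \<open>B\<close> acts freely on it, since the fixed points in
  \<open>M\<close> of an element of \<open>B\<close> form an \<open>A\<close>-invariant set. So
  \<open>B\<close> is abelian on \<open>M\<close>, and \<open>A\<close> is abelian on the preimage
  of \<open>M\<close> under \<open>v\<close>. If some \<open>b\<close> in \<open>B\<close> does not
  preserve \<open>M\<close>, then \<open>M\<close> and its image under \<open>b\<close> are disjoint
  \<open>A\<close>-invariant sets. The way they interleave forces \<open>M\<close> to be discrete,
  and then \<open>A\<close> itself acts freely on \<open>M\<close>.\<close>

lemma commuting_conjugates_abelian_set: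
  assumes A: "subgroup A homeo_plus" and B: "subgroup B homeo_plus" and v: "v \<in> Homeo"
    and conj: "\<And>a. a \<in> A \<Longrightarrow> v \<circ> a \<circ> invf v \<in> B"
    and comm: "\<And>a b x. a \<in> A \<Longrightarrow> b \<in> B \<Longrightarrow> a (b x) = b (a x)"
  obtains M where "M \<noteq> {}" "\<And>a x. a \<in> A \<Longrightarrow> x \<in> M \<Longrightarrow> a x \<in> M"
    "\<And>a b x. a \<in> A \<Longrightarrow> b \<in> A \<Longrightarrow> x \<in> M \<Longrightarrow> a (b x) = b (a x)"
proof -
  note subA = subgroup_closed[OF A] and subB = subgroup_closed[OF B]
  obtain M where M: "closed M" "M \<noteq> {}" and inv: "\<And>a x. a \<in> A \<Longrightarrow> x \<in> M \<Longrightarrow> a x \<in> M"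
    and minimal: "\<And>N. closed N \<Longrightarrow> N \<noteq> {} \<Longrightarrow> N \<subseteq> M \<Longrightarrow> (\<And>a x. a \<in> A \<Longrightarrow> x \<in> N \<Longrightarrow> a x \<in> N) \<Longrightarrow> N = M"
    using minimal_set_exists[OF compact_circle, of A] by blast
  show ?thesis
  proof (cases "\<forall>b\<in>B. \<forall>x\<in>M. b x \<in> M")
    case True
    have free: "b y = y" if b: "b \<in> B" and x: "x \<in> M" "b x = x" and y: "y \<in> M" for b x y
    proof -
      have "b \<in> Homeo" using b subB(1) by blast
      have "M \<inter> {x. b x = x} = M"
      proof (rule minimal)
        show "closed (M \<inter> {x. b x = x})"
          using M(1) Homeo_fixed_closed[OF \<open>b \<in> Homeo\<close>] by (rule closed_Int)
        show "a z \<in> M \<inter> {x. b x = x}" if "a \<in> A" "z \<in> M \<inter> {x. b x = x}" for a z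
          using that inv comm[OF that(1) b, of z] by auto
      qed (use x in auto)
      then show ?thesis using y by blast
    qed
    have commB: "b (c x) = c (b x)" if "b \<in> B" "c \<in> B" "x \<in> M" for b c x
      by (rule hoelder_circle[OF B M(1)]) (use True free that in blast)+
    have va: "a (invf v x) = invf v ((v \<circ> a \<circ> invf v) x)" for a x using v by simp
    show ?thesis
    proof (rule that[of "invf v ` M"])
      show "invf v ` M \<noteq> {}" using M by simp
      show "a x \<in> invf v ` M" if a: "a \<in> A" and x: "x \<in> invf v ` M" for a x
      proof -
        obtain z where z: "z \<in> M" "x = invf v z" using x by blast
        have "(v \<circ> a \<circ> invf v) z \<in> M" using True conj[OF a] z by blast
        then show ?thesis unfolding z va by blast
      qed
      show "a (b x) = b (a x)" if ab: "a \<in> A" "b \<in> A" and x: "x \<in> invf v ` M" for a b x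
      proof -
        obtain z where z: "z \<in> M" "x = invf v z" using x by blast
        show ?thesis using commB[OF conj[OF ab(1)] conj[OF ab(2)] z(1)] Homeo_eq_iff[OF v] v
          unfolding z by simp
      qed
    qed
  next
    case False
    then obtain b z where b: "b \<in> B" "z \<in> M" "b z \<notin> M" by blast
    have bH: "b \<in> Homeo" using b subB(1) by blast
    define M' where "M' = b ` M"
    have M': "closed M'" unfolding M'_def using Homeo_closed_image[OF bH M(1)] .
    have inv': "a x \<in> M'" if "a \<in> A" "x \<in> M'" for a x
      using that inv comm[OF that(1) b(1)] unfolding M'_def by auto
    have disj: "M \<inter> M' = {}"
    proof (rule ccontr)
      assume ne: "M \<inter> M' \<noteq> {}"
      have "M \<inter> M' = M"
        by (rule minimal) (use M M' inv inv' ne in auto)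
      then have MM': "M \<subseteq> M'" by blast
      \<comment> \<open>So far the inverse of \<open>b\<close> is only known to map \<open>M\<close>
        into itself. A second use of minimality turns this into equality, so that \<open>b\<close>
        maps \<open>M\<close> into itself too, against the choice of \<open>z\<close>.\<close>
      have "invf b ` M = M"
      proof (rule minimal)
        show "closed (invf b ` M)" using Homeo_closed_image[OF Homeo_inv[OF bH] M(1)] .
        show "invf b ` M \<noteq> {}" using M by simp
        show "invf b ` M \<subseteq> M" using MM' bH unfolding M'_def by auto
        show "a x \<in> invf b ` M" if a: "a \<in> A" and x: "x \<in> invf b ` M" for a x
        proof -
          obtain u where u: "u \<in> M" "x = invf b u" using x by blast
          have "b (a x) = a u" using comm[OF a b(1), of x] u bH by simp
          then have "a x = invf b (a u)" using bH by (metis Homeo_inv_f)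
          then show ?thesis using inv[OF a u(1)] by blast
        qed
      qed
      then obtain u where "u \<in> M" "z = invf b u" using b(2) by blast
      then have "b z \<in> M" using bH by simp
      then show False using b by simp
    qed
    obtain d where d: "d > 0"
      "\<And>s t. cr s \<in> M \<Longrightarrow> cr t \<in> M' \<Longrightarrow> d \<le> \<bar>s - t\<bar>"
      using disjoint_closed_lifts_separated[OF M(1) M' disj] by blast
    define E where "E = {p. cr p \<in> M \<and> (\<exists>q. cr q \<in> M' \<and> p < q \<and>
      (\<forall>r. cr r \<in> M \<longrightarrow> r < q \<longrightarrow> r \<le> p))}"
    text \<open>\<open>E\<close> consists of the last points of \<open>M\<close> before points of \<open>M'\<close>.\<close>
    have Ed: "d \<le> t - s" if st: "s \<in> E" "t \<in> E" "s < t" for s t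
    proof -
      obtain q where q: "cr q \<in> M'" "s < q"
        "\<And>r. cr r \<in> M \<Longrightarrow> r < q \<Longrightarrow> r \<le> s"
        using st(1) unfolding E_def by blast
      have "cr t \<in> M" "cr s \<in> M" using st by (auto simp: E_def)
      then have "q \<le> t" using q(3)[of t] st(3) by fastforce
      moreover have "d \<le> \<bar>s - q\<bar>" using d(2) \<open>cr s \<in> M\<close> q(1) by blast
      ultimately show ?thesis using q(2) by simp
    qed
    have Eshift: "p + of_int n \<in> E" if p: "p \<in> E" for p and n :: int
    proof -
      obtain q where q: "cr q \<in> M'" "p < q"
        "\<And>r. cr r \<in> M \<Longrightarrow> r < q \<Longrightarrow> r \<le> p"
        using p unfolding E_def by blast
      have "r \<le> p + of_int n" if "cr r \<in> M" "r < q + of_int n" for r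
      proof -
        have "cr (r + of_int (- n)) \<in> M" using that(1) by (simp only: circle_of_real_add_int)
        then have "r + of_int (- n) \<le> p" using q(3) that(2) by simp
        then show ?thesis by simp
      qed
      moreover have "cr p \<in> M" using p by (simp add: E_def)
      ultimately show ?thesis using q(1,2) unfolding E_def
        by (auto intro!: exI[of _ "q + of_int n"])
    qed
    have "closed E"
    proof (rule discrete_imp_closed[OF d(1)], intro ballI impI)
      fix x y assume "x \<in> E" "y \<in> E" "dist y x < d"
      then show "y = x" using Ed[of x y] Ed[of y x] by (simp add: dist_real_def) linarith
    qed
    moreover have vE: "cr -` cr ` E = E"
    proof (intro subset_antisym subsetI)
      fix x assume "x \<in> cr -` cr ` E"
      then show "x \<in> E" using Eshift by (auto simp: circle_of_real_eq_iff)
    qed auto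
    ultimately have "closed (cr ` E)" by (simp add: closed_circle_iff)
    moreover have "cr ` E \<noteq> {}"
    proof -
      obtain q where q: "b z = cr q" using circle_lift_exists by blast
      have qM': "cr q \<in> M'" unfolding M'_def q[symmetric] using b(2) by blast
      define P where "P = cr -` M \<inter> {..q}"
      have "closed P" unfolding P_def using M(1) closed_circle_iff by blast
      moreover have "P \<noteq> {}"
      proof -
        obtain t where t: "z = cr t" using circle_lift_exists by blast
        obtain n :: int where n: "q - 1 \<le> t + of_int n" "t + of_int n < (q - 1) + 1" by (rule real_shift_into)
        then have "t + of_int n \<in> P" using b(2) t by (simp add: P_def)
        then show ?thesis by blast
      qed
      moreover have "bdd_above P" unfolding P_def by (auto intro: bdd_aboveI)
      ultimately have SP: "Sup P \<in> P" using closed_contains_Sup by blast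
      have "r \<le> Sup P" if "cr r \<in> M" "r < q" for r
        using that cSup_upper[of r P] \<open>bdd_above P\<close> by (simp add: P_def)
      moreover have "Sup P \<noteq> q" using SP qM' disj by (auto simp: P_def)
      ultimately have "Sup P \<in> E" using SP qM' unfolding E_def P_def by force
      then show ?thesis by blast
    qed
    moreover have "cr ` E \<subseteq> M" by (auto simp: E_def)
    \<comment> \<open>Membership in \<open>E\<close> is expressed through \<open>M\<close>,
      \<open>M'\<close> and the order of the line, and lifts of elements of \<open>A\<close>
      preserve all three.\<close>
    moreover have "a x \<in> cr ` E" if a: "a \<in> A" and x: "x \<in> cr ` E" for a x
    proof -
      obtain p where p: "p \<in> E" "x = cr p" using x by blast
      obtain q where q: "cr q \<in> M'" "p < q"
        "\<And>r. cr r \<in> M \<Longrightarrow> r < q \<Longrightarrow> r \<le> p"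
        using p(1) unfolding E_def by blast
      have aH: "a \<in> Homeo" using a subA(1) by blast
      obtain F where F: "is_lift a F" using Homeo_lift aH by blast
      have sF: "surj F" using is_lift_surj Homeo_inj aH F by blast
      have "r \<le> F p" if r: "cr r \<in> M" "r < F q" for r
      proof -
        obtain r' where r': "r = F r'" using sF by blast
        have "invf a (cr r) \<in> M" using inv subA(4)[OF a] r(1) by blast
        then have "cr r' \<in> M" using is_lift_eq[OF F, of r'] r' aH by (metis Homeo_inv_f)
        moreover have "r' < q" using r(2) is_lift_less[OF F] r' by blast
        ultimately show ?thesis using q(3) is_lift_le[OF F] r' by blast
      qed
      moreover have "cr (F p) \<in> M" using inv[OF a, of x] p is_lift_eq[OF F] by (auto simp: E_def)
      moreover have "cr (F q) \<in> M'" using inv'[OF a q(1)] is_lift_eq[OF F] by simp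
      moreover have "F p < F q" using q(2) is_lift_less[OF F] by blast
      ultimately have "F p \<in> E" unfolding E_def by blast
      then show ?thesis using p is_lift_eq[OF F] by auto
    qed
    ultimately have EM: "cr ` E = M" by (intro minimal) auto
    have dM: "d \<le> t - s" if "cr s \<in> M" "cr t \<in> M" "s < t" for s t
    proof -
      have "s \<in> E" "t \<in> E" using that vE unfolding EM by auto
      then show ?thesis using Ed that(3) by blast
    qed
    have free: "a y = y" if a: "a \<in> A" and x: "x \<in> M" "a x = x" and y: "y \<in> M" for a x y
    proof -
      have "a \<in> Homeo" using a subA(1) by blast
      show ?thesis by (rule free_on_discrete[OF \<open>a \<in> Homeo\<close> inv[OF a] d(1) dM x y])
    qed
    show ?thesis
    proof (rule that[of M])
      show "M \<noteq> {}" by (rule M(2))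
      show "a x \<in> M" if "a \<in> A" "x \<in> M" for a x using inv that .
      show "a (b x) = b (a x)" if "a \<in> A" "b \<in> A" "x \<in> M" for a b x
        by (rule hoelder_circle[OF A M(1)]) (use inv free that in blast)+
    qed
  qed
qed

section \<open>Proximal actions\<close>

definition com :: "('a \<Rightarrow> 'a) \<Rightarrow> ('a \<Rightarrow> 'a) \<Rightarrow> 'a \<Rightarrow> 'a"
  where "com f g = f \<circ> g \<circ> invf f \<circ> invf g"

lemma conj_com:
  assumes "f \<in> Homeo" "g \<in> Homeo" "k \<in> Homeo"
  shows "k \<circ> com f g \<circ> invf k = com (k \<circ> f \<circ> invf k) (k \<circ> g \<circ> invf k)"
proof -
  have *: "invf (k \<circ> f \<circ> invf k) = k \<circ> invf f \<circ> invf k" if "f \<in> Homeo" for f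
  proof
    fix x
    have H: "k \<circ> f \<circ> invf k \<in> Homeo" using that assms(3) Homeo_comp Homeo_inv by blast
    have "(k \<circ> f \<circ> invf k) ((k \<circ> invf f \<circ> invf k) x) = x" using that assms(3) by simp
    then have "invf (k \<circ> f \<circ> invf k) x = invf (k \<circ> f \<circ> invf k) ((k \<circ> f \<circ> invf k) ((k \<circ> invf f \<circ> invf k) x))"
      by simp
    then show "invf (k \<circ> f \<circ> invf k) x = (k \<circ> invf f \<circ> invf k) x" using Homeo_inv_f[OF H] by simp
  qed
  show ?thesis unfolding com_def *[OF assms(1)] *[OF assms(2)] using assms(3) by (auto simp: fun_eq_iff)
qed

lemma com_id_iff:
  assumes "f \<in> Homeo" "g \<in> Homeo"
  shows "com f g = id \<longleftrightarrow> f \<circ> g = g \<circ> f"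
proof
  assume *: "com f g = id"
  show "f \<circ> g = g \<circ> f"
  proof
    fix x show "(f \<circ> g) x = (g \<circ> f) x"
      using fun_cong[OF *, of "g (f x)"] assms by (simp add: com_def)
  qed
next
  assume *: "f \<circ> g = g \<circ> f"
  show "com f g = id"
  proof
    fix x show "com f g x = id x"
      using fun_cong[OF *, of "invf f (invf g x)"] assms by (simp add: com_def)
  qed
qed

lemma com_closed:
  assumes "subgroup G homeo_plus" "f \<in> G" "g \<in> G" shows "com f g \<in> G"
  unfolding com_def by (intro subgroup_closed[OF assms(1)] assms)

text \<open>Makes the complement of a closed ball admissible as the set to be contracted in a
  proximal action.\<close>

lemma closure_Compl_cball:
  fixes p :: "'a::metric_space"
  assumes "e > 0" shows "closure (- cball p e) \<noteq> UNIV"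
proof -
  have "closure (- cball p e) \<subseteq> - ball p e"
    by (rule closure_minimal) auto
  then show ?thesis using assms by (metis Compl_iff UNIV_I centre_in_ball subsetD)
qed

lemma three_points: "cr 0 \<noteq> cr (1/3)" "cr 0 \<noteq> cr (2/3)"
  "cr (1/3) \<noteq> cr (2/3)"
  by (auto dest!: circle_of_real_eqD)

locale homeo_group =
  fixes G :: "(circle \<Rightarrow> circle) set"
  assumes subgroup_G: "subgroup G homeo_plus"
begin

lemmas G_Homeo = subsetD[OF subgroup_closed(1)[OF subgroup_G]]
lemmas G_id = subgroup_closed(2)[OF subgroup_G]
lemmas G_comp = subgroup_closed(3)[OF subgroup_G]
lemmas G_inv = subgroup_closed(4)[OF subgroup_G]
lemmas G_com = com_closed[OF subgroup_G]

end

text \<open>The products in \<open>G\<close> and in \<open>homeo_plus\<close> both reverse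
  composition, so a homomorphism for right actions respects \<open>\<circ>\<close> in its usual
  order.\<close>

locale proximal_action = homeo_group G for G +
  fixes \<rho> :: "(circle \<Rightarrow> circle) \<Rightarrow> circle \<Rightarrow> circle"
  assumes rho_Homeo: "g \<in> G \<Longrightarrow> \<rho> g \<in> Homeo"
    and rho_comp: "f \<in> G \<Longrightarrow> g \<in> G \<Longrightarrow> \<rho> (f \<circ> g) = \<rho> f \<circ> \<rho> g"
    and proximal: "open I \<Longrightarrow> I \<noteq> {} \<Longrightarrow> open J \<Longrightarrow> J \<noteq> {} \<Longrightarrow> closure J \<noteq> UNIV \<Longrightarrow> \<exists>g\<in>G. \<rho> g ` J \<subseteq> I"
begin

lemma rho_id: "\<rho> id = id"
proof
  fix x
  have "\<rho> id (\<rho> id x) = \<rho> id x" using fun_cong[OF rho_comp[OF G_id G_id], of x] by simp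
  then show "\<rho> id x = id x" using Homeo_eq_iff[OF rho_Homeo[OF G_id]] by simp
qed

lemma rho_inv: assumes "g \<in> G" shows "\<rho> (invf g) = invf (\<rho> g)"
proof
  fix x
  have "g \<circ> invf g = id" using G_Homeo[OF assms] by (auto simp: fun_eq_iff)
  then have "\<rho> g (\<rho> (invf g) x) = x"
    using fun_cong[OF rho_comp[OF assms G_inv[OF assms]], of x] rho_id by simp
  then show "\<rho> (invf g) x = invf (\<rho> g) x"
    using Homeo_inv_f[OF rho_Homeo[OF assms], of "\<rho> (invf g) x"] by simp
qed

lemma rho_com: "f \<in> G \<Longrightarrow> g \<in> G \<Longrightarrow> \<rho> (com f g) = com (\<rho> f) (\<rho> g)"
  unfolding com_def by (simp add: rho_comp G_comp G_inv rho_inv)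

lemma rho_conj: "f \<in> G \<Longrightarrow> g \<in> G \<Longrightarrow> \<rho> (f \<circ> g \<circ> invf f) = \<rho> f \<circ> \<rho> g \<circ> invf (\<rho> f)"
  by (simp add: rho_comp G_comp G_inv rho_inv)

text \<open>The closed set is enlarged to the complement of a closed ball disjoint from it. If that
  complement is empty, so is \<open>F\<close>, and the identity serves.\<close>

lemma proximal_closed:
  assumes F: "closed F" "F \<noteq> UNIV" and I: "open I" "I \<noteq> {}"
  obtains g where "g \<in> G" "\<rho> g ` F \<subseteq> I"
proof -
  obtain y where "y \<in> - F" using F by blast
  then obtain e where e: "e > 0" "cball y e \<subseteq> - F"
    using F open_contains_cball[of "- F"] by blast
  show ?thesis
  proof (cases "- cball y e = {}")
    case True
    then have "\<rho> id ` F \<subseteq> I" using e by blast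
    then show ?thesis using that G_id by blast
  next
    case False
    then obtain g where "g \<in> G" "\<rho> g ` (- cball y e) \<subseteq> I"
      using proximal[OF I, of "- cball y e"] closure_Compl_cball[OF e(1)] by auto
    then show ?thesis using that e(2) by blast
  qed
qed

lemma no_global_fixed_point: "\<exists>g\<in>G. \<rho> g x \<noteq> x"
proof -
  have "{x} \<noteq> UNIV" using three_points(1) by (metis UNIV_I singletonD)
  then obtain g where "g \<in> G" "\<rho> g ` {x} \<subseteq> - {x}"
    using proximal_closed[of "{x}" "- {x}"] by blast
  then show ?thesis by blast
qed

text \<open>The elements \<open>u\<close>, \<open>v\<close> are conjugates of \<open>s\<close> mapping the complements of two disjoint balls
  into these balls; a point outside both balls shows that they do not commute.\<close>

lemma conjugates_not_commuting:
  assumes S: "S \<subseteq> G" and conj: "\<And>k s. k \<in> G \<Longrightarrow> s \<in> S \<Longrightarrow> k \<circ> s \<circ> invf k \<in> S"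
    and s: "s \<in> S" "\<rho> s \<noteq> id"
  obtains u v where "u \<in> S" "v \<in> S" "\<rho> u \<circ> \<rho> v \<noteq> \<rho> v \<circ> \<rho> u"
proof -
  have sG: "s \<in> G" using S s by blast
  obtain x where x: "\<rho> s x \<noteq> x" using s by (auto simp: fun_eq_iff)
  then obtain U V where UV: "open U" "open V" "x \<in> U" "\<rho> s x \<in> V" "U \<inter> V = {}"
    using hausdorff by metis
  \<comment> \<open>The map \<open>\<rho> s\<close> moves \<open>I\<close> off itself. Conjugating
    \<open>s\<close> by an element that squeezes the complement of a ball into \<open>I\<close>
    gives an element that maps this complement into the ball.\<close>
  define I where "I = U \<inter> \<rho> s -` V"
  have I: "open I" "x \<in> I"
    unfolding I_def using UV open_vimage[OF UV(2) Homeo_continuous[OF rho_Homeo[OF sG]]] by auto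
  have Is: "\<rho> s z \<notin> I" if "z \<in> I" for z using that UV by (auto simp: I_def)
  define p q r where "p = cr 0" "q = cr (1/3)" "r = cr (2/3)"
  \<comment> \<open>A third of the least distance makes the closed balls around \<open>p\<close> and
    \<open>q\<close> disjoint, as their radii add up to only \<open>2 * e\<close>, and leaves
    \<open>r\<close> outside both.\<close>
  define e where "e = Min {dist p q, dist p r, dist q r} / 3"
  have e: "e > 0" using three_points by (simp add: e_def p_q_r_def)
  have e3: "3 * e \<le> dist p q" "3 * e \<le> dist p r" "3 * e \<le> dist q r" by (auto simp: e_def)
  have r: "r \<notin> cball p e" "r \<notin> cball q e" using e e3 by auto
  have disj: "cball p e \<inter> cball q e = {}"
  proof (rule ccontr)
    assume "cball p e \<inter> cball q e \<noteq> {}"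
    then obtain z where "dist p z \<le> e" "dist q z \<le> e" by auto
    then have "dist p q \<le> 2 * e" using dist_triangle2[of p q z] by simp
    then show False using e e3 by simp
  qed
  have ex: "\<exists>u\<in>S. \<forall>z. z \<notin> cball c e \<longrightarrow> \<rho> u z \<in> cball c e" if "r \<notin> cball c e" for c
  proof -
    have "- cball c e \<noteq> {}" using that by blast
    then obtain g where g: "g \<in> G" "\<rho> g ` (- cball c e) \<subseteq> I"
      using proximal[OF I(1), of "- cball c e"] closure_Compl_cball[OF e] I(2) by auto
    have gi: "invf g \<in> G" using G_inv g by blast
    have gg: "invf (invf g) = g" using G_Homeo[OF g(1)] Homeo_bij inv_inv_eq by blast
    define u where "u = invf g \<circ> s \<circ> g"
    have u: "u \<in> S" using conj[OF gi s(1)] unfolding u_def gg .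
    have ru: "\<rho> u z = invf (\<rho> g) (\<rho> s (\<rho> g z))" for z
      unfolding u_def using g(1) gi sG by (simp add: rho_comp G_comp rho_inv)
    have "\<rho> u z \<in> cball c e" if "z \<notin> cball c e" for z
    proof (rule ccontr)
      assume "\<rho> u z \<notin> cball c e"
      then have "\<rho> g (\<rho> u z) \<in> I" using g(2) by blast
      then have "\<rho> s (\<rho> g z) \<in> I" unfolding ru using rho_Homeo[OF g(1)] by simp
      moreover have "\<rho> g z \<in> I" using g(2) that by blast
      ultimately show False using Is by blast
    qed
    then show ?thesis using u by blast
  qed
  obtain u where u: "u \<in> S" "\<And>z. z \<notin> cball p e \<Longrightarrow> \<rho> u z \<in> cball p e" using ex[OF r(1)] by blast
  obtain v where v: "v \<in> S" "\<And>z. z \<notin> cball q e \<Longrightarrow> \<rho> v z \<in> cball q e" using ex[OF r(2)] by blast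
  have "\<rho> v (\<rho> u r) \<in> cball q e" by (rule v(2)) (use u(2)[OF r(1)] disj in blast)
  moreover have "\<rho> u (\<rho> v r) \<in> cball p e" by (rule u(2)) (use v(2)[OF r(2)] disj in blast)
  ultimately have "\<rho> u (\<rho> v r) \<noteq> \<rho> v (\<rho> u r)" using disj by auto
  then have "\<rho> u \<circ> \<rho> v \<noteq> \<rho> v \<circ> \<rho> u" by (metis comp_apply)
  then show ?thesis using that u(1) v(1) by blast
qed

text \<open>The inductive step towards non-solvability. It speaks of conjugation-invariant sets
  instead of subgroups, so that it can be iterated on sets of single commutators.\<close>

lemma commutators_not_trivial:
  assumes S: "S \<subseteq> G" and conj: "\<And>k s. k \<in> G \<Longrightarrow> s \<in> S \<Longrightarrow> k \<circ> s \<circ> invf k \<in> S"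
    and s: "s \<in> S" "\<rho> s \<noteq> id"
  defines "S' \<equiv> {com u v | u v. u \<in> S \<and> v \<in> S}"
  shows "S' \<subseteq> G" "k \<in> G \<Longrightarrow> t \<in> S' \<Longrightarrow> k \<circ> t \<circ> invf k \<in> S'" "\<exists>t\<in>S'. \<rho> t \<noteq> id"
proof -
  show "S' \<subseteq> G" unfolding S'_def using S G_com by blast
  show "k \<circ> t \<circ> invf k \<in> S'" if k: "k \<in> G" and t: "t \<in> S'"
  proof -
    obtain u v where uv: "u \<in> S" "v \<in> S" "t = com u v" using t unfolding S'_def by blast
    have "u \<in> Homeo" "v \<in> Homeo" "k \<in> Homeo" using uv S k G_Homeo by blast+
    then have "k \<circ> t \<circ> invf k = com (k \<circ> u \<circ> invf k) (k \<circ> v \<circ> invf k)"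
      unfolding uv(3) by (rule conj_com)
    then show ?thesis unfolding S'_def using conj[OF k uv(1)] conj[OF k uv(2)] by blast
  qed
  obtain u v where uv: "u \<in> S" "v \<in> S" "\<rho> u \<circ> \<rho> v \<noteq> \<rho> v \<circ> \<rho> u"
    using conjugates_not_commuting[OF S conj s] by blast
  have "u \<in> G" "v \<in> G" using uv S by auto
  then have "\<rho> (com u v) \<noteq> id" using uv(3) com_id_iff rho_com rho_Homeo by simp
  then show "\<exists>t\<in>S'. \<rho> t \<noteq> id" unfolding S'_def using uv by blast
qed

text \<open>Three levels are what the later contradiction requires: two levels turn elements of the
  stabilizer of \<open>y\<close> into elements trivial near \<open>y\<close>, and the third is a
  commutator of two such elements.\<close>

lemma not_solvable:
  obtains a b c d a' b' c' d' where
    "a \<in> G" "b \<in> G" "c \<in> G" "d \<in> G" "a' \<in> G" "b' \<in> G" "c' \<in> G" "d' \<in> G"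
    "\<rho> (com (com (com a b) (com c d)) (com (com a' b') (com c' d'))) \<noteq> id"
proof -
  obtain g where g: "g \<in> G" "\<rho> g \<noteq> id"
    using no_global_fixed_point[of "cr 0"] by (metis id_apply)
  have conj: "k \<circ> s \<circ> invf k \<in> G" if "k \<in> G" "s \<in> G" for k s using that G_comp G_inv by blast
  define S1 where "S1 = {com u v | u v. u \<in> G \<and> v \<in> G}"
  define S2 where "S2 = {com u v | u v. u \<in> S1 \<and> v \<in> S1}"
  define S3 where "S3 = {com u v | u v. u \<in> S2 \<and> v \<in> S2}"
  note 1 = commutators_not_trivial[OF order_refl conj g, folded S1_def]
  obtain s1 where s1: "s1 \<in> S1" "\<rho> s1 \<noteq> id" using 1(3) by blast
  note 2 = commutators_not_trivial[OF 1(1,2) s1, folded S2_def]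
  obtain s2 where s2: "s2 \<in> S2" "\<rho> s2 \<noteq> id" using 2(3) by blast
  note 3 = commutators_not_trivial[OF 2(1,2) s2, folded S3_def]
  obtain s3 where s3: "s3 \<in> S3" "\<rho> s3 \<noteq> id" using 3(3) by blast
  obtain u v where uv: "u \<in> S2" "v \<in> S2" "s3 = com u v" using s3(1) unfolding S3_def by blast
  obtain u1 u2 where u: "u1 \<in> S1" "u2 \<in> S1" "u = com u1 u2" using uv(1) unfolding S2_def by blast
  obtain v1 v2 where v: "v1 \<in> S1" "v2 \<in> S1" "v = com v1 v2" using uv(2) unfolding S2_def by blast
  obtain a b where ab: "a \<in> G" "b \<in> G" "u1 = com a b" using u(1) unfolding S1_def by blast
  obtain c d where cd: "c \<in> G" "d \<in> G" "u2 = com c d" using u(2) unfolding S1_def by blast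
  obtain a' b' where ab': "a' \<in> G" "b' \<in> G" "v1 = com a' b'" using v(1) unfolding S1_def by blast
  obtain c' d' where cd': "c' \<in> G" "d' \<in> G" "v2 = com c' d'" using v(2) unfolding S1_def by blast
  show ?thesis
    by (rule that[OF ab(1,2) cd(1,2) ab'(1,2) cd'(1,2)])
      (use s3(2) in \<open>simp add: uv(3) u(3) v(3) ab(3) cd(3) ab'(3) cd'(3)\<close>)
qed

end

section \<open>Groups transitive on circularly ordered tuples\<close>

lemma transitive_on_circular_tuplesD:
  assumes "transitive_on_circular_tuples G k Y"
    and "length xs = k" "set xs \<subseteq> Y" "circularly_ordered xs"
    and "length ys = k" "set ys \<subseteq> Y" "circularly_ordered ys"
  obtains g where "g \<in> G" "map g xs = ys"
proof -
  have "xs \<in> circular_tuples k Y" "ys \<in> circular_tuples k Y"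
    using assms by (simp_all add: circular_tuples_def)
  then show ?thesis using assms(1) that unfolding transitive_on_circular_tuples_def by blast
qed

lemma circularly_ordered_pair:
  assumes "y \<noteq> z" shows "circularly_ordered [y, z]"
proof -
  obtain s where s: "y = cr s" using circle_lift_exists by blast
  obtain t where t: "s \<le> t" "t < s + 1" "z = cr t" by (rule circle_cases)
  then have "s < t" using assms s by (cases "s = t") auto
  then show ?thesis unfolding circularly_ordered_def
    by (intro exI[of _ s] exI[of _ "[s, t]"]) (use s t in auto)
qed

lemma circularly_ordered_triple:
  assumes "r < s" "s < t" "t < r + 1"
  shows "circularly_ordered [cr r, cr s, cr t]"
  unfolding circularly_ordered_def
  by (intro exI[of _ r] exI[of _ "[r, s, t]"]) (use assms in auto)

locale circularly_transitive = homeo_group G for G +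
  fixes Y :: "circle set"
  assumes invariant_Y: "g \<in> G \<Longrightarrow> y \<in> Y \<Longrightarrow> g y \<in> Y"
    and dense_Y: "closure Y = UNIV"
    and trans2: "transitive_on_circular_tuples G 2 Y"
    and trans3: "transitive_on_circular_tuples G 3 Y"
begin

lemma pair_transitive:
  assumes "y \<in> Y" "z \<in> Y" "y \<noteq> z" "y' \<in> Y" "z' \<in> Y" "y' \<noteq> z'"
  obtains g where "g \<in> G" "g y = y'" "g z = z'"
proof -
  obtain g where "g \<in> G" "map g [y, z] = [y', z']"
    by (rule transitive_on_circular_tuplesD[OF trans2, of "[y, z]" "[y', z']"])
      (use assms circularly_ordered_pair in auto)
  then show ?thesis using that by simp
qed

lemma triple_transitive:
  assumes "r < s" "s < t" "t < r + 1" "r' < s'" "s' < t'" "t' < r' + 1"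
    and "cr ` {r, s, t, r', s', t'} \<subseteq> Y"
  obtains g where "g \<in> G" "g (cr r) = cr r'"
    "g (cr s) = cr s'" "g (cr t) = cr t'"
proof -
  obtain g where "g \<in> G" "map g [cr r, cr s, cr t] =
      [cr r', cr s', cr t']"
    by (rule transitive_on_circular_tuplesD[OF trans3,
          of "[cr r, cr s, cr t]"
             "[cr r', cr s', cr t']"])
      (use assms circularly_ordered_triple in auto)
  then show ?thesis using that by simp
qed

lemma Y_meets_open:
  assumes "open U" "U \<noteq> {}" obtains y where "y \<in> Y" "y \<in> U"
  using open_Int_closure_eq_empty[OF assms(1), of Y] assms(2) dense_Y by auto

lemma Y_between:
  assumes "a < b" obtains s where "a < s" "s < b" "cr s \<in> Y"
proof -
  have "open (cr ` {a<..<b})" by (rule open_circle_of_real_image) simp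
  moreover have "cr ` {a<..<b} \<noteq> {}" using assms by simp
  ultimately obtain y where "y \<in> Y" "y \<in> cr ` {a<..<b}" by (rule Y_meets_open)
  then show ?thesis using that by auto
qed

text \<open>The bound \<open>1/2\<close> keeps the arc short of a full turn, so that distinct
  parameters between \<open>t\<close> and \<open>r\<close> give distinct points.\<close>

lemma Y_arc_in_open:
  assumes "open U" "u \<in> U"
  obtains t s r where "u = cr t" "t < s" "s < r" "r < t + 1/2"
    "cr s \<in> Y" "cr r \<in> Y" "\<And>q. t \<le> q \<Longrightarrow> q \<le> r \<Longrightarrow> cr q \<in> U"
proof -
  obtain t e where t: "e > 0" "u = cr t" "\<And>s. \<bar>s - t\<bar> < e \<Longrightarrow> cr s \<in> U"
    using open_circle_arcE[OF assms] by blast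
  have "t < t + min e (1/2)" using t(1) by simp
  then obtain s where s: "t < s" "s < t + min e (1/2)" "cr s \<in> Y" by (rule Y_between)
  obtain r where r: "s < r" "r < t + min e (1/2)" "cr r \<in> Y" by (rule Y_between[OF s(2)])
  show ?thesis by (rule that[OF t(2) s(1) r(1) _ s(3) r(3) t(3)]) (use s r in auto)
qed

lemma eq_on_Y:
  assumes "f \<in> Homeo" "g \<in> Homeo" "\<And>y. y \<in> Y \<Longrightarrow> f y = g y" shows "f = g"
proof -
  have "closed {x. f x = g x}" by (intro closed_Collect_eq Homeo_continuous assms)
  moreover have "Y \<subseteq> {x. f x = g x}" using assms by blast
  ultimately have "closure Y \<subseteq> {x. f x = g x}" by (rule closure_minimal[rotated])
  then show ?thesis using dense_Y by auto
qed

lemma moves_Y: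
  assumes "f \<in> Homeo" "f \<noteq> id" obtains y where "y \<in> Y" "f y \<noteq> y"
  using eq_on_Y[OF assms(1) Homeo_id] assms(2) by fastforce

definition H :: "circle \<Rightarrow> (circle \<Rightarrow> circle) set" where "H y = {g \<in> G. g y = y}"

lemma H_iff: "g \<in> H y \<longleftrightarrow> g \<in> G \<and> g y = y" by (simp add: H_def)

lemma H_closed:
  shows "id \<in> H y" "f \<in> H y \<Longrightarrow> g \<in> H y \<Longrightarrow> f \<circ> g \<in> H y" "f \<in> H y \<Longrightarrow> invf f \<in> H y"
    "f \<in> H y \<Longrightarrow> g \<in> H y \<Longrightarrow> com f g \<in> H y"
proof -
  show "id \<in> H y" by (simp add: H_def G_id)
  show *: "f \<circ> g \<in> H y" if "f \<in> H y" "g \<in> H y" for f g using that by (simp add: H_def G_comp)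
  show **: "invf f \<in> H y" if f: "f \<in> H y" for f
  proof -
    have "invf f (f y) = y" using f G_Homeo[of f] by (intro Homeo_inv_f) (simp add: H_def)
    then have "invf f y = y" using f by (simp add: H_def)
    then show ?thesis using f G_inv by (simp add: H_def)
  qed
  show "com f g \<in> H y" if "f \<in> H y" "g \<in> H y" unfolding com_def using that by (intro * **)
qed

text \<open>The element \<open>p\<close> moves some \<open>x\<close> in \<open>Y\<close>. If
  \<open>(y, x, p x)\<close> and \<open>(y, z, w)\<close> have the same circular order, transitivity
  on triples carries the first to the second, and the corresponding conjugate of \<open>p\<close>
  sends \<open>z\<close> to \<open>w\<close>. If the orders differ, the inverse of \<open>p\<close>
  with the pair \<open>(p x, x)\<close> takes over.\<close>

lemma normal_in_stabilizer_transitive: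
  assumes y: "y \<in> Y" and P: "P \<subseteq> H y" and inv: "\<And>p. p \<in> P \<Longrightarrow> invf p \<in> P"
    and conj: "\<And>h p. h \<in> H y \<Longrightarrow> p \<in> P \<Longrightarrow> h \<circ> p \<circ> invf h \<in> P"
    and p: "p \<in> P" "p \<noteq> id" and zw: "z \<in> Y" "w \<in> Y" "z \<noteq> y" "w \<noteq> y" "z \<noteq> w"
  obtains q where "q \<in> P" "q z = w"
proof -
  have pG: "p \<in> G" "p y = y" using P p by (auto simp: H_def)
  obtain x where x: "x \<in> Y" "p x \<noteq> x" using moves_Y G_Homeo pG p by metis
  have px: "p x \<in> Y" using invariant_Y pG x by blast
  have "x \<noteq> y" using x pG by auto
  have "p x \<noteq> y" using Homeo_eq_iff[OF G_Homeo[OF pG(1)], of x y] pG(2) \<open>x \<noteq> y\<close> by auto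
  obtain r where r: "y = cr r" using circle_lift_exists by blast
  have lift: "\<exists>s. r < s \<and> s < r + 1 \<and> v = cr s" if "v \<noteq> y" for v
  proof -
    obtain s where "r \<le> s" "s < r + 1" "v = cr s" by (rule circle_cases)
    then show ?thesis using that r by (intro exI[of _ s]) (cases "s = r", auto)
  qed
  obtain s where s: "r < s" "s < r + 1" "x = cr s" using lift[OF \<open>x \<noteq> y\<close>] by blast
  obtain s' where s': "r < s'" "s' < r + 1" "p x = cr s'" using lift[OF \<open>p x \<noteq> y\<close>] by blast
  obtain t where t: "r < t" "t < r + 1" "z = cr t" using lift[OF zw(3)] by blast
  obtain t' where t': "r < t'" "t' < r + 1" "w = cr t'" using lift[OF zw(4)] by blast
  have ne: "s \<noteq> s'" "t \<noteq> t'" using x s s' zw t t' by auto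
  have inY: "cr r \<in> Y" "cr s \<in> Y" "cr s' \<in> Y"
    "cr t \<in> Y" "cr t' \<in> Y"
    using r y x px s s' t t' zw by auto
  have main: "\<exists>q\<in>P. q (cr t) = cr t'"
    if q: "q \<in> P" "q (cr s) = cr s'"
      and st: "r < s" "s < r + 1" "r < s'" "s' < r + 1" "r < t" "t < r + 1" "r < t'" "t' < r + 1"
      and lt: "s < s' \<and> t < t' \<or> s' < s \<and> t' < t"
      and inY: "cr r \<in> Y" "cr s \<in> Y" "cr s' \<in> Y"
        "cr t \<in> Y" "cr t' \<in> Y"
    for q s s' t t'
  proof -
    have "\<exists>g\<in>G. g y = y \<and> g (cr s) = cr t \<and> g (cr s') = cr t'"
      using lt
    proof
      assume "s < s' \<and> t < t'"
      then show ?thesis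
        using triple_transitive[of r s s' r t t'] st inY r by auto
    next
      assume "s' < s \<and> t' < t"
      then show ?thesis
        using triple_transitive[of r s' s r t' t] st inY r by auto
    qed
    then obtain g where g: "g \<in> H y" "g (cr s) = cr t"
      "g (cr s') = cr t'" by (auto simp: H_def)
    have gH: "g \<in> Homeo" using g(1) G_Homeo by (simp add: H_def)
    have "(g \<circ> q \<circ> invf g) (cr t) = cr t'"
      using g q Homeo_inv_f[OF gH, of "cr s"] by simp
    then show ?thesis using conj[OF g(1) q(1)] by blast
  qed
  have "\<exists>q\<in>P. q (cr t) = cr t'"
  proof (cases "s < s' \<and> t < t' \<or> s' < s \<and> t' < t")
    case True
    have ps: "p (cr s) = cr s'" using s s' by simp
    show ?thesis by (rule main[OF p(1) ps s(1,2) s'(1,2) t(1,2) t'(1,2) True inY])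
  next
    case False
    then have *: "s' < s \<and> t < t' \<or> s < s' \<and> t' < t" using ne by linarith
    have ps: "invf p (cr s') = cr s"
      using s s' Homeo_inv_f[OF G_Homeo[OF pG(1)], of x] by simp
    show ?thesis
      by (rule main[OF inv[OF p(1)] ps s'(1,2) s(1,2) t(1,2) t'(1,2) * inY(1,3,2,4,5)])
  qed
  then show ?thesis using that t t' by blast
qed

text \<open>No base point has to be preserved here, so transitivity on pairs suffices and no orders
  have to be compared.\<close>

lemma normal_transitive:
  assumes K: "K \<subseteq> G" and conj: "\<And>h k. h \<in> G \<Longrightarrow> k \<in> K \<Longrightarrow> h \<circ> k \<circ> invf h \<in> K"
    and k: "k \<in> K" "k \<noteq> id" and zw: "z \<in> Y" "w \<in> Y" "z \<noteq> w"
  obtains q where "q \<in> K" "q z = w"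
proof -
  have kG: "k \<in> G" using K k by blast
  obtain x where x: "x \<in> Y" "k x \<noteq> x" using moves_Y G_Homeo kG k by metis
  then obtain g where g: "g \<in> G" "g x = z" "g (k x) = w"
    using pair_transitive[OF x(1) invariant_Y[OF kG x(1)] _ zw] by metis
  have "(g \<circ> k \<circ> invf g) z = w" using g Homeo_inv_f[OF G_Homeo[OF g(1)], of x] by simp
  then show ?thesis using that conj[OF g(1) k(1)] by blast
qed

text \<open>A transitive abelian permutation group is free, as point stabilizers are conjugate and
  hence equal. Density of \<open>Y\<close> turns triviality on \<open>Y\<close> into
  triviality.\<close>

lemma transitive_abelian_free:
  assumes y: "y \<in> Y" and A: "A \<subseteq> H y" and comm: "\<And>a b. a \<in> A \<Longrightarrow> b \<in> A \<Longrightarrow> a \<circ> b = b \<circ> a"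
    and trans: "\<And>z w. z \<in> Y \<Longrightarrow> w \<in> Y \<Longrightarrow> z \<noteq> y \<Longrightarrow> w \<noteq> y \<Longrightarrow> z \<noteq> w \<Longrightarrow> \<exists>a\<in>A. a z = w"
    and a: "a \<in> A" "z \<in> Y" "z \<noteq> y" "a z = z"
  shows "a = id"
proof (rule eq_on_Y[OF _ Homeo_id])
  show "a \<in> Homeo" using A a G_Homeo by (auto simp: H_def)
  show "a w = id w" if w: "w \<in> Y" for w
  proof (cases "w = y \<or> w = z")
    case True then show ?thesis using A a by (auto simp: H_def)
  next
    case False
    then obtain b where b: "b \<in> A" "b z = w" using trans[OF a(2) w a(3)] by metis
    have "a (b z) = b (a z)" using fun_cong[OF comm[OF a(1) b(1)], of z] by simp
    then show ?thesis using a b by simp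
  qed
qed

lemma other_point:
  obtains z where "z \<in> Y" "z \<noteq> y"
proof -
  obtain r where r: "y = cr r" using circle_lift_exists by blast
  obtain s where s: "r < s" "s < r + 1" "cr s \<in> Y" by (rule Y_between[of r "r + 1"]) auto
  have "cr s \<noteq> y" unfolding r using s by (auto dest!: circle_of_real_eqD)
  then show ?thesis using that s by blast
qed

text \<open>An abelian stabilizer would be free on the rest of \<open>Y\<close>, but transitivity on
  triples provides an \<open>f\<close> that fixes \<open>y\<close> and another point of
  \<open>Y\<close> and moves a third one.\<close>

lemma stabilizer_not_abelian:
  assumes y: "y \<in> Y"
  obtains f g where "f \<in> H y" "g \<in> H y" "f \<circ> g \<noteq> g \<circ> f"
proof -
  obtain r where r: "y = cr r" using circle_lift_exists by blast
  obtain s1 where s1: "r < s1" "s1 < r + 1" "cr s1 \<in> Y" by (rule Y_between[of r "r + 1"]) auto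
  obtain s2 where s2: "s1 < s2" "s2 < r + 1" "cr s2 \<in> Y" by (rule Y_between[OF s1(2)])
  obtain s3 where s3: "s2 < s3" "s3 < r + 1" "cr s3 \<in> Y" by (rule Y_between[OF s2(2)])
  obtain f where f: "f \<in> G" "f (cr r) = cr r"
    "f (cr s1) = cr s1" "f (cr s2) = cr s3"
    by (rule triple_transitive[of r s1 s2 r s1 s3]) (use s1 s2 s3 r y in auto)
  have fH: "f \<in> H y" using f r by (simp add: H_def)
  have ne: "cr s1 \<noteq> y" "cr s2 \<noteq> cr s3" "cr s2 \<noteq> cr s1"
    unfolding r using s1 s2 s3 by (auto dest!: circle_of_real_eqD)
  have tr: "\<exists>g\<in>H y. g z = w" if "z \<in> Y" "w \<in> Y" "z \<noteq> y" "w \<noteq> y" for z w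
    using pair_transitive[OF y that(1) that(3)[symmetric] y that(2) that(4)[symmetric]]
    by (auto simp: H_def)
  have "f \<noteq> id" using f ne by auto
  then have "\<not> (\<forall>f\<in>H y. \<forall>g\<in>H y. f \<circ> g = g \<circ> f)"
    using transitive_abelian_free[OF y order_refl _ _ fH s1(3) ne(1) f(3)] tr by blast
  then show ?thesis using that by blast
qed

text \<open>Take an arc from \<open>a\<close> to \<open>b\<close> disjoint from \<open>J\<close> and
  an arc from \<open>p\<close> to \<open>q\<close> inside \<open>I\<close>, with all ends in
  \<open>Y\<close>. Sending \<open>b\<close> to \<open>p\<close> and \<open>a\<close> to
  \<open>q\<close>, in this crossed manner, maps the complementary arc, which contains
  \<open>J\<close>, into \<open>I\<close>.\<close>

lemma standard_proximal:
  assumes I: "open I" "I \<noteq> {}" and J: "closure J \<noteq> UNIV"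
  obtains g where "g \<in> G" "g ` J \<subseteq> I"
proof -
  have "open (- closure J)" using open_Compl[OF closed_closure] .
  moreover obtain x where "x \<in> - closure J" using J by blast
  ultimately obtain t a b where "x = cr t" and a: "t < a" and b: "a < b" "b < t + 1/2"
    and abY: "cr a \<in> Y" "cr b \<in> Y"
    and inJ: "\<And>q. t \<le> q \<Longrightarrow> q \<le> b \<Longrightarrow> cr q \<in> - closure J"
    by (rule Y_arc_in_open) blast
  have ab: "b < a + 1" using a b by simp
  have "cr ` {a..b} \<inter> J = {}"
  proof (rule ccontr)
    assume "cr ` {a..b} \<inter> J \<noteq> {}"
    then obtain s where s: "a \<le> s" "s \<le> b" "cr s \<in> J" by auto
    have "cr s \<in> - closure J" by (rule inJ) (use s a b in auto)
    then show False using s(3) closure_subset by blast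
  qed
  then have JJ: "J \<subseteq> cr ` {b<..<a+1}" using Compl_arc[OF b(1) ab] by blast
  obtain x where "x \<in> I" using I by blast
  with I(1) obtain u p q where "x = cr u" and p: "u < p" and q: "p < q" "q < u + 1/2"
    and pqY: "cr p \<in> Y" "cr q \<in> Y"
    and inI: "\<And>r. u \<le> r \<Longrightarrow> r \<le> q \<Longrightarrow> cr r \<in> I"
    by (rule Y_arc_in_open) blast
  have ne: "cr b \<noteq> cr a" "cr p \<noteq> cr q"
    using a b p q ab by (auto dest!: circle_of_real_eqD)
  obtain g where g: "g \<in> G" "g (cr b) = cr p" "g (cr a) = cr q"
    using pair_transitive[OF abY(2,1) ne(1) pqY ne(2)] by blast
  have gH: "g \<in> Homeo" using g G_Homeo by blast
  obtain F where F: "is_lift g F" "F b = p" using lift_through[OF gH g(2)] by blast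
  have "F b < F (a + 1)" "F (a + 1) < F (b + 1)" using is_lift_less[OF F(1)] ab b(1) by auto
  moreover have "F (b + 1) = p + 1" using is_lift_add_1[OF Homeo_inj[OF gH] F(1)] F(2) by simp
  moreover have "cr (F (a + 1)) = cr q"
    using is_lift_eq[OF F(1), of "a + 1"] g(3) by simp
  ultimately have Fa: "F (a + 1) = q" using p q F(2) by (intro circle_of_real_eqD) auto
  have "g ` J \<subseteq> I"
  proof
    fix z assume "z \<in> g ` J"
    then obtain x where x: "x \<in> J" "z = g x" by blast
    then have "x \<in> cr ` {b<..<a+1}" using JJ by blast
    then obtain s where s: "b < s" "s < a + 1" "z = g (cr s)" using x(2) by auto
    have "p < F s" "F s < q" using is_lift_less[OF F(1), of b s] is_lift_less[OF F(1), of s "a + 1"] s F(2) Fa by auto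
    then have "cr (F s) \<in> I" using p q by (intro inI) auto
    then show "z \<in> I" using s(3) is_lift_eq[OF F(1)] by simp
  qed
  then show ?thesis using that g(1) by blast
qed

end

section \<open>Germs at a fixed point\<close>

definition affine_germ :: "(circle \<Rightarrow> real) \<Rightarrow> circle filter \<Rightarrow> (circle \<Rightarrow> circle) \<Rightarrow> real \<Rightarrow> real \<Rightarrow> bool"
  where "affine_germ \<psi> \<Phi> f m c \<longleftrightarrow> eventually (\<lambda>x. \<psi> (f x) = m * \<psi> x + c) \<Phi>"

text \<open>The slopes cancel in a commutator of affine maps. For \<open>w\<close> the image of
  \<open>x\<close> under both inverses, \<open>x\<close> is \<open>b (a w)\<close> while the
  commutator sends \<open>x\<close> to \<open>a (b w)\<close>; the translation is the difference of
  the constant terms \<open>m * d + c\<close> and \<open>n * c + d\<close>.\<close>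

lemma affine_germ_com:
  assumes a: "a \<in> Homeo" "filterlim a \<Phi> \<Phi>" "filterlim (invf a) \<Phi> \<Phi>" "affine_germ \<psi> \<Phi> a m c"
    and b: "b \<in> Homeo" "filterlim b \<Phi> \<Phi>" "filterlim (invf b) \<Phi> \<Phi>" "affine_germ \<psi> \<Phi> b n d"
  shows "affine_germ \<psi> \<Phi> (com a b) 1 (m * d + c - n * c - d)"
proof -
  define w where "w x = invf a (invf b x)" for x
  have lw: "filterlim w \<Phi> \<Phi>" unfolding w_def using filterlim_compose a(3) b(3) by blast
  have lbw: "filterlim (\<lambda>x. b (w x)) \<Phi> \<Phi>" and law: "filterlim (\<lambda>x. a (w x)) \<Phi> \<Phi>"
    using filterlim_compose[OF _ lw] a(2) b(2) by blast+
  have "eventually (\<lambda>x. \<psi> (a (b (w x))) = m * \<psi> (b (w x)) + c) \<Phi>"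
    using eventually_compose_filterlim[OF a(4)[unfolded affine_germ_def] lbw] .
  moreover have "eventually (\<lambda>x. \<psi> (b (w x)) = n * \<psi> (w x) + d) \<Phi>"
    using eventually_compose_filterlim[OF b(4)[unfolded affine_germ_def] lw] .
  moreover have "eventually (\<lambda>x. \<psi> (b (a (w x))) = n * \<psi> (a (w x)) + d) \<Phi>"
    using eventually_compose_filterlim[OF b(4)[unfolded affine_germ_def] law] .
  moreover have "eventually (\<lambda>x. \<psi> (a (w x)) = m * \<psi> (w x) + c) \<Phi>"
    using eventually_compose_filterlim[OF a(4)[unfolded affine_germ_def] lw] .
  ultimately have "eventually (\<lambda>x. \<psi> (a (b (w x))) = \<psi> (b (a (w x))) + (m * d + c - n * c - d)) \<Phi>"
    by eventually_elim (simp add: algebra_simps)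
  moreover have "b (a (w x)) = x" "a (b (w x)) = com a b x" for x
    using a(1) b(1) by (simp_all add: w_def com_def)
  ultimately show ?thesis by (simp add: affine_germ_def)
qed

definition right_germs :: "real \<Rightarrow> circle filter"
  where "right_germs t = filtermap cr (at_right t)"

definition left_germs :: "real \<Rightarrow> circle filter"
  where "left_germs t = filtermap cr (at_left t)"

lemma lift_filterlim:
  assumes F: "is_lift f F" "F t = t"
  shows "filterlim F (at_right t) (at_right t)" "filterlim F (at_left t) (at_left t)"
    "filterlim f (right_germs t) (right_germs t)" "filterlim f (left_germs t) (left_germs t)"
proof -
  have lim: "(F \<longlongrightarrow> t) (at t)"
    using is_lift_isCont[OF F(1), of t] F(2) unfolding isCont_def by simp
  show 1: "filterlim F (at_right t) (at_right t)"
    unfolding filterlim_at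
  proof
    show "(F \<longlongrightarrow> t) (at_right t)" using lim by (rule tendsto_mono[rotated]) (simp add: at_le)
    show "\<forall>\<^sub>F x in at_right t. F x \<in> {t<..} \<and> F x \<noteq> t"
      unfolding eventually_at_filter using is_lift_less[OF F(1), of t] F(2) by (intro always_eventually) auto
  qed
  show 2: "filterlim F (at_left t) (at_left t)"
    unfolding filterlim_at
  proof
    show "(F \<longlongrightarrow> t) (at_left t)" using lim by (rule tendsto_mono[rotated]) (simp add: at_le)
    show "\<forall>\<^sub>F x in at_left t. F x \<in> {..<t} \<and> F x \<noteq> t"
      unfolding eventually_at_filter using is_lift_less[OF F(1), of _ t] F(2) by (intro always_eventually) auto
  qed
  have eq: "(\<lambda>x. f (cr x)) = (\<lambda>x. cr (F x))" using is_lift_eq[OF F(1)] by blast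
  show "filterlim f (right_germs t) (right_germs t)"
    unfolding right_germs_def filterlim_filtermap eq
    using filterlim_compose[OF _ 1] by (auto simp: filterlim_def filtermap_mono filtermap_filtermap[symmetric])
  show "filterlim f (left_germs t) (left_germs t)"
    unfolding left_germs_def filterlim_filtermap eq
    using filterlim_compose[OF _ 2] by (auto simp: filterlim_def filtermap_mono filtermap_filtermap[symmetric])
qed

definition trivial_near :: "circle \<Rightarrow> (circle \<Rightarrow> circle) \<Rightarrow> bool"
  where "trivial_near y g \<longleftrightarrow> (\<exists>U. open U \<and> y \<in> U \<and> (\<forall>x\<in>U. g x = x))"

text \<open>One chart serves both sides, but slope and translation may differ between them. The
  fixed point is left out of injectivity because the projective chart has a pole there.\<close>

definition germ_chart :: "(circle \<Rightarrow> circle) set \<Rightarrow> real \<Rightarrow> (circle \<Rightarrow> real) \<Rightarrow> bool"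
  where "germ_chart H t \<psi> \<longleftrightarrow> inj_on \<psi> (- {cr t}) \<and>
    (\<forall>h\<in>H. \<exists>m c. affine_germ \<psi> (right_germs t) h m c) \<and>
    (\<forall>h\<in>H. \<exists>m c. affine_germ \<psi> (left_germs t) h m c)"

text \<open>The germs at a fixed point form a metabelian group, as both sides are affine in the chart.\<close>

lemma second_commutator_trivial_near:
  assumes chart: "germ_chart H t \<psi>"
    and H: "\<And>h. h \<in> H \<Longrightarrow> h \<in> Homeo \<and> h (cr t) = cr t"
    and closed: "\<And>h. h \<in> H \<Longrightarrow> invf h \<in> H" "\<And>f g. f \<in> H \<Longrightarrow> g \<in> H \<Longrightarrow> com f g \<in> H"
    and abcd: "a \<in> H" "b \<in> H" "c \<in> H" "d \<in> H"
  shows "trivial_near (cr t) (com (com a b) (com c d))"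
proof -
  define k where "k = com (com a b) (com c d)"
  have kH: "k \<in> H" unfolding k_def by (intro closed abcd)
  have ev: "eventually (\<lambda>x. k x = x) \<Phi>"
    if lim: "\<And>h. h \<in> H \<Longrightarrow> filterlim h \<Phi> \<Phi>"
      and germ: "\<And>h. h \<in> H \<Longrightarrow> \<exists>m c. affine_germ \<psi> \<Phi> h m c"
      and ne: "eventually (\<lambda>x. x \<noteq> cr t) \<Phi>" for \<Phi>
  proof -
    have tr: "\<exists>c. affine_germ \<psi> \<Phi> (com f g) 1 c" if fg: "f \<in> H" "g \<in> H" for f g
    proof -
      obtain m c where mc: "affine_germ \<psi> \<Phi> f m c" using germ fg by blast
      obtain n d where nd: "affine_germ \<psi> \<Phi> g n d" using germ fg by blast
      have "f \<in> Homeo" "g \<in> Homeo" using H fg by blast+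
      then have "affine_germ \<psi> \<Phi> (com f g) 1 (m * d + c - n * c - d)"
        by (intro affine_germ_com lim closed fg mc nd)
      then show ?thesis by blast
    qed
    obtain r where r: "affine_germ \<psi> \<Phi> (com a b) 1 r" using tr abcd by blast
    obtain s where s: "affine_germ \<psi> \<Phi> (com c d) 1 s" using tr abcd by blast
    have cH: "com a b \<in> H" "com c d \<in> H" using closed abcd by auto
    then have "com a b \<in> Homeo" "com c d \<in> Homeo" using H by blast+
    \<comment> \<open>For two translations the formula for the constant term gives zero, so the
      second commutator is the identity in the chart.\<close>
    then have "affine_germ \<psi> \<Phi> k 1 (1 * s + r - 1 * r - s)"
      unfolding k_def by (intro affine_germ_com lim closed cH r s)
    then have "eventually (\<lambda>x. \<psi> (k x) = \<psi> x) \<Phi>" by (simp add: affine_germ_def)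
    then show ?thesis using ne
    proof eventually_elim
      case (elim x)
      have "k x \<noteq> cr t"
        using elim(2) H[OF kH] Homeo_eq_iff[of k x "cr t"] by auto
      then show ?case using elim chart unfolding germ_chart_def inj_on_def by blast
    qed
  qed
  have lims: "filterlim h (right_germs t) (right_germs t)" "filterlim h (left_germs t) (left_germs t)"
    if "h \<in> H" for h
  proof -
    obtain F where F: "is_lift h F" "F t = t" using lift_through[of h t t] H[OF \<open>h \<in> H\<close>] by blast
    show "filterlim h (right_germs t) (right_germs t)" "filterlim h (left_germs t) (left_germs t)"
      using lift_filterlim[OF F] by auto
  qed
  have ne_near: "eventually (\<lambda>s. cr s \<noteq> cr t) (at t)"
    unfolding eventually_at
    by (rule exI[of _ 1]) (auto simp: dist_real_def dest!: circle_of_real_eqD)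
  have "eventually (\<lambda>s. cr s \<noteq> cr t) (at_right t)"
    "eventually (\<lambda>s. cr s \<noteq> cr t) (at_left t)"
    using ne_near by (auto simp: eventually_at_split)
  then have ne: "eventually (\<lambda>x. x \<noteq> cr t) (right_germs t)"
    "eventually (\<lambda>x. x \<noteq> cr t) (left_germs t)"
    by (simp_all add: right_germs_def left_germs_def eventually_filtermap)
  have "eventually (\<lambda>x. k x = x) (right_germs t)"
    by (rule ev[OF lims(1) _ ne(1)]) (use chart in \<open>auto simp: germ_chart_def\<close>)
  moreover have "eventually (\<lambda>x. k x = x) (left_germs t)"
    by (rule ev[OF lims(2) _ ne(2)]) (use chart in \<open>auto simp: germ_chart_def\<close>)
  ultimately have "eventually (\<lambda>s. k (cr s) = cr s) (at t)"
    by (simp add: eventually_at_split right_germs_def left_germs_def eventually_filtermap)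
  then obtain e where e: "e > 0" "\<And>s. s \<noteq> t \<Longrightarrow> dist s t < e \<Longrightarrow> k (cr s) = cr s"
    unfolding eventually_at by blast
  have "k x = x" if "x \<in> cr ` ball t e" for x
  proof -
    obtain s where s: "x = cr s" "dist s t < e" using \<open>x \<in> _\<close> by (auto simp: dist_commute)
    show ?thesis using e(2)[OF _ s(2)] H[OF kH] unfolding s(1) by (cases "s = t") auto
  qed
  moreover have "open (cr ` ball t e)" by (rule open_circle_of_real_image) simp
  moreover have "cr t \<in> cr ` ball t e" using e(1) by simp
  ultimately show ?thesis unfolding trivial_near_def k_def by blast
qed

text \<open>On a given side of \<open>t0\<close>, an arc contains either all or none of the
  sufficiently close points, and finitely many arcs that cover the circle cannot all miss them. The
  integer \<open>n\<close> adjusts \<open>t\<close> to the particular lift by which the arc is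
  encoded.\<close>

lemma arc_cover_one_sided:
  assumes A: "arc_cover A" and \<Phi>: "\<Phi> = at_right t0 \<or> \<Phi> = at_left t0"
  shows "\<exists>(a, b)\<in>A. \<exists>n::int. eventually (\<lambda>t. t - of_int n \<in> {a..b}) \<Phi>"
proof -
  have fin: "finite A" and ab: "\<And>a b. (a, b) \<in> A \<Longrightarrow> a < b \<and> b < a + 1"
    and cov: "(\<Union>(a, b)\<in>A. cr ` {a..b}) = UNIV"
    using A unfolding arc_cover_def by auto
  have contra: False
    if nontrivial: "\<Phi> \<noteq> bot"
      and each: "\<And>a b. (a, b) \<in> A \<Longrightarrow> eventually (\<lambda>t. cr t \<notin> cr ` {a..b}) \<Phi>"
  proof -
    have "eventually (\<lambda>t. \<forall>p\<in>A. cr t \<notin> cr ` {fst p..snd p}) \<Phi>"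
      using each by (intro eventually_ball_finite[OF fin]) auto
    then obtain t where t: "\<forall>p\<in>A. cr t \<notin> cr ` {fst p..snd p}"
      using eventually_happens'[OF nontrivial] by blast
    have "cr t \<in> (\<Union>(a, b)\<in>A. cr ` {a..b})" unfolding cov by simp
    then show False using t by force
  qed
  have right: "(\<exists>n::int. eventually (\<lambda>t. t - of_int n \<in> {a..b}) (at_right t0)) \<or>
      eventually (\<lambda>t. cr t \<notin> cr ` {a..b}) (at_right t0)"
    if "(a, b) \<in> A" for a b
  proof -
    define n where "n = \<lfloor>t0 - a\<rfloor>"
    have n: "a + n \<le> t0" "t0 < a + n + 1" unfolding n_def by linarith+
    show ?thesis
    proof (cases "t0 < b + n")
      case True
      have "eventually (\<lambda>t. t - of_int n \<in> {a..b}) (at_right t0)"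
        unfolding eventually_at_right_field by (rule exI[of _ "b + n"]) (use True n in auto)
      then show ?thesis by blast
    next
      case False
      have "eventually (\<lambda>t. cr t \<notin> cr ` {a..b}) (at_right t0)"
        unfolding eventually_at_right_field
      proof (intro exI[of _ "a + n + 1"] conjI allI impI)
        fix t assume t: "t0 < t" "t < a + n + 1"
        have "cr (t - n) \<notin> cr ` {a..b}"
          using in_arc_iff(1)[of a "t - n" b] ab[OF that] t False n by auto
        then show "cr t \<notin> cr ` {a..b}"
          using circle_of_real_add_int[of "t - n" n] by simp
      qed (use n in auto)
      then show ?thesis by blast
    qed
  qed
  have left: "(\<exists>n::int. eventually (\<lambda>t. t - of_int n \<in> {a..b}) (at_left t0)) \<or>
      eventually (\<lambda>t. cr t \<notin> cr ` {a..b}) (at_left t0)"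
    if "(a, b) \<in> A" for a b
  proof -
    \<comment> \<open>Unlike the floor used on the right, this choice allows
      \<open>t0 = a + n + 1\<close> and excludes \<open>t0 = a + n\<close>: when \<open>t0\<close>
      is congruent to \<open>a\<close>, the points to its left belong to the end of the preceding
      period.\<close>
    define n where "n = \<lceil>t0 - a\<rceil> - 1"
    have n: "a + n < t0" "t0 \<le> a + n + 1" unfolding n_def by linarith+
    show ?thesis
    proof (cases "t0 \<le> b + n")
      case True
      have "eventually (\<lambda>t. t - of_int n \<in> {a..b}) (at_left t0)"
        unfolding eventually_at_left_field by (rule exI[of _ "a + n"]) (use True n in auto)
      then show ?thesis by blast
    next
      case False
      have "eventually (\<lambda>t. cr t \<notin> cr ` {a..b}) (at_left t0)"
        unfolding eventually_at_left_field
      proof (intro exI[of _ "b + n"] conjI allI impI)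
        fix t assume t: "b + n < t" "t < t0"
        have "cr (t - n) \<notin> cr ` {a..b}"
          using in_arc_iff(1)[of a "t - n" b] ab[OF that] t False n by auto
        then show "cr t \<notin> cr ` {a..b}"
          using circle_of_real_add_int[of "t - n" n] by simp
      qed (use False in auto)
      then show ?thesis by blast
    qed
  qed
  have "\<Phi> \<noteq> bot" using \<Phi> by (elim disjE) simp_all
  then show ?thesis using contra right left \<Phi> by blast
qed

lemma eventually_constant_of_int:
  fixes u :: "real \<Rightarrow> real"
  assumes lim: "(u \<longlongrightarrow> l) \<Phi>" and int: "eventually (\<lambda>t. u t \<in> \<int>) \<Phi>"
  shows "\<exists>k. eventually (\<lambda>t. u t = k) \<Phi>"
proof -
  have "eventually (\<lambda>t. dist (u t) l < 1/2) \<Phi>" using tendstoD[OF lim, of "1/2"] by simp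
  then have "eventually (\<lambda>t. u t = of_int (round l)) \<Phi>" using int
  proof eventually_elim
    case (elim t)
    obtain j :: int where j: "u t = of_int j" using elim(2) by (auto elim: Ints_cases)
    have "round l = j" using elim(1) by (intro round_unique') (simp add: j dist_real_def abs_minus_commute)
    then show ?case using j by simp
  qed
  then show ?thesis by blast
qed

text \<open>On the piece, \<open>F\<close> differs from an affine map by integers. The difference
  has a limit at \<open>t0\<close>, so the integer is eventually constant.\<close>

lemma piecewise_linear_lift_affine:
  assumes F: "is_lift f F" and \<Phi>: "\<Phi> \<le> at t0"
    and piece: "\<And>t. t \<in> {a..b} \<Longrightarrow> f (cr t) = cr (m * t + c)"
    and ev: "eventually (\<lambda>t. t - of_int n \<in> {a..b}) \<Phi>"
  shows "\<exists>k. eventually (\<lambda>t. F t = m * t + k) \<Phi>"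
proof -
  define u where "u t = F t - m * t" for t
  have "isCont u t0" unfolding u_def using is_lift_isCont[OF F] by (intro continuous_intros)
  then have "((\<lambda>t. u t - (c - m * n)) \<longlongrightarrow> u t0 - (c - m * n)) (at t0)" unfolding isCont_def by (intro tendsto_intros)
  then have lim: "((\<lambda>t. u t - (c - m * n)) \<longlongrightarrow> u t0 - (c - m * n)) \<Phi>" using \<Phi> tendsto_mono by blast
  have "eventually (\<lambda>t. u t - (c - m * n) \<in> \<int>) \<Phi>" using ev
  proof eventually_elim
    case (elim t)
    have "cr (F t) = f (cr t)" using is_lift_eq[OF F] by simp
    also have "\<dots> = f (cr (t - n))" using circle_of_real_add_int[of "t - n" n] by simp
    also have "\<dots> = cr (m * (t - n) + c)" using elim by (intro piece) auto
    finally obtain j :: int where "F t = m * (t - n) + c + j" using circle_of_real_eq_iff by blast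
    then have "u t - (c - m * n) = j" by (simp add: u_def algebra_simps)
    then show ?case by simp
  qed
  then obtain k where "eventually (\<lambda>t. u t - (c - m * n) = k) \<Phi>"
    using eventually_constant_of_int[OF lim] by blast
  then have "eventually (\<lambda>t. F t = m * t + (k + (c - m * n))) \<Phi>"
    by eventually_elim (simp add: u_def algebra_simps)
  then show ?thesis by blast
qed

lemma germ_chart_linear:
  assumes H: "\<And>h. h \<in> H \<Longrightarrow> h \<in> Homeo \<and> h (cr t0) = cr t0 \<and> piecewise_linear h"
  shows "\<exists>\<psi>. germ_chart H t0 \<psi>"
proof -
  define \<psi> where "\<psi> x = (SOME t. t0 \<le> t \<and> t < t0 + 1 \<and> x = cr t)" for x
  have \<psi>: "t0 \<le> \<psi> x \<and> \<psi> x < t0 + 1 \<and> x = cr (\<psi> x)" for x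
    unfolding \<psi>_def by (rule someI_ex) (use circle_cases[of t0 x] in blast)
  have \<psi>_eq: "\<psi> (cr t) = t" if "t0 \<le> t" "t < t0 + 1" for t
    using \<psi>[of "cr t"] that by (intro circle_of_real_eqD) auto
  have inj: "inj_on \<psi> (- {cr t0})" by (rule inj_onI) (metis \<psi>)
  \<comment> \<open>The chart jumps at \<open>t0\<close>. The integer \<open>j\<close> is 0 on the
    right and 1 on the left, where the chart reads \<open>t + 1\<close>; it affects only the
    constant term.\<close>
  have germ: "\<exists>m c. eventually (\<lambda>t. \<psi> (h (cr t)) = m * \<psi> (cr t) + c) \<Phi>"
    if h: "h \<in> H" and \<Phi>: "\<Phi> = at_right t0 \<or> \<Phi> = at_left t0"
      and near: "eventually (\<lambda>t. t0 \<le> t + of_int j \<and> t + of_int j < t0 + 1) \<Phi>" for h \<Phi> and j :: int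
  proof -
    have \<psi>_eq': "\<psi> (cr t) = t + of_int j" if "t0 \<le> t + of_int j \<and> t + of_int j < t0 + 1" for t
      using \<psi>_eq[of "t + of_int j"] that by simp
    obtain F where F: "is_lift h F" "F t0 = t0" using lift_through[of h t0 t0] H[OF h] by blast
    have "filterlim F \<Phi> \<Phi>" using lift_filterlim(1,2)[OF F] \<Phi> by auto
    note nearF = eventually_compose_filterlim[OF near this]
    obtain A where A: "arc_cover A" "\<And>a b. (a, b) \<in> A \<Longrightarrow>
      \<exists>m c. \<forall>t\<in>{a..b}. h (cr t) = cr (m * t + c)"
      using H[OF h] unfolding piecewise_linear_def by blast
    obtain a b n where ab: "(a, b) \<in> A" "eventually (\<lambda>t. t - of_int n \<in> {a..b}) \<Phi>"
      using arc_cover_one_sided[OF A(1) \<Phi>] by auto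
    obtain m c where mc: "\<And>t. t \<in> {a..b} \<Longrightarrow> h (cr t) = cr (m * t + c)"
      using A(2)[OF ab(1)] by blast
    have "\<Phi> \<le> at t0" using \<Phi> by (auto intro: at_le)
    then obtain k where "eventually (\<lambda>t. F t = m * t + k) \<Phi>"
      using piecewise_linear_lift_affine[OF F(1) _ mc ab(2)] by blast
    then have "eventually (\<lambda>t. \<psi> (h (cr t)) = m * \<psi> (cr t) + (k + j - m * j)) \<Phi>"
      using near nearF by eventually_elim (simp add: is_lift_eq[OF F(1)] \<psi>_eq' algebra_simps)
    then show ?thesis by blast
  qed
  have "eventually (\<lambda>t. t0 \<le> t + of_int 0 \<and> t + of_int 0 < t0 + 1) (at_right t0)"
    "eventually (\<lambda>t. t0 \<le> t + of_int 1 \<and> t + of_int 1 < t0 + 1) (at_left t0)"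
    unfolding eventually_at_right_field eventually_at_left_field
    by (auto intro: exI[of _ "t0 + 1"] exI[of _ "t0 - 1"])
  then show ?thesis
    using germ inj unfolding germ_chart_def affine_germ_def right_germs_def left_germs_def eventually_filtermap
    by blast
qed

section \<open>The Cayley transform and the chart for piecewise projective maps\<close>

lemma Rep_cayley:
  "Rep_circle (cayley p) = (case p of None \<Rightarrow> 1 | Some x \<Rightarrow> (of_real x - \<i>) / (of_real x + \<i>))"
proof -
  have "norm (complex_of_real x - \<i>) = norm (complex_of_real x + \<i>)" for x
    by (simp add: cmod_def)
  moreover have "complex_of_real x + \<i> \<noteq> 0" for x
    by (simp add: complex_eq_iff)
  ultimately show ?thesis unfolding cayley_def
    by (intro Abs_circle_inverse) (auto simp: norm_divide split: option.split)
qed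

lemma inj_cayley: "inj cayley"
proof (rule injI)
  fix p q assume "cayley p = cayley q"
  then have eq: "Rep_circle (cayley p) = Rep_circle (cayley q)" by simp
  have nz: "complex_of_real x + \<i> \<noteq> 0" for x by (simp add: complex_eq_iff)
  show "p = q"
  proof (cases p; cases q)
    fix x y assume pq: "p = Some x" "q = Some y"
    have "(of_real x - \<i>) * (of_real y + \<i>) = (of_real y - \<i>) * (complex_of_real x + \<i>)"
      using eq nz[of x] nz[of y] unfolding Rep_cayley pq by (simp add: frac_eq_eq)
    then show ?thesis unfolding pq by (simp add: complex_eq_iff algebra_simps)
  next
    fix y assume pq: "p = None" "q = Some y"
    have "complex_of_real y - \<i> = complex_of_real y + \<i>"
      using eq nz[of y] unfolding Rep_cayley pq by (simp add: eq_divide_eq)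
    then show ?thesis by (simp add: complex_eq_iff)
  next
    fix x assume pq: "p = Some x" "q = None"
    have "complex_of_real x - \<i> = complex_of_real x + \<i>"
      using eq nz[of x] unfolding Rep_cayley pq by (simp add: divide_eq_eq)
    then show ?thesis by (simp add: complex_eq_iff)
  qed simp
qed

lemma cayley_None: "cayley None = cr 0"
  by (simp add: cayley_def circle_of_real_def)

text \<open>Multiplying numerator and denominator of the Cayley transform by
  \<open>sin (pi * t)\<close> turns them into \<open>- cis (pi * t)\<close> and
  \<open>- cis (- (pi * t))\<close>, whose quotient is \<open>cis (2 * pi * t)\<close>.\<close>

lemma cayley_Some:
  assumes "0 < t" "t < 1"
  shows "cayley (Some (- cot (pi * t))) = cr t"
proof -
  have s: "sin (pi * t) > 0" using assms by (intro sin_gt_zero) auto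
  have "Rep_circle (cayley (Some (- cot (pi * t)))) = cis (2 * pi * t)"
  proof -
    have nz: "complex_of_real (- cot (pi * t)) + \<i> \<noteq> 0" by (simp add: complex_eq_iff)
    have ci: "cis (2 * pi * t) = cis (pi * t) * cis (pi * t)" by (simp add: cis_mult algebra_simps)
    have E: "of_real (sin (pi * t)) * (complex_of_real (- cot (pi * t)) - \<i>) = - cis (pi * t)"
      "of_real (sin (pi * t)) * (complex_of_real (- cot (pi * t)) + \<i>) = - cis (- (pi * t))"
      using s by (auto simp: complex_eq_iff cot_def)
    have "cis (pi * t) * cis (- (pi * t)) = 1" by (simp add: cis_mult)
    then have "of_real (sin (pi * t)) * (complex_of_real (- cot (pi * t)) - \<i>) =
        cis (2 * pi * t) * (of_real (sin (pi * t)) * (complex_of_real (- cot (pi * t)) + \<i>))"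
      unfolding ci E by (simp add: mult.assoc)
    then have "complex_of_real (- cot (pi * t)) - \<i> = cis (2 * pi * t) * (complex_of_real (- cot (pi * t)) + \<i>)"
      using s by (simp add: mult.left_commute[of _ "complex_of_real (sin (pi * t))"])
    then show ?thesis using nz by (simp add: Rep_cayley divide_eq_eq)
  qed
  then show ?thesis by (metis Rep_circle_inject Rep_circle_of_real)
qed

lemma surj_cayley: "\<exists>p. cayley p = x"
proof -
  obtain t where t: "0 \<le> t" "t < 0 + 1" "x = cr t" by (rule circle_cases)
  show ?thesis
  proof (cases "t = 0")
    case True then show ?thesis using t cayley_None by blast
  next
    case False then show ?thesis using cayley_Some[of t] t by auto
  qed
qed

text \<open>The coordinate \<open>1 / (v - y0)\<close> puts the fixed point at infinity, and a
  projective map fixing infinity is affine.\<close>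

lemma germ_chart_projective:
  assumes H: "\<And>h. h \<in> H \<Longrightarrow> h \<in> Homeo \<and> h (cr t0) = cr t0 \<and> piecewise_projective h"
    and t0: "cr t0 = cayley (Some y0)"
  shows "\<exists>\<psi>. germ_chart H t0 \<psi>"
proof -
  \<comment> \<open>The value 0 at infinity is the limit of the formula. Division by zero also
    yields 0 at \<open>y0\<close>, but that point is exempt from injectivity.\<close>
  define \<psi> where "\<psi> x = (case inv_into UNIV cayley x of None \<Rightarrow> 0 | Some v \<Rightarrow> 1 / (v - y0))" for x
  have \<psi>: "\<psi> (cayley p) = (case p of None \<Rightarrow> 0 | Some v \<Rightarrow> 1 / (v - y0))" for p
    by (simp add: \<psi>_def inv_f_f[OF inj_cayley])
  have inj: "inj_on \<psi> (- {cr t0})"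
  proof (rule inj_onI)
    fix x x' assume x: "x \<in> - {cr t0}" "x' \<in> - {cr t0}" "\<psi> x = \<psi> x'"
    obtain p p' where p: "x = cayley p" "x' = cayley p'" using surj_cayley by metis
    then have "p \<noteq> Some y0" "p' \<noteq> Some y0" using x t0 by auto
    then have "p = p'" using x(3) unfolding p \<psi> by (auto split: option.splits simp: field_simps)
    then show "x = x'" using p by simp
  qed
  have germ: "\<exists>m c. eventually (\<lambda>t. \<psi> (h (cr t)) = m * \<psi> (cr t) + c) \<Phi>"
    if h: "h \<in> H" and A: "\<And>p. cayley p \<in> cr ` {a..b} \<Longrightarrow> h (cayley p) = cayley (\<mu> p)"
      and \<mu>: "\<mu> \<in> PSL2"
      and \<Phi>: "\<Phi> \<le> at t0" "\<Phi> \<noteq> bot"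
      and ev: "eventually (\<lambda>t. t - of_int n \<in> {a..b}) \<Phi>" for a b n \<mu> \<Phi> h
  proof -
    have hH: "h \<in> Homeo" "h (cayley (Some y0)) = cayley (Some y0)" using H[OF h] t0 by auto
    have evc: "eventually (\<lambda>t. cr t \<in> cr ` {a..b}) \<Phi>" using ev
    proof eventually_elim
      case (elim t)
      then have "cr (t - n) \<in> cr ` {a..b}" by auto
      then show ?case using circle_of_real_add_int[of "t - n" n] by simp
    qed
    have lim: "(cr \<longlongrightarrow> cr t0) \<Phi>"
      using tendsto_circle_of_real[OF tendsto_ident_at, of t0 UNIV] \<Phi>(1) tendsto_mono by auto
    \<comment> \<open>The arc is closed and contains points converging to \<open>cr t0\<close>.
      Hence the matrix of this piece describes \<open>h\<close> at the fixed point too, so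
      \<open>\<mu>\<close> fixes \<open>y0\<close>.\<close>
    have "cr t0 \<in> cr ` {a..b}"
      using Lim_in_closed_set[OF closed_arc evc \<Phi>(2) lim] .
    then have "cayley (\<mu> (Some y0)) = cayley (Some y0)" using A[of "Some y0"] t0 hH by simp
    then have \<mu>y: "\<mu> (Some y0) = Some y0" using inj_cayley by (simp add: inj_eq)
    obtain p q r s where pq: "p * s - q * r = 1" "\<mu> = moebius p q r s" using \<mu> unfolding PSL2_def by auto
    have den: "r * y0 + s \<noteq> 0" and numer: "p * y0 + q = y0 * (r * y0 + s)"
      using \<mu>y unfolding pq(2) moebius_def by (auto split: if_splits simp: field_simps)
    have inf: "cayley None \<noteq> cr t0" using inj_cayley t0 by (auto simp: inj_eq)
    \<comment> \<open>Near \<open>t0\<close> neither the point nor its image is at infinity, so only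
      the finite branch of \<open>moebius\<close> occurs below.\<close>
    have "eventually (\<lambda>t. h (cr t) \<in> - {cayley None}) \<Phi>"
    proof (rule topological_tendstoD)
      show "((\<lambda>t. h (cr t)) \<longlongrightarrow> h (cr t0)) \<Phi>"
      proof (rule isCont_tendsto_compose[OF _ lim])
        show "isCont h (cr t0)"
          using Homeo_continuous[OF hH(1), of UNIV] by (simp add: continuous_on_eq_continuous_at)
      qed
      show "h (cr t0) \<in> - {cayley None}" using hH inf t0 by auto
      show "open (- {cayley None})" using open_Compl[OF closed_singleton] .
    qed
    moreover have "eventually (\<lambda>t. cr t \<in> - {cayley None}) \<Phi>"
      using inf by (intro topological_tendstoD[OF lim]) auto
    moreover have "eventually (\<lambda>t. cr t \<noteq> cr t0) \<Phi>"
    proof (rule filter_leD[OF \<Phi>(1)])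
      show "eventually (\<lambda>s. cr s \<noteq> cr t0) (at t0)"
        unfolding eventually_at
        by (rule exI[of _ 1]) (auto simp: dist_real_def dest!: circle_of_real_eqD)
    qed
    ultimately have "eventually (\<lambda>t. \<psi> (h (cr t)) =
        (r * y0 + s)^2 * \<psi> (cr t) + r * (r * y0 + s)) \<Phi>" using evc
    proof eventually_elim
      case (elim t)
      obtain v where v: "cr t = cayley (Some v)"
        using surj_cayley[of "cr t"] elim(2) by (metis ComplI not_Some_eq singletonI Compl_iff)
      have vy: "v - y0 \<noteq> 0" using elim(3) v t0 by auto
      have hv: "h (cayley (Some v)) = cayley (\<mu> (Some v))" using A[of "Some v"] elim(4) v by simp
      have dv: "r * v + s \<noteq> 0" using elim(1) unfolding v hv pq(2) by (auto simp: moebius_def)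
      \<comment> \<open>The fixed point equation \<open>numer\<close> and determinant 1 give this
        difference. Its reciprocal is affine in \<open>1 / (v - y0)\<close>, since
        \<open>r * v + s = r * (v - y0) + (r * y0 + s)\<close>.\<close>
      have "(p * v + q) / (r * v + s) - y0 = (v - y0) / ((r * v + s) * (r * y0 + s))"
      proof -
        have "((p * v + q) - y0 * (r * v + s)) * (r * y0 + s)
            = (p * v + q) * (r * y0 + s) - (y0 * (r * y0 + s)) * (r * v + s)" by (simp add: algebra_simps)
        also have "\<dots> = (p * v + q) * (r * y0 + s) - (p * y0 + q) * (r * v + s)" by (simp add: numer)
        also have "\<dots> = (v - y0) * (p * s - q * r)" by (simp add: algebra_simps)
        finally have "((p * v + q) - y0 * (r * v + s)) * (r * y0 + s) = v - y0" by (simp add: pq(1))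
        moreover have "N / D - y0 = w / (D * E)" if "(N - y0 * D) * E = w" "D \<noteq> 0" "E \<noteq> 0" for N D E w
          unfolding that(1)[symmetric] using that(2,3) by (simp add: diff_divide_distrib)
        ultimately show ?thesis using dv den by blast
      qed
      then have "\<psi> (h (cr t)) = (r * v + s) * (r * y0 + s) / (v - y0)"
        unfolding v hv pq(2) moebius_def using dv by (simp add: \<psi>)
      also have "\<dots> = (r * y0 + s)^2 * (1 / (v - y0)) + r * (r * y0 + s)"
        using vy by (simp add: field_simps power2_eq_square)
      finally show ?case unfolding v by (simp add: \<psi>)
    qed
    then show ?thesis by blast
  qed
  have "\<exists>m c. eventually (\<lambda>t. \<psi> (h (cr t)) = m * \<psi> (cr t) + c) \<Phi>"
    if h: "h \<in> H" and \<Phi>: "\<Phi> = at_right t0 \<or> \<Phi> = at_left t0" for h \<Phi>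
  proof -
    obtain A where A: "arc_cover A" "\<And>a b. (a, b) \<in> A \<Longrightarrow>
      \<exists>\<mu>\<in>PSL2. \<forall>p. cayley p \<in> cr ` {a..b} \<longrightarrow> h (cayley p) = cayley (\<mu> p)"
      using H[OF h] unfolding piecewise_projective_def by blast
    obtain a b n where ab: "(a, b) \<in> A" "eventually (\<lambda>t. t - of_int n \<in> {a..b}) \<Phi>"
      using arc_cover_one_sided[OF A(1) \<Phi>] by auto
    obtain \<mu> where \<mu>: "\<mu> \<in> PSL2" "\<And>p. cayley p \<in> cr ` {a..b} \<Longrightarrow> h (cayley p) = cayley (\<mu> p)"
      using A(2)[OF ab(1)] by blast
    show ?thesis
      by (rule germ[OF h \<mu>(2,1) _ _ ab(2)])
        (use \<Phi> in \<open>elim disjE; simp add: at_le\<close>)+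
  qed
  then show ?thesis
    using inj unfolding germ_chart_def affine_germ_def right_germs_def left_germs_def eventually_filtermap
    by blast
qed

section \<open>Fixed points of stabilizers under a proximal action\<close>

lemma lift_iterate_unbounded:
  assumes B: "is_lift b B" and pos: "\<And>t. t < B t"
  obtains n where "z < (B ^^ n) x"
proof (rule ccontr)
  assume "\<not> thesis"
  then have bd: "(B ^^ n) x \<le> z" for n using that by (meson not_less)
  have "incseq (\<lambda>n. (B ^^ n) x)" using pos by (intro incseq_SucI) (simp add: less_imp_le)
  then obtain l where l: "(\<lambda>n. (B ^^ n) x) \<longlonglongrightarrow> l" using incseq_convergent bd by blast
  have "(\<lambda>n. B ((B ^^ n) x)) \<longlonglongrightarrow> B l" using isCont_tendsto_compose[OF is_lift_isCont[OF B] l] .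
  moreover have "(\<lambda>n. B ((B ^^ n) x)) \<longlonglongrightarrow> l" using LIMSEQ_Suc[OF l] by simp
  ultimately have "B l = l" using LIMSEQ_unique by blast
  then show False using pos[of l] by simp
qed

lemma lift_pow:
  assumes "is_lift b B" shows "is_lift (b ^^ n) (B ^^ n)"
proof (induction n)
  case 0 then show ?case by (simp add: is_lift_def strict_mono_def)
next
  case (Suc n) then show ?case using is_lift_comp[OF assms Suc] by (simp only: funpow.simps)
qed

lemma Homeo_pow: "b \<in> Homeo \<Longrightarrow> b ^^ n \<in> Homeo"
  by (induction n) (simp_all add: Homeo_id Homeo_comp)

text \<open>The translation number of a lift \<open>B\<close> conjugate to its square \<open>B\<^sup>2\<close> vanishes.\<close>

lemma no_positive_lift_conjugate_to_square:
  assumes b: "b \<in> Homeo" "is_lift b B" and h: "h \<in> Homeo" "is_lift h K"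
    and conj: "\<And>t. K (B t) = B (B (K t))"
  shows "\<not> (\<forall>t. t < B t)"
proof
  assume "\<forall>t. t < B t"
  then have pos: "\<And>t. t < B t" by blast
  define x where "x n = (B ^^ n) 0" for n
  define q where "q = K 0"
  have shift: "(B ^^ n) (t + of_int j) = (B ^^ n) t + of_int j" for n t and j :: int
    using is_lift_add_int[OF Homeo_inj[OF Homeo_pow[OF b(1)]] lift_pow[OF b(2)]] .
  have mono: "s \<le> t \<Longrightarrow> (B ^^ n) s \<le> (B ^^ n) t" for n s t
    using is_lift_le[OF lift_pow[OF b(2)]] by blast
  have K_le: "K s \<le> s + q + 1" for s
  proof -
    have "K s \<le> K (0 + of_int (\<lfloor>s\<rfloor> + 1))" using is_lift_le[OF h(2)] by (simp; linarith)
    also have "\<dots> = q + of_int (\<lfloor>s\<rfloor> + 1)" using is_lift_add_int[OF Homeo_inj[OF h(1)] h(2)] unfolding q_def .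
    finally show ?thesis by (simp; linarith)
  qed
  have conj_pow: "K ((B ^^ n) t) = (B ^^ n) ((B ^^ n) (K t))" for n t
  proof (induction n arbitrary: t)
    case (Suc n)
    have "K ((B ^^ Suc n) t) = K ((B ^^ n) (B t))" by (simp add: funpow_swap1)
    also have "\<dots> = (B ^^ n) ((B ^^ n) (B (B (K t))))" unfolding Suc conj ..
    also have "\<dots> = (B ^^ Suc n) ((B ^^ Suc n) (K t))" by (simp add: funpow_swap1)
    finally show ?case .
  qed simp
  \<comment> \<open>By conjugacy \<open>K (x n)\<close> is \<open>B ^^ n\<close> applied twice to
    \<open>q\<close>. Replacing \<open>q\<close> by 0 costs at most \<open>j\<close>, and
    \<open>K\<close> moves no point to the right by more than \<open>q + 1\<close>. So
    \<open>B ^^ n\<close> moves \<open>x n\<close> by an amount bounded independently of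
    \<open>n\<close>.\<close>
  obtain j :: int where j: "- q \<le> of_int j" using ex_le_of_int by blast
  have up: "(B ^^ n) (x n) \<le> x n + q + 1 + j" for n
  proof -
    have "(B ^^ n) (x n) - j = (B ^^ n) ((B ^^ n) (0 + of_int (- j)))" unfolding shift x_def by simp
    also have "\<dots> \<le> (B ^^ n) ((B ^^ n) q)" using j by (intro mono) simp
    also have "\<dots> = K (x n)" unfolding x_def q_def conj_pow ..
    also have "\<dots> \<le> x n + q + 1" by (rule K_le)
    finally show ?thesis by simp
  qed
  \<comment> \<open>Passing from 0 to \<open>x n\<close> lowers the displacement of
    \<open>B ^^ n\<close> by less than 1, which explains the extra 1.\<close>
  obtain n where n: "q + 1 + j + 1 < (B ^^ n) 0" by (rule lift_iterate_unbounded[OF b(2) pos])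
  have "x n + (q + 1 + j) < of_int \<lfloor>x n\<rfloor> + (B ^^ n) 0" using n by linarith
  also have "\<dots> = (B ^^ n) (0 + of_int \<lfloor>x n\<rfloor>)" unfolding shift by simp
  also have "\<dots> \<le> (B ^^ n) (x n)" by (intro mono) simp
  finally show False using up[of n] by simp
qed

lemma conjugate_to_square_has_fixed_point:
  assumes b: "b \<in> Homeo" and h: "h \<in> Homeo" and conj: "h \<circ> b = b \<circ> b \<circ> h"
  shows "\<exists>x. b x = x"
proof -
  obtain B0 where B0: "is_lift b B0" using Homeo_lift b by blast
  obtain K where K: "is_lift h K" using Homeo_lift h by blast
  have "cr (K (B0 0)) = h (b (cr 0))" using is_lift_eq[OF B0] is_lift_eq[OF K] by simp
  also have "\<dots> = b (b (h (cr 0)))" using fun_cong[OF conj, of "cr 0"] by simp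
  also have "\<dots> = cr (B0 (B0 (K 0)))" using is_lift_eq[OF B0] is_lift_eq[OF K] by simp
  finally obtain k :: int where k: "K (B0 0) = B0 (B0 (K 0)) + k" using circle_of_real_eq_iff by blast
  \<comment> \<open>The conjugacy lifts only up to an integer \<open>k\<close>. Adding
    \<open>k\<close> to the lift changes one side by \<open>k\<close> and the other by
    \<open>2 * k\<close>, so the relation becomes exact.\<close>
  define B where "B t = B0 t + of_int k" for t
  have B: "is_lift b B" unfolding B_def by (rule is_lift_shift[OF B0])
  have hb: "inj (h \<circ> b)" using Homeo_inj[OF Homeo_comp[OF h b]] .
  have "K \<circ> B = B \<circ> B \<circ> K"
  proof (rule lift_unique[OF hb])
    show "is_lift (h \<circ> b) (K \<circ> B)" using is_lift_comp[OF K B] .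
    show "is_lift (h \<circ> b) (B \<circ> B \<circ> K)" unfolding conj using is_lift_comp[OF is_lift_comp[OF B B] K] .
    have "K (B 0) = K (B0 0) + k"
      unfolding B_def using is_lift_add_int[OF Homeo_inj[OF h] K] .
    moreover have "B (B (K 0)) = B0 (B0 (K 0)) + k + k"
      unfolding B_def using is_lift_add_int[OF Homeo_inj[OF b] B0] by simp
    ultimately show "(K \<circ> B) 0 = (B \<circ> B \<circ> K) 0" using k by simp
  qed
  then have KB: "K (B t) = B (B (K t))" for t by (metis comp_apply)
  show ?thesis
  proof (rule ccontr)
    assume "\<nexists>x. b x = x"
    then have ne: "B t \<noteq> t" for t using is_lift_eq[OF B, of t] by metis
    have conn: "connected (range (\<lambda>t. B t - t))"
      by (intro connected_continuous_image continuous_intros is_lift_continuous[OF B] connected_UNIV)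
    \<comment> \<open>By connectedness a lift without fixed points moves all points in the same
      direction. Motion to the left is treated through the inverse, which satisfies the same
      relation.\<close>
    have "(\<forall>t. t < B t) \<or> (\<forall>t. B t < t)"
    proof (rule ccontr)
      assume "\<not> ((\<forall>t. t < B t) \<or> (\<forall>t. B t < t))"
      then obtain s t where "B s - s \<le> 0" "0 \<le> B t - t" by (auto simp: not_less)
      then have "0 \<in> range (\<lambda>t. B t - t)" using connectedD_interval[OF conn, of "B s - s" "B t - t" 0] by blast
      then show False using ne by auto
    qed
    then show False
    proof
      assume "\<forall>t. t < B t"
      then show False using no_positive_lift_conjugate_to_square[OF b B h K KB] by blast
    next
      assume neg: "\<forall>t. B t < t"
      define C where "C = invf B"
      have C: "is_lift (invf b) C" unfolding C_def by (rule is_lift_inv[OF b B])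
      have BC: "B (C t) = t" for t unfolding C_def using is_lift_surj[OF Homeo_inj[OF b] B] by (simp add: surj_f_inv_f)
      have CB: "C (B t) = t" for t unfolding C_def using B strict_mono_imp_inj_on[of B] by (simp add: is_lift_def)
      have "K (C t) = C (C (K t))" for t
        using KB[of "C t"] by (simp add: BC CB)
      moreover have "t < C t" for t using neg[rule_format, of "C t"] by (simp add: BC)
      ultimately show False using no_positive_lift_conjugate_to_square[OF Homeo_inv[OF b] C h K] by blast
    qed
  qed
qed

text \<open>The piecewise structure of \<open>G\<close> enters what follows only through
  \<open>second_commutators\<close>, the metabelian property of the germs at
  \<open>y\<close>.\<close>

locale rigid_action = circularly_transitive G Y + proximal_action G \<rho> for G Y \<rho> +
  fixes y :: circle
  assumes y_in_Y: "y \<in> Y"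
    and second_commutators: "a \<in> H y \<Longrightarrow> b \<in> H y \<Longrightarrow> c \<in> H y \<Longrightarrow> d \<in> H y \<Longrightarrow>
      trivial_near y (com (com a b) (com c d))"
begin

definition N :: "(circle \<Rightarrow> circle) set" where "N = {g \<in> H y. trivial_near y g}"

lemma H_Homeo: "h \<in> H y \<Longrightarrow> h \<in> Homeo" by (simp add: H_iff G_Homeo)

lemma N_H: "n \<in> N \<Longrightarrow> n \<in> H y" by (simp add: N_def)

lemma N_inv: assumes n: "n \<in> N" shows "invf n \<in> N"
proof -
  obtain U where U: "open U" "y \<in> U" "\<And>x. x \<in> U \<Longrightarrow> n x = x" using n by (auto simp: N_def trivial_near_def)
  have "invf n x = x" if "x \<in> U" for x using U(3)[OF that] Homeo_inv_f[OF H_Homeo[OF N_H[OF n]], of x] by simp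
  then show ?thesis using U(1,2) H_closed(3)[OF N_H[OF n]] by (auto simp: N_def trivial_near_def)
qed

lemma N_conj: assumes h: "h \<in> H y" and n: "n \<in> N" shows "h \<circ> n \<circ> invf h \<in> N"
proof -
  obtain U where U: "open U" "y \<in> U" "\<And>x. x \<in> U \<Longrightarrow> n x = x" using n by (auto simp: N_def trivial_near_def)
  have hH: "h \<in> Homeo" "invf h \<in> Homeo" using H_Homeo[OF h] Homeo_inv by blast+
  have "open (invf h -` U)" by (rule open_vimage[OF U(1) Homeo_continuous[OF hH(2)]])
  moreover have "invf h y = y" using H_closed(3)[OF h] by (simp add: H_iff)
  then have "y \<in> invf h -` U" using U(2) by simp
  moreover have "(h \<circ> n \<circ> invf h) x = x" if "x \<in> invf h -` U" for x
    using U(3)[of "invf h x"] that hH by simp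
  ultimately have "trivial_near y (h \<circ> n \<circ> invf h)" unfolding trivial_near_def by blast
  moreover have "h \<circ> n \<circ> invf h \<in> H y" by (intro H_closed(2,3) h N_H[OF n])
  ultimately show ?thesis by (simp add: N_def)
qed

text \<open>The groups \<open>A\<close> and \<open>B\<close> of elements trivial on two
  complementary arcs commute. An element that swaps the two common end points carries one arc to the
  other, hence conjugates \<open>A\<close> into \<open>B\<close>. Any point of the resulting set on
  which \<open>A\<close> is abelian works for all \<open>f\<close> and \<open>g\<close> at
  once.\<close>

lemma supported_away_common_fixed_point:
  assumes U: "open U" "u \<in> U"
  shows "\<exists>x. \<forall>f\<in>G. \<forall>g\<in>G. (\<forall>z\<in>U. f z = z) \<longrightarrow> (\<forall>z\<in>U. g z = z) \<longrightarrow> \<rho> (com f g) x = x"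
proof -
  obtain t s r where "u = cr t" and s: "t < s" and r: "s < r" "r < t + 1/2"
    and srY: "cr s \<in> Y" "cr r \<in> Y"
    and inU: "\<And>q. t \<le> q \<Longrightarrow> q \<le> r \<Longrightarrow> cr q \<in> U"
    using U by (rule Y_arc_in_open) blast
  have r1: "r < s + 1" using s r by simp
  define L1 where "L1 = cr ` {s..r}"
  define L2 where "L2 = cr ` {r..s+1}"
  have L1U: "L1 \<subseteq> U" unfolding L1_def using s by (auto intro!: inU)
  have L12: "z \<in> L1 \<or> z \<in> L2" for z
  proof -
    obtain q where "s \<le> q" "q < s + 1" "z = cr q" by (rule circle_cases)
    then show ?thesis unfolding L1_def L2_def by (cases "q \<le> r") auto
  qed
  have ne: "cr s \<noteq> cr r" using r r1 by (auto dest!: circle_of_real_eqD)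
  obtain v where v: "v \<in> G" "v (cr s) = cr r" "v (cr r) = cr s"
    using pair_transitive[OF srY ne srY(2,1) ne[symmetric]] by blast
  have vH: "v \<in> Homeo" "invf v \<in> Homeo" using G_Homeo[OF v(1)] Homeo_inv by blast+
  have vL: "invf v z \<in> L1" if z: "z \<in> L2" for z
  proof -
    have "invf v (cr r) = cr s" using Homeo_inv_f[OF vH(1)] v(2) by metis
    then obtain V where V: "is_lift (invf v) V" "V r = s" using lift_through[OF vH(2)] by blast
    have "invf v (cr s) = cr r" using Homeo_inv_f[OF vH(1)] v(3) by metis
    then have "cr (V (s + 1)) = cr r" using is_lift_eq[OF V(1), of "s + 1"] by simp
    moreover have "V r < V (s + 1)" "V (s + 1) < V (r + 1)" using is_lift_less[OF V(1)] r1 r(1) by auto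
    moreover have "V (r + 1) = s + 1" using is_lift_add_1[OF Homeo_inj[OF vH(2)] V(1)] V(2) by simp
    ultimately have Vs: "V (s + 1) = r" using V(2) r(1) r1 by (intro circle_of_real_eqD) auto
    obtain q where q: "r \<le> q" "q \<le> s + 1" "z = cr q" using z unfolding L2_def by auto
    have "s \<le> V q" "V q \<le> r" using is_lift_le[OF V(1), of r q] is_lift_le[OF V(1), of q "s + 1"] q V(2) Vs by auto
    then show ?thesis unfolding L1_def using is_lift_eq[OF V(1), of q] q(3) by auto
  qed
  define A where "A = {g \<in> G. \<forall>z\<in>L1. g z = z}"
  define B where "B = {g \<in> G. \<forall>z\<in>L2. g z = z}"
  have stab: "subgroup (\<rho> ` {g \<in> G. \<forall>z\<in>L. g z = z}) homeo_plus" for L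
  proof (rule subgroup_homeo_plusI)
    let ?A = "{g \<in> G. \<forall>z\<in>L. g z = z}"
    show "\<rho> ` ?A \<subseteq> Homeo" using rho_Homeo by blast
    show "id \<in> \<rho> ` ?A" using rho_id G_id by (intro image_eqI[of _ _ id]) auto
    show "f \<circ> g \<in> \<rho> ` ?A" if fg: "f \<in> \<rho> ` ?A" "g \<in> \<rho> ` ?A" for f g
    proof -
      obtain f' where f': "f' \<in> ?A" "f = \<rho> f'" using fg(1) by blast
      obtain g' where g': "g' \<in> ?A" "g = \<rho> g'" using fg(2) by blast
      have "f' \<circ> g' \<in> ?A" using f'(1) g'(1) G_comp by simp
      moreover have "f \<circ> g = \<rho> (f' \<circ> g')" using rho_comp f' g' by simp
      ultimately show ?thesis by blast
    qed
    show "invf f \<in> \<rho> ` ?A" if f: "f \<in> \<rho> ` ?A" for f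
    proof -
      obtain f' where f': "f' \<in> ?A" "f = \<rho> f'" using f by blast
      have "invf f' z = z" if "z \<in> L" for z
        using f'(1) that Homeo_inv_f[OF G_Homeo, of f' z] by auto
      then have "invf f' \<in> ?A" using f'(1) G_inv by simp
      moreover have "invf f = \<rho> (invf f')" using rho_inv f' by simp
      ultimately show ?thesis by blast
    qed
  qed
  have comm: "a (b z) = b (a z)" if ab: "a \<in> A" "b \<in> B" for a b z
  proof -
    have aH: "a \<in> Homeo" and bH: "b \<in> Homeo" using ab G_Homeo by (auto simp: A_def B_def)
    have a: "a w = w" if "w \<in> L1" for w using ab that by (simp add: A_def)
    have b: "b w = w" if "w \<in> L2" for w using ab that by (simp add: B_def)
    show ?thesis
    proof (cases "z \<in> L2")
      case True
      show ?thesis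
      proof (cases "z \<in> L1")
        case False
        have "a z \<notin> L1" using a[of "a z"] Homeo_eq_iff[OF aH] False by auto
        then show ?thesis using L12[of "a z"] b \<open>z \<in> L2\<close> by simp
      qed (use a b True in simp)
    next
      case False
      then have z1: "z \<in> L1" using L12 by blast
      have "b z \<notin> L2" using b[of "b z"] Homeo_eq_iff[OF bH] False by auto
      then show ?thesis using L12[of "b z"] a z1 by simp
    qed
  qed
  obtain M where M: "M \<noteq> {}" "\<And>a x. a \<in> \<rho> ` A \<Longrightarrow> x \<in> M \<Longrightarrow> a x \<in> M"
    "\<And>a b x. a \<in> \<rho> ` A \<Longrightarrow> b \<in> \<rho> ` A \<Longrightarrow> x \<in> M \<Longrightarrow> a (b x) = b (a x)"
  proof (rule commuting_conjugates_abelian_set[of "\<rho> ` A" "\<rho> ` B" "\<rho> v"])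
    show "subgroup (\<rho> ` A) homeo_plus" "subgroup (\<rho> ` B) homeo_plus" unfolding A_def B_def by (rule stab)+
    show "\<rho> v \<in> Homeo" using rho_Homeo[OF v(1)] .
    show "\<rho> v \<circ> a \<circ> invf (\<rho> v) \<in> \<rho> ` B" if a: "a \<in> \<rho> ` A" for a
    proof -
      obtain a' where a': "a' \<in> A" "a = \<rho> a'" using a by blast
      have a'G: "a' \<in> G" using a' by (simp add: A_def)
      have "(v \<circ> a' \<circ> invf v) z = z" if "z \<in> L2" for z
        using vL[OF that] a'(1) vH by (simp add: A_def)
      then have "v \<circ> a' \<circ> invf v \<in> B" using a'G v(1) G_comp G_inv by (simp add: B_def)
      moreover have "\<rho> v \<circ> a \<circ> invf (\<rho> v) = \<rho> (v \<circ> a' \<circ> invf v)" using rho_conj[OF v(1) a'G] a'(2) by simp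
      ultimately show ?thesis by blast
    qed
    show "a (b x) = b (a x)" if ab: "a \<in> \<rho> ` A" "b \<in> \<rho> ` B" for a b x
    proof -
      obtain a' where a': "a' \<in> A" "a = \<rho> a'" using ab by blast
      obtain b' where b': "b' \<in> B" "b = \<rho> b'" using ab by blast
      have G: "a' \<in> G" "b' \<in> G" using a' b' by (auto simp: A_def B_def)
      have "a' \<circ> b' = b' \<circ> a'" using comm[OF a'(1) b'(1)] by auto
      then have "\<rho> a' \<circ> \<rho> b' = \<rho> b' \<circ> \<rho> a'" using rho_comp G by metis
      then show ?thesis using a' b' by (metis comp_apply)
    qed
  qed blast
  obtain x where x: "x \<in> M" using M(1) by blast
  have "\<rho> (com f g) x = x" if fg: "f \<in> G" "g \<in> G" "\<forall>z\<in>U. f z = z" "\<forall>z\<in>U. g z = z" for f g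
  proof -
    have A: "f \<in> A" "g \<in> A" using fg L1U by (auto simp: A_def)
    have Ai: "invf h \<in> A" if "h \<in> A" for h
    proof -
      have hG: "h \<in> G" using that by (simp add: A_def)
      have "invf h z = z" if "z \<in> L1" for z
        using \<open>h \<in> A\<close> that Homeo_inv_f[OF G_Homeo[OF hG], of z] by (simp add: A_def)
      then show ?thesis using hG G_inv by (simp add: A_def)
    qed
    \<comment> \<open>The set \<open>M\<close> is also invariant under inverses, so \<open>w\<close>
      belongs to it, and \<open>f\<close> and \<open>g\<close> may be interchanged at
      \<open>w\<close>.\<close>
    define w where "w = \<rho> (invf f) (\<rho> (invf g) x)"
    have wM: "w \<in> M" unfolding w_def
      using M(2)[OF imageI[OF Ai[OF A(1)]] M(2)[OF imageI[OF Ai[OF A(2)]] x]] .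
    have "\<rho> (com f g) x = \<rho> f (\<rho> g w)" unfolding rho_com[OF fg(1,2)]
      by (simp add: com_def w_def rho_inv fg)
    also have "\<dots> = \<rho> g (\<rho> f w)" by (rule M(3)) (use A wM in auto)
    also have "\<dots> = x" unfolding w_def using fg(1,2) rho_Homeo[OF fg(1)] rho_Homeo[OF fg(2)] by (simp add: rho_inv)
    finally show ?thesis .
  qed
  then show ?thesis by blast
qed

text \<open>A closed set playing the role of the fixed point of the stabilizer of \<open>y\<close>.\<close>

definition good_set :: "circle set \<Rightarrow> bool"
  where "good_set F \<longleftrightarrow> closed F \<and> F \<noteq> {} \<and> (\<forall>h\<in>H y. \<forall>x\<in>F. \<rho> h x \<in> F) \<and>
    (\<exists>p\<in>H y. p \<noteq> id \<and> (\<forall>x\<in>F. \<rho> p x = x)) \<and>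
    (F = UNIV \<longrightarrow> (\<forall>f\<in>N. \<forall>g\<in>N. \<rho> (com f g) = id))"

lemma good_setI:
  assumes "F \<noteq> {}" "closed F" "\<And>h x. h \<in> H y \<Longrightarrow> x \<in> F \<Longrightarrow> \<rho> h x \<in> F"
    and "\<forall>x\<in>F. \<rho> p x = x" "\<And>f g. F = UNIV \<Longrightarrow> f \<in> N \<Longrightarrow> g \<in> N \<Longrightarrow> \<rho> (com f g) = id"
    and "p \<in> H y" "p \<noteq> id"
  shows "good_set F"
  using assms unfolding good_set_def by auto

lemma fixed_set_invariant:
  assumes S: "S \<subseteq> H y" and conj: "\<And>h s. h \<in> H y \<Longrightarrow> s \<in> S \<Longrightarrow> h \<circ> s \<circ> invf h \<in> S"
    and h: "h \<in> H y" and x: "\<forall>s\<in>S. \<rho> s x = x" and s: "s \<in> S"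
  shows "\<rho> s (\<rho> h x) = \<rho> h x"
proof -
  have hG: "h \<in> G" "s \<in> G" "invf h \<in> G" using h s S G_inv by (auto simp: H_iff)
  have ih: "invf (invf h) = h" using Homeo_bij[OF H_Homeo[OF h]] by (rule inv_inv_eq)
  have "invf h \<circ> s \<circ> invf (invf h) \<in> S" using conj[OF H_closed(3)[OF h] s] .
  then have "\<rho> (invf h \<circ> s \<circ> h) x = x" using x unfolding ih by blast
  then have "invf (\<rho> h) (\<rho> s (\<rho> h x)) = x" using hG by (simp add: rho_comp G_comp rho_inv)
  then show ?thesis using Homeo_f_inv[OF rho_Homeo[OF hG(1)]] by metis
qed

text \<open>The set is the common fixed set of all commutators of elements of \<open>N\<close>.
  Finitely many of them involve only elements trivial on one neighbourhood of \<open>y\<close>, so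
  they share a fixed point; compactness of the circle then handles all of them.\<close>

lemma good_set_if_N_nontrivial:
  assumes n: "n \<in> N" "n \<noteq> id"
  shows "\<exists>F. good_set F"
proof -
  define S where "S = {com f g | f g. f \<in> N \<and> g \<in> N}"
  have SH: "S \<subseteq> H y" unfolding S_def using H_closed(4) N_H by blast
  have Sconj: "h \<circ> s \<circ> invf h \<in> S" if h: "h \<in> H y" and s: "s \<in> S" for h s
  proof -
    obtain f g where fg: "f \<in> N" "g \<in> N" "s = com f g" using s unfolding S_def by blast
    have "h \<circ> s \<circ> invf h = com (h \<circ> f \<circ> invf h) (h \<circ> g \<circ> invf h)"
      unfolding fg(3) using conj_com H_Homeo h N_H fg(1,2) by blast
    then show ?thesis unfolding S_def using N_conj[OF h fg(1)] N_conj[OF h fg(2)] by blast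
  qed
  have NHs: "N \<subseteq> H y" using N_H by blast
  have trans: "\<exists>a\<in>N. a z = w" if "z \<in> Y" "w \<in> Y" "z \<noteq> y" "w \<noteq> y" "z \<noteq> w" for z w
    using normal_in_stabilizer_transitive[OF y_in_Y NHs N_inv N_conj n that] by blast
  \<comment> \<open>An abelian \<open>N\<close> would be free on the points of \<open>Y\<close>
    other than \<open>y\<close>, but \<open>n\<close> fixes all those close to
    \<open>y\<close>.\<close>
  have "\<exists>f\<in>N. \<exists>g\<in>N. f \<circ> g \<noteq> g \<circ> f"
  proof (rule ccontr)
    assume "\<not> ?thesis"
    then have comm: "f \<circ> g = g \<circ> f" if "f \<in> N" "g \<in> N" for f g using that by blast
    obtain U where U: "open U" "y \<in> U" "\<And>x. x \<in> U \<Longrightarrow> n x = x" using n(1) by (auto simp: N_def trivial_near_def)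
    obtain t s r where s: "y = cr t" "t < s" "s < r" "r < t + 1/2" "cr s \<in> Y" "cr r \<in> Y"
      and inU: "\<And>q. t \<le> q \<Longrightarrow> q \<le> r \<Longrightarrow> cr q \<in> U"
      using U(1,2) by (rule Y_arc_in_open) blast
    have "cr s \<noteq> y" unfolding s(1) using s(2-4) by (auto dest!: circle_of_real_eqD)
    moreover have "n (cr s) = cr s" using s by (intro U(3) inU) auto
    ultimately have "n = id" using transitive_abelian_free[OF y_in_Y NHs comm trans n(1) s(5)] by blast
    then show False using n(2) by simp
  qed
  then obtain f g where fg: "f \<in> N" "g \<in> N" "f \<circ> g \<noteq> g \<circ> f" by blast
  have p: "com f g \<in> S" "com f g \<noteq> id"
    using fg com_id_iff H_Homeo N_H unfolding S_def by blast+
  define F where "F = (\<Inter>s\<in>S. {x. \<rho> s x = x})"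
  have cl: "closed {x. \<rho> s x = x}" if "s \<in> S" for s
  proof -
    have "s \<in> G" using that SH by (auto simp: H_iff)
    then show ?thesis by (intro Homeo_fixed_closed rho_Homeo)
  qed
  have "F \<noteq> {}"
  proof -
    have "UNIV \<inter> F \<noteq> {}" unfolding F_def
    proof (rule compact_imp_fip_image[OF compact_circle])
      show "closed {x. \<rho> s x = x}" if "s \<in> S" for s using cl[OF that] .
      show "UNIV \<inter> (\<Inter>s\<in>T. {x. \<rho> s x = x}) \<noteq> {}" if T: "finite T" "T \<subseteq> S" for T
      proof -
        have "\<exists>U. open U \<and> y \<in> U \<and> (\<exists>f g. f \<in> N \<and> g \<in> N \<and> s = com f g \<and> (\<forall>z\<in>U. f z = z) \<and> (\<forall>z\<in>U. g z = z))"
          if s: "s \<in> S" for s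
        proof -
          obtain f g where fg: "f \<in> N" "g \<in> N" "s = com f g" using s unfolding S_def by blast
          obtain U where U: "open U" "y \<in> U" "\<forall>x\<in>U. f x = x" using fg(1) by (auto simp: N_def trivial_near_def)
          obtain V where V: "open V" "y \<in> V" "\<forall>x\<in>V. g x = x" using fg(2) by (auto simp: N_def trivial_near_def)
          have "open (U \<inter> V) \<and> y \<in> U \<inter> V" using U V by auto
          moreover have "f \<in> N \<and> g \<in> N \<and> s = com f g \<and> (\<forall>z\<in>U \<inter> V. f z = z) \<and> (\<forall>z\<in>U \<inter> V. g z = z)"
            using U V fg by blast
          ultimately show ?thesis by blast
        qed
        then obtain W where W: "\<And>s. s \<in> S \<Longrightarrow> open (W s)" "\<And>s. s \<in> S \<Longrightarrow> y \<in> W s"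
          "\<And>s. s \<in> S \<Longrightarrow> \<exists>f g. f \<in> N \<and> g \<in> N \<and> s = com f g \<and> (\<forall>z\<in>W s. f z = z) \<and> (\<forall>z\<in>W s. g z = z)"
          by metis
        have oT: "open (\<Inter>s\<in>T. W s)" "y \<in> (\<Inter>s\<in>T. W s)"
          using W(1,2) T by (auto intro!: open_INT)
        obtain x where x: "\<And>f g. f \<in> G \<Longrightarrow> g \<in> G \<Longrightarrow> \<forall>z\<in>(\<Inter>s\<in>T. W s). f z = z \<Longrightarrow>
            \<forall>z\<in>(\<Inter>s\<in>T. W s). g z = z \<Longrightarrow> \<rho> (com f g) x = x"
          using supported_away_common_fixed_point[OF oT] by blast
        have "\<rho> s x = x" if s: "s \<in> T" for s
        proof -
          obtain f g where fg: "f \<in> N" "g \<in> N" "s = com f g" "\<forall>z\<in>W s. f z = z" "\<forall>z\<in>W s. g z = z"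
            using W(3)[of s] s T(2) by blast
          have "f \<in> G" "g \<in> G" using N_H fg(1,2) by (auto simp: H_iff)
          then show ?thesis unfolding fg(3) using fg(4,5) s by (intro x) auto
        qed
        then show ?thesis by blast
      qed
    qed
    then show ?thesis by simp
  qed
  moreover have "closed F" unfolding F_def using cl by (intro closed_INT) blast
  moreover have "\<rho> h x \<in> F" if h: "h \<in> H y" and x: "x \<in> F" for h x
    using fixed_set_invariant[OF SH Sconj h] x unfolding F_def by blast
  moreover have "\<forall>x\<in>F. \<rho> (com f g) x = x" using p(1) by (auto simp: F_def)
  moreover have "\<rho> (com f g) = id" if "F = UNIV" "f \<in> N" "g \<in> N" for f g
  proof
    fix x
    have "x \<in> F" "com f g \<in> S" using that by (auto simp: S_def)
    then show "\<rho> (com f g) x = id x" by (auto simp: F_def)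
  qed
  ultimately have "good_set F" by (rule good_setI) (use p SH in blast)+
  then show ?thesis ..
qed

text \<open>Here \<open>Z\<close> is the centre of the centralizer \<open>C\<close> of the
  commutators of the stabilizer. It is abelian and normal, and it contains these commutators because
  the stabilizer is metabelian. Defining it by centralizers gives closure under products without
  generating a subgroup from commutators.\<close>

lemma good_set_if_N_trivial:
  assumes N1: "\<And>n. n \<in> N \<Longrightarrow> n = id"
  shows "\<exists>F. good_set F"
proof -
  have com2: "com (com a b) (com c d) = id" if "a \<in> H y" "b \<in> H y" "c \<in> H y" "d \<in> H y" for a b c d
  proof (rule N1)
    show "com (com a b) (com c d) \<in> N"
      unfolding N_def using second_commutators[OF that]
        H_closed(4)[OF H_closed(4)[OF that(1,2)] H_closed(4)[OF that(3,4)]] by simp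
  qed
  define C where "C = {h \<in> H y. \<forall>a\<in>H y. \<forall>b\<in>H y. h \<circ> com a b = com a b \<circ> h}"
  define Z where "Z = {z \<in> C. \<forall>h\<in>C. z \<circ> h = h \<circ> z}"
  have comC: "com a b \<in> C" if ab: "a \<in> H y" "b \<in> H y" for a b
  proof -
    have "com a b \<circ> com c d = com c d \<circ> com a b" if "c \<in> H y" "d \<in> H y" for c d
      using com_id_iff[OF H_Homeo[OF H_closed(4)[OF ab]] H_Homeo[OF H_closed(4)[OF that]]]
        com2[OF ab that] by simp
    then show ?thesis unfolding C_def using H_closed(4)[OF ab] by blast
  qed
  have comZ: "com a b \<in> Z" if ab: "a \<in> H y" "b \<in> H y" for a b
  proof -
    have "com a b \<circ> h = h \<circ> com a b" if "h \<in> C" for h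
    proof -
      have "h \<circ> com a b = com a b \<circ> h" using that ab unfolding C_def by blast
      then show ?thesis by (rule sym)
    qed
    then show ?thesis unfolding Z_def using comC[OF ab] by blast
  qed
  have CH: "C \<subseteq> H y" by (auto simp: C_def)
  have ZC: "Z \<subseteq> C" by (auto simp: Z_def)
  have ZH: "Z \<subseteq> H y" using ZC CH by blast
  have commI: "invf f \<circ> g = g \<circ> invf f" if f: "f \<in> Homeo" and "f \<circ> g = g \<circ> f" for f g
  proof
    fix x
    have "f (g (invf f x)) = g x" using fun_cong[OF that(2), of "invf f x"] f by simp
    then have "invf f (g x) = g (invf f x)" using Homeo_inv_f[OF f] by metis
    then show "(invf f \<circ> g) x = (g \<circ> invf f) x" by simp
  qed
  have Zinv: "invf z \<in> Z" if z: "z \<in> Z" for z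
  proof -
    have zH: "z \<in> H y" "z \<in> Homeo" using z ZH H_Homeo by blast+
    have c1: "z \<circ> com a b = com a b \<circ> z" if "a \<in> H y" "b \<in> H y" for a b using z that by (auto simp: Z_def C_def)
    have c2: "z \<circ> h = h \<circ> z" if "h \<in> C" for h using z that by (auto simp: Z_def)
    have "invf z \<in> C" unfolding C_def using H_closed(3)[OF zH(1)] commI[OF zH(2) c1] by blast
    then show ?thesis unfolding Z_def using commI[OF zH(2) c2] by blast
  qed
  have Zcomp: "z \<circ> w \<in> Z" if zw: "z \<in> Z" "w \<in> Z" for z w
  proof -
    have *: "(z \<circ> w) \<circ> k = k \<circ> (z \<circ> w)" if "z \<circ> k = k \<circ> z" "w \<circ> k = k \<circ> w" for k
    proof -
      have "(z \<circ> w) \<circ> k = z \<circ> (w \<circ> k)" by (rule comp_assoc)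
      also have "\<dots> = z \<circ> k \<circ> w" unfolding that(2) by (rule comp_assoc[symmetric])
      also have "\<dots> = k \<circ> (z \<circ> w)" unfolding that(1) by (rule comp_assoc)
      finally show ?thesis .
    qed
    have zwC: "z \<in> C" "w \<in> C" using zw ZC by blast+
    have "(z \<circ> w) \<circ> com a b = com a b \<circ> (z \<circ> w)" if "a \<in> H y" "b \<in> H y" for a b
      by (rule *) (use zwC that in \<open>unfold C_def, blast+\<close>)
    moreover have "z \<circ> w \<in> H y" using zwC CH by (intro H_closed(2)) blast+
    ultimately have "z \<circ> w \<in> C" unfolding C_def by blast
    moreover have "(z \<circ> w) \<circ> k = k \<circ> (z \<circ> w)" if "k \<in> C" for k
      by (rule *) (use zw that in \<open>unfold Z_def, blast+\<close>)
    ultimately show ?thesis unfolding Z_def by blast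
  qed
  have conjeq: "(h \<circ> z \<circ> invf h) \<circ> k = k \<circ> (h \<circ> z \<circ> invf h)"
    if h: "h \<in> Homeo" and "z \<circ> (invf h \<circ> k \<circ> h) = (invf h \<circ> k \<circ> h) \<circ> z" for h z k
  proof
    fix x
    have "z (invf h (k x)) = invf h (k (h (z (invf h x))))" using fun_cong[OF that(2), of "invf h x"] h by simp
    then show "((h \<circ> z \<circ> invf h) \<circ> k) x = (k \<circ> (h \<circ> z \<circ> invf h)) x" using h by simp
  qed
  have comconj: "\<exists>a'\<in>H y. \<exists>b'\<in>H y. invf h \<circ> com a b \<circ> h = com a' b'"
    if h: "h \<in> H y" and ab: "a \<in> H y" "b \<in> H y" for h a b
  proof -
    have ih: "invf (invf h) = h" using Homeo_bij[OF H_Homeo[OF h]] by (rule inv_inv_eq)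
    have hi: "invf h \<in> H y" using H_closed(3)[OF h] .
    have "invf h \<circ> com a b \<circ> h = com (invf h \<circ> a \<circ> h) (invf h \<circ> b \<circ> h)"
      using conj_com[OF H_Homeo[OF ab(1)] H_Homeo[OF ab(2)] H_Homeo[OF hi]] unfolding ih .
    moreover have "invf h \<circ> a \<circ> h \<in> H y" "invf h \<circ> b \<circ> h \<in> H y" by (intro H_closed(2) hi ab h)+
    ultimately show ?thesis by blast
  qed
  have Cconj: "h \<circ> z \<circ> invf h \<in> C" if h: "h \<in> H y" and z: "z \<in> C" for h z
  proof -
    have "(h \<circ> z \<circ> invf h) \<circ> com a b = com a b \<circ> (h \<circ> z \<circ> invf h)" if ab: "a \<in> H y" "b \<in> H y" for a b
    proof (rule conjeq[OF H_Homeo[OF h]])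
      obtain a' b' where ab': "a' \<in> H y" "b' \<in> H y" "invf h \<circ> com a b \<circ> h = com a' b'"
        using comconj[OF h ab] by blast
      show "z \<circ> (invf h \<circ> com a b \<circ> h) = (invf h \<circ> com a b \<circ> h) \<circ> z"
        unfolding ab'(3) using z ab'(1,2) by (auto simp: C_def)
    qed
    moreover have "h \<circ> z \<circ> invf h \<in> H y" using z CH by (intro H_closed(2,3) h) blast
    ultimately show ?thesis unfolding C_def by blast
  qed
  have Zconj: "h \<circ> z \<circ> invf h \<in> Z" if h: "h \<in> H y" and z: "z \<in> Z" for h z
  proof -
    have "(h \<circ> z \<circ> invf h) \<circ> k = k \<circ> (h \<circ> z \<circ> invf h)" if k: "k \<in> C" for k
    proof (rule conjeq[OF H_Homeo[OF h]])
      have ih: "invf (invf h) = h" using Homeo_bij[OF H_Homeo[OF h]] by (rule inv_inv_eq)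
      have "invf h \<circ> k \<circ> h \<in> C" using Cconj[OF H_closed(3)[OF h] k] unfolding ih .
      then show "z \<circ> (invf h \<circ> k \<circ> h) = (invf h \<circ> k \<circ> h) \<circ> z" using z by (auto simp: Z_def)
    qed
    then show ?thesis unfolding Z_def using Cconj[OF h] z ZC by blast
  qed
  obtain f g where fg: "f \<in> H y" "g \<in> H y" "f \<circ> g \<noteq> g \<circ> f" by (rule stabilizer_not_abelian[OF y_in_Y])
  have p: "com f g \<in> Z" "com f g \<noteq> id"
    using fg(3) com_id_iff[OF H_Homeo[OF fg(1)] H_Homeo[OF fg(2)]] comZ[OF fg(1,2)] by simp_all
  have trans: "\<exists>a\<in>Z. a z = w" if "z \<in> Y" "w \<in> Y" "z \<noteq> y" "w \<noteq> y" "z \<noteq> w" for z w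
    using normal_in_stabilizer_transitive[OF y_in_Y ZH Zinv Zconj p that] by blast
  have Zcomm: "a \<circ> b = b \<circ> a" if ab: "a \<in> Z" "b \<in> Z" for a b
  proof -
    have "b \<in> C" using ab(2) ZC by blast
    then show ?thesis using ab(1) unfolding Z_def by blast
  qed
  have free: "a = id" if "a \<in> Z" "z \<in> Y" "z \<noteq> y" "a z = z" for a z
    using transitive_abelian_free[OF y_in_Y ZH Zcomm trans that] by blast
  have fixpt: "\<exists>x. \<rho> a x = x" if a: "a \<in> Z" for a
  proof (cases "a = id")
    case True then show ?thesis using rho_id by simp
  next
    case False
    have aG: "a \<in> G" "a y = y" using a ZH by (auto simp: H_iff)
    have aH: "a \<in> Homeo" using G_Homeo[OF aG(1)] .
    obtain r where r: "y = cr r" using circle_lift_exists by blast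
    obtain F where F: "is_lift a F" "F r = r" using lift_through[OF aH, of r r] aG(2) r by blast
    obtain s where s: "r < s" "s < r + 1" "cr s \<in> Y" by (rule Y_between[of r "r + 1"]) auto
    have F1: "F (r + 1) = r + 1" using is_lift_add_1[OF Homeo_inj[OF aH] F(1), of r] F(2) by simp
    have bd: "r < F t \<and> F t < r + 1" if "r < t" "t < r + 1" for t
      using is_lift_less[OF F(1), of r t] is_lift_less[OF F(1), of t "r + 1"] that F(2) F1 by simp
    note b1 = bd[OF s(1,2)]
    note b2 = bd[OF conjunct1[OF b1] conjunct2[OF b1]]
    have sy: "cr s \<noteq> y" unfolding r using s by (auto dest!: circle_of_real_eqD)
    have Fs: "F s \<noteq> s"
      using free[OF a s(3) sy] False is_lift_eq[OF F(1), of s] by auto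
    have inY: "cr (F s) \<in> Y" "cr (F (F s)) \<in> Y"
      using invariant_Y[OF aG(1) s(3)] invariant_Y[OF aG(1) invariant_Y[OF aG(1) s(3)]]
      by (simp_all add: is_lift_eq[OF F(1)])
    have rY: "cr r \<in> Y" using y_in_Y r by simp
    \<comment> \<open>As \<open>F\<close> is increasing, \<open>s\<close>, \<open>F s\<close> and
      \<open>F (F s)\<close> follow each other in one direction, so \<open>h\<close> may be required
      to fix \<open>y\<close> and \<open>s\<close> and to send \<open>F s\<close> to
      \<open>F (F s)\<close>.\<close>
    have "\<exists>h\<in>G. h y = y \<and> h (cr s) = cr s \<and>
        h (cr (F s)) = cr (F (F s))"
    proof (cases "s < F s")
      case True
      then have "F s < F (F s)" using is_lift_less[OF F(1)] by blast
      then show ?thesis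
        using triple_transitive[of r s "F s" r s "F (F s)"] True s b1 b2 inY rY r by auto
    next
      case False
      then have "F s < s" using Fs by simp
      then have "F (F s) < F s" using is_lift_less[OF F(1)] by blast
      then show ?thesis
        using triple_transitive[of r "F s" s r "F (F s)" s] \<open>F s < s\<close> s b1 b2 inY rY r by auto
    qed
    then obtain h where h: "h \<in> H y" "h (cr s) = cr s"
      "h (a (cr s)) = a (a (cr s))"
      unfolding H_def using is_lift_eq[OF F(1)] by auto
    have hH: "h \<in> Homeo" and hG: "h \<in> G" using h(1) H_Homeo by (auto simp: H_iff)
    have aa: "a \<circ> a \<in> Homeo" using Homeo_comp[OF aH aH] .
    \<comment> \<open>This compares \<open>a \<circ> a\<close> with the conjugate of
      \<open>a\<close> by \<open>h\<close>. Both lie in \<open>Z\<close> and agree at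
      \<open>cr s\<close>, so freeness of \<open>Z\<close> makes them equal.\<close>
    define k where "k = invf (a \<circ> a) \<circ> (h \<circ> a \<circ> invf h)"
    have "k \<in> Z" unfolding k_def by (intro Zcomp Zinv Zconj a h(1))
    moreover have "k (cr s) = cr s"
    proof -
      have "invf h (cr s) = cr s" using Homeo_inv_f[OF hH] h(2) by metis
      then have "k (cr s) = invf (a \<circ> a) ((a \<circ> a) (cr s))" by (simp add: k_def h(3))
      then show ?thesis using Homeo_inv_f[OF aa] by simp
    qed
    ultimately have kid: "k = id" using free[OF _ s(3) sy] by blast
    have "h \<circ> a = a \<circ> a \<circ> h"
    proof
      fix x
      have "invf (a \<circ> a) (h (a x)) = h x" using fun_cong[OF kid, of "h x"] hH by (simp add: k_def)
      then show "(h \<circ> a) x = (a \<circ> a \<circ> h) x" using Homeo_f_inv[OF aa, of "h (a x)"] by simp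
    qed
    then have "\<rho> h \<circ> \<rho> a = \<rho> a \<circ> \<rho> a \<circ> \<rho> h"
      using rho_comp[OF hG aG(1)] rho_comp[OF aG(1) aG(1)] rho_comp[OF G_comp[OF aG(1) aG(1)] hG] by simp
    then show ?thesis
      using conjugate_to_square_has_fixed_point[OF rho_Homeo[OF aG(1)] rho_Homeo[OF hG]] by blast
  qed
  obtain M where M: "closed M" "M \<noteq> {}" and Minv: "\<And>a x. a \<in> \<rho> ` Z \<Longrightarrow> x \<in> M \<Longrightarrow> a x \<in> M"
    and minimal: "\<And>N. closed N \<Longrightarrow> N \<noteq> {} \<Longrightarrow> N \<subseteq> M \<Longrightarrow> (\<And>a x. a \<in> \<rho> ` Z \<Longrightarrow> x \<in> N \<Longrightarrow> a x \<in> N) \<Longrightarrow> N = M"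
    using minimal_set_exists[OF compact_circle, of "\<rho> ` Z"] by blast
  \<comment> \<open>Each element separately has a fixed point in the minimal set \<open>M\<close>.
    Since \<open>Z\<close> is abelian, its fixed points in \<open>M\<close> form an invariant closed
    set, hence all of \<open>M\<close>; so every point of \<open>M\<close> is a common fixed
    point.\<close>
  have Mfix: "\<rho> a x = x" if a: "a \<in> Z" and x: "x \<in> M" for a x
  proof -
    have aG: "a \<in> G" using a ZH by (auto simp: H_iff)
    obtain x0 where x0: "\<rho> a x0 = x0" using fixpt[OF a] by blast
    obtain z where z: "z \<in> M" "\<rho> a z = z"
      using fixed_point_in_invariant_set[OF rho_Homeo[OF aG] x0 M] Minv a by blast
    have "M \<inter> {x. \<rho> a x = x} = M"
    proof (rule minimal)
      show "closed (M \<inter> {x. \<rho> a x = x})"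
        by (intro closed_Int M Homeo_fixed_closed rho_Homeo aG)
      show "b w \<in> M \<inter> {x. \<rho> a x = x}" if b: "b \<in> \<rho> ` Z" and w: "w \<in> M \<inter> {x. \<rho> a x = x}" for b w
      proof -
        obtain b' where b': "b' \<in> Z" "b = \<rho> b'" using b by blast
        have "b' \<in> G" using b' ZH by (auto simp: H_iff)
        then have "\<rho> a \<circ> \<rho> b' = \<rho> b' \<circ> \<rho> a" using Zcomm[OF a b'(1)] rho_comp aG by metis
        then have "\<rho> a (b w) = b (\<rho> a w)" unfolding b'(2) by (metis comp_apply)
        then show ?thesis using w Minv[OF b] by simp
      qed
    qed (use z in auto)
    then show ?thesis using x by blast
  qed
  define F where "F = (\<Inter>s\<in>Z. {x. \<rho> s x = x})"
  have "F \<noteq> {}" using M(2) Mfix unfolding F_def by blast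
  moreover have "closed F" unfolding F_def
  proof (intro closed_INT ballI)
    fix s assume "s \<in> Z"
    then have "s \<in> G" using ZH by (auto simp: H_iff)
    then show "closed {x. \<rho> s x = x}" by (intro Homeo_fixed_closed rho_Homeo)
  qed
  moreover have "\<rho> h x \<in> F" if h: "h \<in> H y" and x: "x \<in> F" for h x
    using fixed_set_invariant[OF ZH Zconj h] x unfolding F_def by blast
  moreover have "\<forall>x\<in>F. \<rho> (com f g) x = x" using p(1) by (auto simp: F_def)
  moreover have "\<rho> (com f g) = id" if "F = UNIV" "f \<in> N" "g \<in> N" for f g
  proof -
    have "com f g = id" using N1[OF that(2)] N1[OF that(3)] com_id_iff[OF Homeo_id Homeo_id] by simp
    then show ?thesis using rho_id by simp
  qed
  ultimately have "good_set F" by (rule good_setI) (use p ZH in blast)+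
  then show ?thesis ..
qed

lemma good_set_exists: "\<exists>F. good_set F"
  using good_set_if_N_nontrivial good_set_if_N_trivial by blast

text \<open>Otherwise the kernel of \<open>\<rho>\<close> is a nontrivial normal subgroup, hence
  transitive on \<open>Y\<close>, and every element of \<open>G\<close> acts like some element of
  the stabilizer of \<open>y\<close>. Second commutators of \<open>G\<close> then act like elements
  of \<open>N\<close>, whose commutators act trivially by the last clause of
  \<open>good_set\<close>. That contradicts non-solvability.\<close>

lemma good_set_not_UNIV:
  assumes F: "good_set F" shows "F \<noteq> UNIV"
proof
  assume U: "F = UNIV"
  obtain p where p: "p \<in> H y" "p \<noteq> id" "\<And>x. \<rho> p x = x" using F U unfolding good_set_def by blast
  have triv: "\<rho> (com f g) = id" if "f \<in> N" "g \<in> N" for f g using F U that unfolding good_set_def by blast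
  define K where "K = {k \<in> G. \<rho> k = id}"
  have KG: "K \<subseteq> G" by (auto simp: K_def)
  have conj: "h \<circ> k \<circ> invf h \<in> K" if h: "h \<in> G" and k: "k \<in> K" for h k
  proof -
    have kG: "k \<in> G" and kid: "\<rho> k = id" using k by (auto simp: K_def)
    have "\<rho> (h \<circ> k \<circ> invf h) = id" using rho_Homeo[OF h] by (simp add: rho_conj[OF h kG] kid fun_eq_iff)
    moreover have "h \<circ> k \<circ> invf h \<in> G" by (intro G_comp G_inv h kG)
    ultimately show ?thesis by (simp add: K_def)
  qed
  have "p \<in> G" using p(1) by (simp add: H_iff)
  moreover have "\<rho> p = id" using p(3) by auto
  ultimately have pK: "p \<in> K" by (simp add: K_def)
  have rep: "\<exists>h\<in>H y. \<rho> h = \<rho> g" if g: "g \<in> G" for g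
  proof (cases "g y = y")
    case True then show ?thesis using g by (auto simp: H_iff)
  next
    case False
    obtain k where k: "k \<in> K" "k y = g y"
      using normal_transitive[OF KG conj pK p(2) y_in_Y invariant_Y[OF g y_in_Y] False[symmetric]] by blast
    have kG: "k \<in> G" and kid: "\<rho> k = id" using k(1) by (auto simp: K_def)
    have "(invf k \<circ> g) y = y" using k(2)[symmetric] G_Homeo[OF kG] by simp
    then have r1: "invf k \<circ> g \<in> H y" unfolding H_iff by (rule conjI[OF G_comp[OF G_inv[OF kG] g]])
    have r2: "\<rho> (invf k \<circ> g) = \<rho> g"
      unfolding rho_comp[OF G_inv[OF kG] g] rho_inv[OF kG] kid by simp
    show ?thesis by (rule bexI[of "\<lambda>h. \<rho> h = \<rho> g", OF r2 r1])
  qed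
  obtain a b c d a' b' c' d' where G:
    "a \<in> G" "b \<in> G" "c \<in> G" "d \<in> G" "a' \<in> G" "b' \<in> G" "c' \<in> G" "d' \<in> G"
    and ne: "\<rho> (com (com (com a b) (com c d)) (com (com a' b') (com c' d'))) \<noteq> id"
    by (rule not_solvable)
  have mem: "com (com u v) (com w z) \<in> N" if "u \<in> H y" "v \<in> H y" "w \<in> H y" "z \<in> H y" for u v w z
    unfolding N_def using second_commutators[OF that]
      H_closed(4)[OF H_closed(4)[OF that(1,2)] H_closed(4)[OF that(3,4)]] by simp
  have rho4: "\<rho> (com (com u v) (com w z)) = com (com (\<rho> u) (\<rho> v)) (com (\<rho> w) (\<rho> z))"
    if "u \<in> G" "v \<in> G" "w \<in> G" "z \<in> G" for u v w z
    unfolding rho_com[OF G_com[OF that(1,2)] G_com[OF that(3,4)]] rho_com[OF that(1,2)] rho_com[OF that(3,4)] ..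
  have "\<exists>f\<in>N. \<rho> f = \<rho> (com (com u v) (com w z))" if g: "u \<in> G" "v \<in> G" "w \<in> G" "z \<in> G" for u v w z
  proof -
    obtain u1 where u1: "u1 \<in> H y" "\<rho> u1 = \<rho> u" using rep[OF g(1)] by blast
    obtain v1 where v1: "v1 \<in> H y" "\<rho> v1 = \<rho> v" using rep[OF g(2)] by blast
    obtain w1 where w1: "w1 \<in> H y" "\<rho> w1 = \<rho> w" using rep[OF g(3)] by blast
    obtain z1 where z1: "z1 \<in> H y" "\<rho> z1 = \<rho> z" using rep[OF g(4)] by blast
    have g1: "u1 \<in> G" "v1 \<in> G" "w1 \<in> G" "z1 \<in> G" using u1 v1 w1 z1 by (auto simp: H_iff)
    show ?thesis
      by (rule bexI[OF _ mem[OF u1(1) v1(1) w1(1) z1(1)]])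
        (simp only: rho4[OF g] rho4[OF g1] u1(2) v1(2) w1(2) z1(2))
  qed
  note N_rep = this
  obtain f where f: "f \<in> N" "\<rho> f = \<rho> (com (com a b) (com c d))" using N_rep[OF G(1-4)] by blast
  obtain g where g: "g \<in> N" "\<rho> g = \<rho> (com (com a' b') (com c' d'))" using N_rep[OF G(5-8)] by blast
  have "f \<in> G" "g \<in> G" using N_H f(1) g(1) by (auto simp: H_iff)
  then have "com (\<rho> f) (\<rho> g) = id" using triv[OF f(1) g(1)] rho_com by simp
  then show False
    using ne unfolding f(2) g(2)
    using rho_com[OF G_com[OF G_com[OF G(1,2)] G_com[OF G(3,4)]] G_com[OF G_com[OF G(5,6)] G_com[OF G(7,8)]]]
    by simp
qed

text \<open>Let \<open>U\<close> be a gap of \<open>F\<close> and \<open>W\<close> the complementary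
  open arc, and let \<open>g\<close> and \<open>g'\<close> send \<open>F\<close> into
  \<open>U\<close> and \<open>W\<close>. The elements of the stabilizer that act trivially on
  \<open>F\<close> form a nontrivial normal subgroup, so one of them, \<open>q\<close>, sends
  \<open>g' y\<close> to \<open>g y\<close>. Composing \<open>g'\<close>, \<open>q\<close> and the
  inverse of \<open>g\<close> gives an element of the stabilizer. It preserves \<open>F\<close>, so
  \<open>q g'\<close> sends \<open>F\<close> into \<open>U\<close>. But \<open>q\<close> fixes the
  ends of the gap and therefore preserves \<open>W\<close>.\<close>

lemma good_set_singleton:
  assumes F: "good_set F" shows "\<exists>x. F = {x}"
proof (rule ccontr)
  assume nosing: "\<nexists>x. F = {x}"
  have cl: "closed F" and ne: "F \<noteq> {}" and inv: "\<And>h x. h \<in> H y \<Longrightarrow> x \<in> F \<Longrightarrow> \<rho> h x \<in> F"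
    using F unfolding good_set_def by blast+
  obtain p where p: "p \<in> H y" "p \<noteq> id" "\<And>x. x \<in> F \<Longrightarrow> \<rho> p x = x" using F unfolding good_set_def by blast
  have nU: "F \<noteq> UNIV" by (rule good_set_not_UNIV[OF F])
  define S where "S = cr -` F"
  have clS: "closed S" unfolding S_def using cl closed_circle_iff by blast
  obtain z where z: "z \<notin> F" using nU by blast
  obtain t where "z = cr t" using circle_lift_exists by blast
  then have t: "t \<notin> S" using z by (simp add: S_def)
  obtain x where x: "x \<in> F" using ne by blast
  obtain a0 where a0: "t - 1 \<le> a0" "a0 < (t - 1) + 1" "x = cr a0" by (rule circle_cases)
  obtain b0 where b0: "t \<le> b0" "b0 < t + 1" "x = cr b0" by (rule circle_cases)
  define a where "a = Sup (S \<inter> {..t})"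
  define b where "b = Inf (S \<inter> {t..})"
  have a0S: "a0 \<in> S \<inter> {..t}" and b0S: "b0 \<in> S \<inter> {t..}" using a0 b0 x by (auto simp: S_def)
  have bdd: "bdd_above (S \<inter> {..t})" "bdd_below (S \<inter> {t..})" by (auto intro: bdd_aboveI bdd_belowI)
  have aS: "a \<in> S \<inter> {..t}" unfolding a_def using a0S clS bdd by (intro closed_contains_Sup) auto
  have bS: "b \<in> S \<inter> {t..}" unfolding b_def using b0S clS bdd by (intro closed_contains_Inf) auto
  have at: "a < t" "t < b" using aS bS t by (auto simp: order_less_le)
  have gap: "u \<notin> S" if "a < u" "u < b" for u
  proof
    assume u: "u \<in> S"
    show False
    proof (cases "u \<le> t")
      case True then show False using cSup_upper[OF _ bdd(1), of u] u that(1) by (simp add: a_def)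
    next
      case False then show False using cInf_lower[OF _ bdd(2), of u] u that(2) by (simp add: b_def)
    qed
  qed
  have aF: "cr a \<in> F" "cr b \<in> F" using aS bS by (auto simp: S_def)
  have "b \<le> a + 1"
  proof (rule ccontr)
    assume "\<not> b \<le> a + 1"
    then have "a + 1 \<notin> S" by (intro gap) auto
    then show False using aF by (simp add: S_def)
  qed
  \<comment> \<open>A gap of full length leaves just one point of \<open>F\<close>, which is the
    case excluded here.\<close>
  moreover have "b \<noteq> a + 1"
  proof
    assume b: "b = a + 1"
    have "F = {cr a}"
    proof (intro subset_antisym subsetI)
      fix z assume z: "z \<in> F"
      obtain u where u: "a \<le> u" "u < a + 1" "z = cr u" by (rule circle_cases)
      then have "u = a" using gap[of u] b z by (cases "u = a") (auto simp: S_def)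
      then show "z \<in> {cr a}" using u by simp
    qed (use aF in simp)
    then show False using nosing by blast
  qed
  ultimately have ba: "b < a + 1" by simp
  define U where "U = cr ` {a<..<b}"
  define W where "W = cr ` {b<..<a+1}"
  have UF: "U \<inter> F = {}" unfolding U_def using gap by (auto simp: S_def)
  have aW: "cr a \<notin> W" unfolding W_def using ba at by (auto dest!: circle_of_real_eqD)
  have UW: "U \<inter> W = {}"
  proof (rule ccontr)
    assume "U \<inter> W \<noteq> {}"
    then obtain u w where uw: "a < u" "u < b" "b < w" "w < a + 1" "cr u = cr w"
      unfolding U_def W_def by auto
    then have "u = w" by (intro circle_of_real_eqD) auto
    then show False using uw by simp
  qed
  have UWo: "open U" "open W" unfolding U_def W_def by (auto intro: open_circle_of_real_image)
  have UWne: "U \<noteq> {}" "W \<noteq> {}" unfolding U_def W_def using at ba by auto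
  obtain g where g: "g \<in> G" "\<rho> g ` F \<subseteq> U" by (rule proximal_closed[OF cl nU UWo(1) UWne(1)])
  obtain g' where g': "g' \<in> G" "\<rho> g' ` F \<subseteq> W" by (rule proximal_closed[OF cl nU UWo(2) UWne(2)])
  have gy: "g y \<noteq> y"
  proof
    assume "g y = y"
    then have "\<rho> g x \<in> F" using inv g(1) x by (simp add: H_iff)
    moreover have "\<rho> g x \<in> U" using g(2) x by blast
    ultimately show False using UF by blast
  qed
  \<comment> \<open>Disjointness does not help as it did for \<open>U\<close>, since
    \<open>F\<close> may meet \<open>W\<close>. If \<open>g'\<close> fixed \<open>y\<close>, its
    inverse would preserve \<open>F\<close> as well, so \<open>cr a\<close> would be the image of a
    point of \<open>F\<close> and would lie in \<open>W\<close>.\<close>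
  have g'y: "g' y \<noteq> y"
  proof
    assume "g' y = y"
    then have "g' \<in> H y" using g'(1) by (simp add: H_iff)
    then have "\<rho> (invf g') (cr a) \<in> F" using inv[OF H_closed(3) aF(1)] by blast
    then have "\<rho> g' (\<rho> (invf g') (cr a)) \<in> W" using g'(2) by blast
    then have "cr a \<in> W" using rho_Homeo[OF g'(1)] by (simp add: rho_inv g'(1))
    then show False using aW by blast
  qed
  define P where "P = {q \<in> H y. \<forall>x\<in>F. \<rho> q x = x}"
  have PH: "P \<subseteq> H y" by (auto simp: P_def)
  have Pinv: "invf q \<in> P" if q: "q \<in> P" for q
  proof -
    have qH: "q \<in> H y" and qG: "q \<in> G" using q by (auto simp: P_def H_iff)
    have "\<rho> (invf q) z = z" if "z \<in> F" for z
      using q that Homeo_inv_f[OF rho_Homeo[OF qG], of z] by (simp add: P_def rho_inv[OF qG])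
    then show ?thesis using H_closed(3)[OF qH] by (simp add: P_def)
  qed
  have Pconj: "h \<circ> q \<circ> invf h \<in> P" if h: "h \<in> H y" and q: "q \<in> P" for h q
  proof -
    have qH: "q \<in> H y" and qG: "q \<in> G" and hG: "h \<in> G" using q h by (auto simp: P_def H_iff)
    have "\<rho> (h \<circ> q \<circ> invf h) z = z" if z: "z \<in> F" for z
    proof -
      have "\<rho> (invf h) z \<in> F" using inv[OF H_closed(3)[OF h] z] .
      then have "\<rho> q (\<rho> (invf h) z) = \<rho> (invf h) z" using q by (simp add: P_def)
      then show ?thesis using rho_Homeo[OF hG] by (simp add: rho_conj[OF hG qG] rho_inv[OF hG])
    qed
    moreover have "h \<circ> q \<circ> invf h \<in> H y" by (intro H_closed(2,3) h qH)
    ultimately show ?thesis by (simp add: P_def)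
  qed
  have pP: "p \<in> P" using p by (simp add: P_def)
  have "\<exists>q\<in>P. q (g' y) = g y"
  proof (cases "g' y = g y")
    case True
    have "id \<in> P" using rho_id H_closed(1) by (simp add: P_def)
    then show ?thesis using True by (intro bexI[of _ id]) auto
  next
    case False
    show ?thesis
      using normal_in_stabilizer_transitive[OF y_in_Y PH Pinv Pconj pP p(2)
          invariant_Y[OF g'(1) y_in_Y] invariant_Y[OF g(1) y_in_Y] g'y gy False] by blast
  qed
  then obtain q where q: "q \<in> P" "q (g' y) = g y" by blast
  have qG: "q \<in> G" using q PH by (auto simp: H_iff)
  have qfix: "\<rho> q z = z" if "z \<in> F" for z using q(1) that by (simp add: P_def)
  define r where "r = invf g \<circ> q \<circ> g'"
  have "r \<in> G" unfolding r_def by (intro G_comp G_inv g(1) g'(1) qG)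
  moreover have "r y = y" using q(2) G_Homeo[OF g(1)] by (simp add: r_def)
  ultimately have "\<rho> r x \<in> F" using inv x by (simp add: H_iff)
  then have "\<rho> g (\<rho> r x) \<in> U" using g(2) by blast
  moreover have "\<rho> g (\<rho> r x) = \<rho> q (\<rho> g' x)"
    unfolding r_def using rho_Homeo[OF g(1)] by (simp add: rho_comp G_comp G_inv g(1) g'(1) qG rho_inv)
  ultimately have 1: "\<rho> q (\<rho> g' x) \<in> U" by simp
  have "\<rho> g' x \<in> W" using g'(2) x by blast
  then obtain w where w: "b < w" "w < a + 1" "\<rho> g' x = cr w" unfolding W_def by auto
  have qH: "\<rho> q \<in> Homeo" using rho_Homeo[OF qG] .
  obtain Q where Q: "is_lift (\<rho> q) Q" "Q b = b" using lift_through[OF qH qfix[OF aF(2)]] by blast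
  have "cr (Q (a + 1)) = cr (a + 1)"
    using is_lift_eq[OF Q(1), of "a + 1"] qfix[OF aF(1)] by simp
  moreover have "Q b < Q (a + 1)" "Q (a + 1) < Q (b + 1)" using is_lift_less[OF Q(1)] at ba by auto
  moreover have "Q (b + 1) = b + 1" using is_lift_add_1[OF Homeo_inj[OF qH] Q(1)] Q(2) by simp
  ultimately have Qa: "Q (a + 1) = a + 1" using at ba Q(2) by (intro circle_of_real_eqD) auto
  have "b < Q w" "Q w < a + 1"
    using is_lift_less[OF Q(1), of b w] is_lift_less[OF Q(1), of w "a + 1"] w Q(2) Qa by auto
  then have "\<rho> q (\<rho> g' x) \<in> W" unfolding w(3) W_def is_lift_eq[OF Q(1)] by auto
  then show False using 1 UW by blast
qed

text \<open>The orbit map sending \<open>g y\<close> to \<open>\<rho> g x\<close> is well defined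
  because the stabilizer fixes \<open>x\<close>. By transitivity on pairs a single coincidence of
  values would make it constant and give a global fixed point. Density of the image is proximality
  applied to one point.\<close>

lemma equivariant_injection:
  obtains q where "\<And>g v. g \<in> G \<Longrightarrow> v \<in> Y \<Longrightarrow> q (g v) = \<rho> g (q v)"
    "\<And>v w. v \<in> Y \<Longrightarrow> w \<in> Y \<Longrightarrow> v \<noteq> w \<Longrightarrow> q v \<noteq> q w"
    "\<And>I. open I \<Longrightarrow> I \<noteq> {} \<Longrightarrow> \<exists>v\<in>Y. q v \<in> I"
proof -
  obtain F where F: "good_set F" using good_set_exists by blast
  obtain x where x: "F = {x}" using good_set_singleton[OF F] by blast
  have fixed: "\<rho> h x = x" if "h \<in> H y" for h using F that unfolding good_set_def x by blast
  have orbit: "\<exists>g. g \<in> G \<and> g y = v" if v: "v \<in> Y" for v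
  proof (cases "v = y")
    case True then show ?thesis using G_id by (intro exI[of _ id]) simp
  next
    case False
    then show ?thesis using pair_transitive[OF y_in_Y v False[symmetric] v y_in_Y False] by blast
  qed
  define q where "q v = \<rho> (SOME g. g \<in> G \<and> g y = v) x" for v
  have q_eq: "q (g y) = \<rho> g x" if g: "g \<in> G" for g
  proof -
    define k where "k = (SOME k. k \<in> G \<and> k y = g y)"
    have k: "k \<in> G" "k y = g y"
      using someI[of "\<lambda>k. k \<in> G \<and> k y = g y" g] g unfolding k_def by auto
    have "invf g \<circ> k \<in> H y"
      unfolding H_iff using k G_Homeo[OF g] G_comp[OF G_inv[OF g] k(1)] by simp
    then have "\<rho> (invf g \<circ> k) x = x" by (rule fixed)
    then have "invf (\<rho> g) (\<rho> k x) = x" by (simp add: rho_comp rho_inv g G_inv k(1))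
    then have "\<rho> k x = \<rho> g x" using Homeo_f_inv[OF rho_Homeo[OF g], of "\<rho> k x"] by simp
    then show ?thesis unfolding q_def k_def .
  qed
  have equi: "q (g v) = \<rho> g (q v)" if g: "g \<in> G" and v: "v \<in> Y" for g v
  proof -
    obtain k where k: "k \<in> G" "k y = v" using orbit[OF v] by blast
    have "q (g v) = q ((g \<circ> k) y)" using k(2) by simp
    also have "\<dots> = \<rho> (g \<circ> k) x" by (rule q_eq[OF G_comp[OF g k(1)]])
    also have "\<dots> = \<rho> g (q v)" using q_eq[OF k(1)] k by (simp add: rho_comp[OF g k(1)])
    finally show ?thesis .
  qed
  have inj: "q v \<noteq> q w" if vw: "v \<in> Y" "w \<in> Y" "v \<noteq> w" for v w
  proof
    assume eq: "q v = q w"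
    have all: "q z = q y" if z: "z \<in> Y" for z
    proof (cases "z = y")
      case False
      obtain g where g: "g \<in> G" "g v = z" "g w = y"
        using pair_transitive[OF vw z y_in_Y False] by blast
      then show ?thesis using equi[OF g(1) vw(1)] equi[OF g(1) vw(2)] eq by simp
    qed simp
    obtain g where g: "g \<in> G" "\<rho> g (q y) \<noteq> q y" using no_global_fixed_point by blast
    then show False using equi[OF g(1) y_in_Y] all[OF invariant_Y[OF g(1) y_in_Y]] by simp
  qed
  have dense: "\<exists>v\<in>Y. q v \<in> I" if I: "open I" "I \<noteq> {}" for I
  proof -
    have "{q y} \<noteq> UNIV" using three_points(1) by (metis UNIV_I singletonD)
    then obtain g where g: "g \<in> G" "\<rho> g ` {q y} \<subseteq> I" using proximal_closed[of "{q y}" I] I by auto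
    then have "q (g y) \<in> I" using equi[OF g(1) y_in_Y] by simp
    then show ?thesis using invariant_Y[OF g(1) y_in_Y] by blast
  qed
  show ?thesis by (rule that[OF equi inj dense])
qed

end

section \<open>Extension of order-preserving maps from dense sets to homeomorphisms\<close>

text \<open>Density of \<open>T\<close> makes the extension by suprema strictly increasing. Density
  of the values of \<open>Q\<close> leaves no gaps in its range and also forces periodicity.\<close>

lemma monotone_extension:
  fixes T :: "real set" and Q :: "real \<Rightarrow> real"
  assumes T: "\<And>a b. a < b \<Longrightarrow> \<exists>t\<in>T. a < t \<and> t < b"
    and mono: "\<And>s t. s \<in> T \<Longrightarrow> t \<in> T \<Longrightarrow> s < t \<Longrightarrow> Q s < Q t"
    and Q: "\<And>a b. a < b \<Longrightarrow> \<exists>t\<in>T. a < Q t \<and> Q t < b"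
    and period: "\<And>t. t \<in> T \<Longrightarrow> t + 1 \<in> T \<and> Q (t + 1) = Q t + 1"
  obtains H where "strict_mono H" "surj H" "\<And>t. t \<in> T \<Longrightarrow> H t = Q t" "\<And>x. H (x + 1) = H x + 1"
proof -
  have mono_le: "Q s \<le> Q t" if "s \<in> T" "t \<in> T" "s \<le> t" for s t
    using mono[OF that(1,2)] that(3) by (cases "s = t") auto
  define H where "H x = Sup (Q ` {t \<in> T. t \<le> x})" for x
  have ne: "Q ` {t \<in> T. t \<le> x} \<noteq> {}" for x using T[of "x - 1" x] by force
  have bd: "bdd_above (Q ` {t \<in> T. t \<le> x})" for x
  proof -
    obtain s where s: "s \<in> T" "x < s" using T[of x "x + 1"] by auto
    show ?thesis by (rule bdd_aboveI[of _ "Q s"]) (use s mono_le in force)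
  qed
  have lower: "Q t \<le> H x" if "t \<in> T" "t \<le> x" for t x
    unfolding H_def using that by (intro cSup_upper bd) auto
  have upper: "H x \<le> Q t" if "t \<in> T" "x \<le> t" for t x
    unfolding H_def using that mono_le by (intro cSup_least ne) force
  have HT: "H t = Q t" if "t \<in> T" for t using lower[OF that] upper[OF that] by (intro antisym) auto
  have smono: "strict_mono H"
  proof (rule strict_monoI)
    fix x z :: real assume xz: "x < z"
    obtain s where s: "s \<in> T" "x < s" "s < z" using T[OF xz] by blast
    obtain t where t: "t \<in> T" "s < t" "t < z" using T[OF s(3)] by blast
    have "H x \<le> Q s" using upper s by simp
    also have "\<dots> < Q t" using mono s t by blast
    also have "\<dots> \<le> H z" using lower t by simp
    finally show "H x < H z" .
  qed
  have "\<exists>x. H x = v" for v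
  proof -
    define X where "X = {t \<in> T. Q t \<le> v}"
    have "X \<noteq> {}" using Q[of "v - 1" v] by (force simp: X_def)
    have bX: "bdd_above X"
    proof -
      obtain s where s: "s \<in> T" "v < Q s" using Q[of v "v + 1"] by auto
      have "t \<le> s" if "t \<in> X" for t
      proof (rule ccontr)
        assume "\<not> t \<le> s"
        then have "Q s < Q t" using mono s(1) that by (simp add: X_def)
        then show False using that s(2) by (simp add: X_def)
      qed
      then show ?thesis by (rule bdd_aboveI)
    qed
    have "\<not> H (Sup X) < v"
    proof
      assume "H (Sup X) < v"
      then obtain t where t: "t \<in> T" "H (Sup X) < Q t" "Q t < v" using Q by blast
      then have "t \<le> Sup X" by (intro cSup_upper bX) (simp add: X_def)
      then show False using lower[OF t(1)] t(2) by fastforce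
    qed
    moreover have "\<not> v < H (Sup X)"
    proof
      assume "v < H (Sup X)"
      then obtain t where t: "t \<in> T" "v < Q t" "Q t < H (Sup X)" using Q by blast
      have "s \<le> t" if "s \<in> X" for s
      proof (rule ccontr)
        assume "\<not> s \<le> t"
        then have "Q t < Q s" using mono t(1) that by (simp add: X_def)
        then show False using that t(2) by (simp add: X_def)
      qed
      then have "Sup X \<le> t" using \<open>X \<noteq> {}\<close> by (intro cSup_least) auto
      then show False using upper[OF t(1)] t(3) by fastforce
    qed
    ultimately show ?thesis by (intro exI[of _ "Sup X"]) simp
  qed
  then have surj: "surj H" unfolding surj_def by metis
  have per: "H (x + 1) = H x + 1" for x
  proof (rule antisym)
    show "H (x + 1) \<le> H x + 1"
    proof (rule ccontr)
      assume "\<not> ?thesis"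
      then have "H x < H (x + 1) - 1" by simp
      then obtain t where t: "t \<in> T" "H x < Q t" "Q t < H (x + 1) - 1" using Q by blast
      have "x < t" using lower[OF t(1)] t(2) by (meson not_le)
      then have "H (x + 1) \<le> Q (t + 1)" using period[OF t(1)] by (intro upper) auto
      then show False using period[OF t(1)] t(3) by simp
    qed
    show "H x + 1 \<le> H (x + 1)"
    proof (rule ccontr)
      assume "\<not> ?thesis"
      then have "H (x + 1) - 1 < H x" by simp
      then obtain t where t: "t \<in> T" "H (x + 1) - 1 < Q t" "Q t < H x" using Q by blast
      have "t < x" using upper[OF t(1)] t(3) by (meson not_le)
      then have "Q (t + 1) \<le> H (x + 1)" using period[OF t(1)] by (intro lower) auto
      then show False using period[OF t(1)] t(2) by simp
    qed
  qed
  show ?thesis by (rule that[of H, OF smono surj]) (use HT per in auto)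
qed

text \<open>Continuity descends because \<open>cr\<close> is a quotient map; a continuous bijection
  of the compact circle is a homeomorphism.\<close>

lemma circle_homeomorphism_of_lift:
  assumes H: "strict_mono H" "surj H" "\<And>x. H (x + 1) = H x + (1 :: real)"
  obtains h h' where "homeomorphism UNIV UNIV h h'" "\<And>t. h (cr t) = cr (H t)"
proof -
  have Hn: "H (x + of_nat n) = H x + of_nat n" for x n
  proof (induction n)
    case (Suc n)
    have "H (x + of_nat (Suc n)) = H ((x + of_nat n) + 1)" by (simp add: algebra_simps)
    also have "\<dots> = H x + of_nat (Suc n)" unfolding H(3) Suc by simp
    finally show ?case .
  qed simp
  have Hi: "H (x + of_int n) = H x + of_int n" for x and n :: int
  proof (cases "n \<ge> 0")
    case True then show ?thesis using Hn[of x "nat n"] by simp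
  next
    case False
    then show ?thesis using Hn[of "x + of_int n" "nat (- n)"] by simp
  qed
  define h where "h x = cr (H (SOME t. cr t = x))" for x
  have h: "h (cr t) = cr (H t)" for t
  proof -
    define s where "s = (SOME s. cr s = cr t)"
    have "cr s = cr t" unfolding s_def by (rule someI) (rule refl)
    then obtain n :: int where "s = t + of_int n" using circle_of_real_eq_iff by blast
    then have "cr (H s) = cr (H t)" using Hi by simp
    then show ?thesis unfolding h_def s_def .
  qed
  have cH: "continuous_on UNIV H" using strict_mono_surj_continuous[OF H(1,2)] .
  have "continuous_on UNIV h"
    unfolding continuous_on_open_vimage[OF open_UNIV]
  proof (intro allI impI)
    fix B :: "circle set" assume "open B"
    then have "open (H -` (cr -` B))"
      using open_vimage[OF _ cH] open_circle_iff by blast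
    moreover have "H -` (cr -` B) = cr -` (h -` B)" using h by auto
    ultimately show "open (h -` B \<inter> UNIV)" using open_circle_iff[of "h -` B"] by simp
  qed
  moreover have "inj h"
  proof (rule injI)
    fix x z assume eq: "h x = h z"
    obtain s where s: "x = cr s" using circle_lift_exists by blast
    obtain t where t: "z = cr t" using circle_lift_exists by blast
    obtain n :: int where "H s = H t + of_int n" using eq circle_of_real_eq_iff unfolding s t h by blast
    then have "H s = H (t + of_int n)" using Hi by simp
    then have "s = t + of_int n" using strict_mono_eq[OF H(1)] by blast
    then show "x = z" unfolding s t by simp
  qed
  moreover have "h ` UNIV = UNIV"
  proof -
    have "x \<in> range h" for x
    proof -
      obtain s where s: "x = cr s" using circle_lift_exists by blast
      obtain t where "s = H t" using H(2) by blast
      then have "x = h (cr t)" using s h by simp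
      then show ?thesis by blast
    qed
    then show ?thesis by blast
  qed
  ultimately obtain h' where "homeomorphism UNIV UNIV h h'"
    using homeomorphism_compact[OF compact_circle] by blast
  then show ?thesis using that h by blast
qed

lemma circularly_orderedE:
  assumes "circularly_ordered xs"
  obtains a ts where "sorted_wrt (<) ts" "set ts \<subseteq> {a..<a+1}" "xs = map cr ts"
  using assms unfolding circularly_ordered_def by (elim exE conjE)

lemma circularly_ordered_tripleD:
  assumes "circularly_ordered [cr r, x, z]"
  obtains s t where "r < s" "s < t" "t < r + 1" "x = cr s" "z = cr t"
proof -
  obtain a ts where ts: "sorted_wrt (<) ts" "set ts \<subseteq> {a..<a+1}" "[cr r, x, z] = map cr ts"
    using assms by (rule circularly_orderedE)
  have "length ts = 3" using arg_cong[OF ts(3), of length] by simp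
  then obtain r' s' t' where e: "ts = [r', s', t']" by (auto simp: length_Suc_conv numeral_3_eq_3)
  then have "cr r = cr r'" using ts(3) by simp
  then obtain n :: int where n: "r = r' + of_int n" using circle_of_real_eq_iff by blast
  show ?thesis
    by (rule that[of "s' + of_int n" "t' + of_int n"]) (use ts e n in simp_all)
qed
lemma circularly_ordered_total:
  assumes "x \<noteq> y" "x \<noteq> z" "y \<noteq> z"
  shows "circularly_ordered [x, y, z] \<or> circularly_ordered [x, z, y]"
proof -
  obtain r where r: "x = cr r" using circle_lift_exists by blast
  obtain s where s: "r \<le> s" "s < r + 1" "y = cr s" by (rule circle_cases)
  obtain t where t: "r \<le> t" "t < r + 1" "z = cr t" by (rule circle_cases)
  have "r \<noteq> s" "r \<noteq> t" "s \<noteq> t" using assms r s t by auto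
  then consider "r < s" "s < t" | "r < t" "t < s" using s t by linarith
  then show ?thesis
    by cases (use r s t circularly_ordered_triple in auto)
qed

lemma circularly_ordered_Homeo:
  assumes f: "f \<in> Homeo" and xs: "circularly_ordered xs" shows "circularly_ordered (map f xs)"
proof -
  obtain a ts where ts: "sorted_wrt (<) ts" "set ts \<subseteq> {a..<a+1}" "xs = map cr ts"
    using xs by (rule circularly_orderedE)
  obtain F where F: "is_lift f F" using Homeo_lift[OF f] by blast
  have "sorted_wrt (<) (map F ts)"
    using ts(1) is_lift_less[OF F] by (simp add: sorted_wrt_map)
  moreover have "set (map F ts) \<subseteq> {F a..<F a + 1}"
    using ts(2) is_lift_le[OF F] is_lift_less[OF F, of _ "a + 1"] is_lift_add_1[OF Homeo_inj[OF f] F, of a] by auto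
  moreover have "map f xs = map cr (map F ts)"
    unfolding ts(3) using is_lift_eq[OF F] by simp
  ultimately show ?thesis unfolding circularly_ordered_def by (intro exI conjI)
qed

lemma order_preserving_extension:
  assumes Y: "\<And>I. open I \<Longrightarrow> I \<noteq> {} \<Longrightarrow> \<exists>v\<in>Y. v \<in> I"
    and q: "\<And>I. open I \<Longrightarrow> I \<noteq> {} \<Longrightarrow> \<exists>v\<in>Y. q v \<in> I"
    and inj: "\<And>v w. v \<in> Y \<Longrightarrow> w \<in> Y \<Longrightarrow> v \<noteq> w \<Longrightarrow> q v \<noteq> q w"
    and order: "\<And>u v w. u \<in> Y \<Longrightarrow> v \<in> Y \<Longrightarrow> w \<in> Y \<Longrightarrow> circularly_ordered [u, v, w] \<Longrightarrow>
      circularly_ordered [q u, q v, q w]"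
  obtains h h' where "homeomorphism UNIV UNIV h h'" "\<And>v. v \<in> Y \<Longrightarrow> h v = q v"
proof -
  obtain v0 where v0: "v0 \<in> Y" using Y[of UNIV] by auto
  obtain t0 where t0: "v0 = cr t0" using circle_lift_exists by blast
  obtain x0 where x0: "q v0 = cr x0" using circle_lift_exists by blast
  define T where "T = cr -` Y"
  define l where "l x = (SOME u. x0 \<le> u \<and> u < x0 + 1 \<and> x = cr u)" for x
  have l: "x0 \<le> l x \<and> l x < x0 + 1 \<and> x = cr (l x)" for x
    unfolding l_def by (rule someI_ex) (use circle_cases[of x0 x] in blast)
  have l_eq: "l (cr u) = u" if "x0 \<le> u" "u < x0 + 1" for u
    using l[of "cr u"] that by (intro circle_of_real_eqD) auto
  \<comment> \<open>A lift of \<open>q\<close>: the period from \<open>t0\<close> is sent into the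
    period from \<open>x0\<close>, and the floor continues this periodically.\<close>
  define Q where "Q t = l (q (cr t)) + of_int \<lfloor>t - t0\<rfloor>" for t
  have cQ: "cr (Q t) = q (cr t)" for t
    unfolding Q_def using l[of "q (cr t)"] by simp
  have Qi: "Q (t + of_int n) = Q t + of_int n" for t and n :: int
  proof -
    have "\<lfloor>t + of_int n - t0\<rfloor> = \<lfloor>t - t0\<rfloor> + n" by linarith
    then show ?thesis by (simp add: Q_def)
  qed
  have Ti: "t + of_int n \<in> T \<longleftrightarrow> t \<in> T" for t and n :: int by (simp add: T_def)
  \<comment> \<open>When \<open>s\<close> is the base parameter only two points are involved and the
    hypothesis on triples is silent. There injectivity gives strictness, as \<open>x0\<close> is the
    least value of \<open>l\<close>.\<close>
  have base: "l (q (cr s)) < l (q (cr t))"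
    if st: "t0 \<le> s" "s < t" "t < t0 + 1" "s \<in> T" "t \<in> T" for s t
  proof (cases "s = t0")
    case True
    have "cr t \<noteq> v0" unfolding t0 using st True by (auto dest!: circle_of_real_eqD)
    then have "q (cr t) \<noteq> q v0" using inj v0 st(5) by (simp add: T_def)
    then have "l (q (cr t)) \<noteq> x0" using l[of "q (cr t)"] x0 by metis
    moreover have "l (q (cr s)) = x0" using True t0 x0 l_eq[of x0] by simp
    ultimately show ?thesis using l[of "q (cr t)"] by simp
  next
    case False
    then have "circularly_ordered [v0, cr s, cr t]"
      unfolding t0 using st by (intro circularly_ordered_triple) auto
    then have "circularly_ordered [cr x0, q (cr s), q (cr t)]"
      using order[OF v0] st(4,5) x0 by (simp add: T_def)
    then obtain u w where "x0 < u" "u < w" "w < x0 + 1"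
      "q (cr s) = cr u" "q (cr t) = cr w"
      by (rule circularly_ordered_tripleD)
    then show ?thesis using l_eq by simp
  qed
  have Qmono: "Q s < Q t" if st: "s \<in> T" "t \<in> T" "s < t" for s t
  proof (cases "\<lfloor>s - t0\<rfloor> = \<lfloor>t - t0\<rfloor>")
    case True
    define n where "n = \<lfloor>s - t0\<rfloor>"
    define s' t' where "s' = s - of_int n" and "t' = t - of_int n"
    have eqs: "s = s' + of_int n" "t = t' + of_int n" by (auto simp: s'_def t'_def)
    have b: "t0 \<le> s'" "t' < t0 + 1" unfolding s'_def t'_def using True n_def by linarith+
    have "l (q (cr s')) < l (q (cr t'))"
      by (rule base) (use st b eqs Ti in auto)
    then show ?thesis unfolding Q_def True using eqs by simp
  next
    case False
    then have "\<lfloor>s - t0\<rfloor> + 1 \<le> \<lfloor>t - t0\<rfloor>" using floor_mono[of "s - t0" "t - t0"] st(3) by simp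
    then have "of_int \<lfloor>s - t0\<rfloor> + 1 \<le> real_of_int \<lfloor>t - t0\<rfloor>" by linarith
    then show ?thesis unfolding Q_def
      using l[of "q (cr s)"] l[of "q (cr t)"] by linarith
  qed
  have Tdense: "\<exists>t\<in>T. a < t \<and> t < b" if "a < b" for a b
  proof -
    have "open (cr ` {a<..<b})" by (rule open_circle_of_real_image) simp
    moreover have "cr ` {a<..<b} \<noteq> {}" using that by simp
    ultimately obtain v where "v \<in> Y" "v \<in> cr ` {a<..<b}" using Y by blast
    then show ?thesis unfolding T_def by auto
  qed
  have Qdense: "\<exists>t\<in>T. a < Q t \<and> Q t < b" if "a < b" for a b
  proof -
    have "open (cr ` {a<..<b})" by (rule open_circle_of_real_image) simp
    moreover have "cr ` {a<..<b} \<noteq> {}" using that by simp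
    ultimately obtain v where v: "v \<in> Y" "q v \<in> cr ` {a<..<b}" using q by blast
    obtain u where u: "a < u" "u < b" "q v = cr u" using v(2) by auto
    obtain t where t: "v = cr t" using circle_lift_exists by blast
    have "cr u = cr (Q t)" using cQ u(3) t by simp
    then obtain n :: int where n: "u = Q t + of_int n" using circle_of_real_eq_iff by blast
    have "t + of_int n \<in> T" using v(1) t Ti by (simp add: T_def)
    then show ?thesis using Qi[of t n] n u by (intro bexI[of _ "t + of_int n"]) auto
  qed
  have per: "t + 1 \<in> T \<and> Q (t + 1) = Q t + 1" if "t \<in> T" for t
    using that Ti[of t 1] Qi[of t 1] by simp
  obtain H where H: "strict_mono H" "surj H" "\<And>t. t \<in> T \<Longrightarrow> H t = Q t" "\<And>x. H (x + 1) = H x + 1"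
    using monotone_extension[OF Tdense Qmono Qdense per] by blast
  obtain h h' where h: "homeomorphism UNIV UNIV h h'" "\<And>t. h (cr t) = cr (H t)"
    using circle_homeomorphism_of_lift[OF H(1,2,4)] by blast
  have "h v = q v" if v: "v \<in> Y" for v
  proof -
    obtain t where t: "v = cr t" using circle_lift_exists by blast
    then have "t \<in> T" using v by (simp add: T_def)
    then show ?thesis unfolding t using h(2) H(3) cQ by simp
  qed
  then show ?thesis using that h(1) by blast
qed

text \<open>An orientation-reversing involution, which reduces maps that reverse the circular order
  to maps that preserve it.\<close>

definition reflect :: "circle \<Rightarrow> circle"
  where "reflect x = Abs_circle (cnj (Rep_circle x))"

lemma reflect_circle_of_real: "reflect (cr t) = cr (- t)"
  unfolding reflect_def Rep_circle_of_real by (simp add: cis_cnj circle_of_real_def)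

lemma reflect_reflect: "reflect (reflect x) = x"
proof -
  obtain t where "x = cr t" using circle_lift_exists by blast
  then show ?thesis by (simp add: reflect_circle_of_real)
qed

lemma continuous_reflect: "continuous_on S reflect"
proof -
  have "dist (reflect x) (reflect z) = dist x z" for x z
  proof -
    have R: "Rep_circle (reflect u) = cnj (Rep_circle u)" for u
      unfolding reflect_def using Rep_circle[of u] by (intro Abs_circle_inverse) simp
    show ?thesis unfolding dist_circle_def R dist_norm
      by (simp flip: complex_cnj_diff)
  qed
  then show ?thesis unfolding continuous_on_iff by auto
qed

lemma homeomorphism_reflect: "homeomorphism UNIV UNIV reflect reflect"
  unfolding homeomorphism_def
  using reflect_reflect continuous_reflect by (auto intro!: surjI[of reflect reflect])

lemma circularly_ordered_reflect:
  assumes "circularly_ordered [x, y, z]" shows "circularly_ordered [reflect x, reflect z, reflect y]"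
proof -
  obtain r where r: "x = cr r" using circle_lift_exists by blast
  obtain s t where st: "r < s" "s < t" "t < r + 1" "y = cr s" "z = cr t"
    using assms unfolding r by (rule circularly_ordered_tripleD)
  \<comment> \<open>The shift by 1 moves the parameters \<open>- t\<close> and \<open>- s\<close>
    into the period that starts at \<open>- r\<close>.\<close>
  have "circularly_ordered [cr (- r), cr (- t + 1), cr (- s + 1)]"
    using st by (intro circularly_ordered_triple) auto
  then show ?thesis unfolding r st(4,5) reflect_circle_of_real circle_of_real_add_1 .
qed

context rigid_action
begin

theorem conjugate_to_standard:
  obtains h h' where "homeomorphism UNIV UNIV h h'" "\<And>g. g \<in> G \<Longrightarrow> h \<circ> g = \<rho> g \<circ> h"
proof -
  obtain q where q: "\<And>g v. g \<in> G \<Longrightarrow> v \<in> Y \<Longrightarrow> q (g v) = \<rho> g (q v)"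
    "\<And>v w. v \<in> Y \<Longrightarrow> w \<in> Y \<Longrightarrow> v \<noteq> w \<Longrightarrow> q v \<noteq> q w"
    "\<And>I. open I \<Longrightarrow> I \<noteq> {} \<Longrightarrow> \<exists>v\<in>Y. q v \<in> I"
    using equivariant_injection by blast
  have Ydense: "\<exists>v\<in>Y. v \<in> I" if "open I" "I \<noteq> {}" for I using Y_meets_open[OF that] by blast
  have ext: "\<exists>h h'. homeomorphism UNIV UNIV h h' \<and> (\<forall>v\<in>Y. h v = q v)"
  proof -
    obtain r where r: "cr r \<in> Y" using Y_between[of 0 1] by auto
    obtain s where s: "r < s" "s < r + 1" "cr s \<in> Y" by (rule Y_between[of r "r + 1"]) auto
    obtain t where t: "s < t" "t < r + 1" "cr t \<in> Y" by (rule Y_between[OF s(2)])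
    have move: "\<exists>g\<in>G. g (cr r) = u \<and> g (cr s) = v \<and> g (cr t) = w"
      if uvw: "u \<in> Y" "v \<in> Y" "w \<in> Y" "circularly_ordered [u, v, w]" for u v w
    proof -
      obtain r' where r': "u = cr r'" using circle_lift_exists by blast
      obtain s' t' where st': "r' < s'" "s' < t'" "t' < r' + 1" "v = cr s'" "w = cr t'"
        using uvw(4) unfolding r' by (rule circularly_ordered_tripleD)
      obtain g where "g \<in> G" "g (cr r) = cr r'"
        "g (cr s) = cr s'" "g (cr t) = cr t'"
        by (rule triple_transitive[OF s(1) t(1,2) st'(1-3)]) (use uvw r s t r' st' in auto)
      then show ?thesis using r' st' by blast
    qed
    have ne: "cr r \<noteq> cr s" "cr r \<noteq> cr t"
      "cr s \<noteq> cr t"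
      using s t by (auto dest!: circle_of_real_eqD)
    \<comment> \<open>One reference triple decides: \<open>G\<close> carries it to every circularly
      ordered triple of \<open>Y\<close>, and \<open>\<rho>\<close> preserves the circular order of
      the images.\<close>
    consider
      (pos) "circularly_ordered [q (cr r), q (cr s), q (cr t)]"
      | (neg) "circularly_ordered [q (cr r), q (cr t), q (cr s)]"
      using circularly_ordered_total[OF q(2)[OF r s(3) ne(1)] q(2)[OF r t(3) ne(2)] q(2)[OF s(3) t(3) ne(3)]]
      by blast
    then show ?thesis
    proof cases
      case pos
      have "circularly_ordered [q u, q v, q w]"
        if uvw: "u \<in> Y" "v \<in> Y" "w \<in> Y" "circularly_ordered [u, v, w]" for u v w
      proof -
        obtain g where g: "g \<in> G" "g (cr r) = u" "g (cr s) = v" "g (cr t) = w"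
          using move[OF uvw] by blast
        have "circularly_ordered (map (\<rho> g) [q (cr r), q (cr s), q (cr t)])"
          using circularly_ordered_Homeo[OF rho_Homeo[OF g(1)] pos] .
        then show ?thesis using q(1)[OF g(1) r] q(1)[OF g(1) s(3)] q(1)[OF g(1) t(3)] g by simp
      qed
      note order = this
      show ?thesis by (rule order_preserving_extension[of Y q, OF Ydense q(3) q(2) order]) blast+
    next
      case neg
      define q' where "q' v = reflect (q v)" for v
      have "circularly_ordered [q' u, q' v, q' w]"
        if uvw: "u \<in> Y" "v \<in> Y" "w \<in> Y" "circularly_ordered [u, v, w]" for u v w
      proof -
        obtain g where g: "g \<in> G" "g (cr r) = u" "g (cr s) = v" "g (cr t) = w"
          using move[OF uvw] by blast
        have "circularly_ordered (map (\<rho> g) [q (cr r), q (cr t), q (cr s)])"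
          using circularly_ordered_Homeo[OF rho_Homeo[OF g(1)] neg] .
        then have "circularly_ordered [q u, q w, q v]"
          using q(1)[OF g(1) r] q(1)[OF g(1) s(3)] q(1)[OF g(1) t(3)] g by simp
        then show ?thesis unfolding q'_def by (rule circularly_ordered_reflect)
      qed
      note order = this
      have dense: "\<exists>v\<in>Y. q' v \<in> I" if I: "open I" "I \<noteq> {}" for I
      proof -
        have "open (reflect -` I)" by (rule open_vimage[OF I(1) continuous_reflect])
        moreover obtain i where "i \<in> I" using I(2) by blast
        then have "reflect i \<in> reflect -` I" by (simp add: reflect_reflect)
        then have "reflect -` I \<noteq> {}" by blast
        ultimately obtain v where "v \<in> Y" "q v \<in> reflect -` I" using q(3) by blast
        then show ?thesis unfolding q'_def by blast
      qed
      have inj: "q' v \<noteq> q' w" if "v \<in> Y" "w \<in> Y" "v \<noteq> w" for v w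
        using q(2)[OF that] reflect_reflect unfolding q'_def by metis
      obtain h h' where h: "homeomorphism UNIV UNIV h h'" "\<And>v. v \<in> Y \<Longrightarrow> h v = q' v"
        by (rule order_preserving_extension[of Y q', OF Ydense dense inj order]) blast+
      have "homeomorphism UNIV UNIV (reflect \<circ> h) (h' \<circ> reflect)"
        by (rule homeomorphism_compose[OF h(1) homeomorphism_reflect])
      moreover have "(reflect \<circ> h) v = q v" if "v \<in> Y" for v
        using h(2)[OF that] reflect_reflect by (simp add: q'_def)
      ultimately show ?thesis by blast
    qed
  qed
  then obtain h h' where h: "homeomorphism UNIV UNIV h h'" "\<And>v. v \<in> Y \<Longrightarrow> h v = q v" by blast
  have hc: "continuous_on UNIV h" using h(1) by (simp add: homeomorphism_def)
  have "h \<circ> g = \<rho> g \<circ> h" if g: "g \<in> G" for g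
  proof -
    have "closed {x. (h \<circ> g) x = (\<rho> g \<circ> h) x}"
    proof (rule closed_Collect_eq)
      show "continuous_on UNIV (h \<circ> g)"
        using continuous_on_compose[OF Homeo_continuous[OF G_Homeo[OF g], of UNIV]] continuous_on_subset[OF hc] by blast
      show "continuous_on UNIV (\<rho> g \<circ> h)"
        by (rule continuous_on_compose[OF hc Homeo_continuous[OF rho_Homeo[OF g]]])
    qed
    moreover have "Y \<subseteq> {x. (h \<circ> g) x = (\<rho> g \<circ> h) x}"
      using h(2) q(1)[OF g] invariant_Y[OF g] by auto
    ultimately have "closure Y \<subseteq> {x. (h \<circ> g) x = (\<rho> g \<circ> h) x}" by (rule closure_minimal[rotated])
    then show ?thesis unfolding dense_Y by (auto simp: fun_eq_iff)
  qed
  then show ?thesis using that h(1) by blast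
qed

end

lemma conjugate_actions_via_standard:
  fixes h h' k k' :: "circle \<Rightarrow> circle"
  assumes h: "homeomorphism UNIV UNIV h h'" "\<And>g. g \<in> carrier \<Gamma> \<Longrightarrow> h \<circ> g = \<rho> g \<circ> h"
    and k: "homeomorphism UNIV UNIV k k'" "\<And>g. g \<in> carrier \<Gamma> \<Longrightarrow> k \<circ> g = \<sigma> g \<circ> k"
  shows "conjugate_actions \<Gamma> \<rho> \<sigma>"
  unfolding conjugate_actions_def
proof (intro exI conjI ballI)
  show "homeomorphism UNIV UNIV (k \<circ> h') (h \<circ> k')"
    using homeomorphism_compose[OF homeomorphism_symD[OF h(1)] k(1)] .
  fix g assume g: "g \<in> carrier \<Gamma>"
  have hh: "h' (h x) = x" "h (h' x) = x" for x using h(1) by (auto simp: homeomorphism_def)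
  show "(k \<circ> h') \<circ> \<rho> g = \<sigma> g \<circ> (k \<circ> h')"
  proof
    fix x
    have "\<rho> g x = h (g (h' x))" using fun_cong[OF h(2)[OF g], of "h' x"] hh by simp
    then show "((k \<circ> h') \<circ> \<rho> g) x = (\<sigma> g \<circ> (k \<circ> h')) x"
      using fun_cong[OF k(2)[OF g], of "h' x"] hh by simp
  qed
qed

theorem corollary5p2:
  fixes G :: "(circle \<Rightarrow> circle) set" and Y :: "circle set"
  assumes "subgroup G homeo_plus"
    and "(\<forall>g\<in>G. piecewise_linear g) \<or> (\<forall>g\<in>G. piecewise_projective g)"
    and "\<exists>y. Y = (\<lambda>g. g y) ` G"
    and "closure Y = UNIV"
    and "transitive_on_circular_tuples G 2 Y"
    and "transitive_on_circular_tuples G 3 Y"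
  defines "\<Gamma> \<equiv> homeo_plus\<lparr>carrier := G\<rparr>"
  shows "(\<exists>\<rho>. circle_action \<Gamma> \<rho> \<and> proximal \<Gamma> \<rho>) \<and>
    (\<forall>\<rho> \<sigma>. circle_action \<Gamma> \<rho> \<and> proximal \<Gamma> \<rho> \<and> circle_action \<Gamma> \<sigma> \<and> proximal \<Gamma> \<sigma> \<longrightarrow>
      conjugate_actions \<Gamma> \<rho> \<sigma>)"
proof -
  obtain y0 where Y: "Y = (\<lambda>g. g y0) ` G" using assms(3) by blast
  have invariant: "g v \<in> Y" if g: "g \<in> G" and v: "v \<in> Y" for g v
  proof -
    obtain k where k: "k \<in> G" "v = k y0" using v Y by blast
    have "g \<circ> k \<in> G" using subgroup_closed(3)[OF assms(1) g k(1)] .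
    then have "(g \<circ> k) y0 \<in> Y" unfolding Y by blast
    then show ?thesis using k(2) by simp
  qed
  interpret circularly_transitive G Y
  proof (intro circularly_transitive.intro homeo_group.intro circularly_transitive_axioms.intro assms(1,4-6))
    show "g v \<in> Y" if "g \<in> G" "v \<in> Y" for g v using invariant[OF that] .
  qed
  have carrier: "carrier \<Gamma> = G" by (simp add: \<Gamma>_def)
  have mult: "f \<otimes>\<^bsub>\<Gamma>\<^esub> g = g \<circ> f" for f g by (simp add: \<Gamma>_def)
  \<comment> \<open>The base point is chosen away from infinity, so that the chart
    \<open>1 / (v - y0)\<close> is available in the projective case.\<close>
  obtain y where y: "y \<in> Y" "y \<noteq> cayley None" by (rule other_point)
  obtain t where t: "y = cr t" using circle_lift_exists by blast
  obtain p where p: "cayley p = y" using surj_cayley by blast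
  obtain v where "p = Some v" using p y(2) by (cases p) auto
  then have v: "cr t = cayley (Some v)" using p t by simp
  have "\<exists>\<psi>. germ_chart (H y) t \<psi>"
    using assms(2)
  proof
    assume "\<forall>g\<in>G. piecewise_linear g"
    then show ?thesis by (intro germ_chart_linear) (use G_Homeo t in \<open>auto simp: H_iff\<close>)
  next
    assume "\<forall>g\<in>G. piecewise_projective g"
    then show ?thesis by (intro germ_chart_projective[OF _ v]) (use G_Homeo t in \<open>auto simp: H_iff\<close>)
  qed
  then obtain \<psi> where \<psi>: "germ_chart (H y) t \<psi>" by blast
  have Ht: "h \<in> Homeo \<and> h (cr t) = cr t" if "h \<in> H y" for h
    using that G_Homeo t by (auto simp: H_iff)
  have second: "trivial_near y (com (com a b) (com c d))"
    if "a \<in> H y" "b \<in> H y" "c \<in> H y" "d \<in> H y" for a b c d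
    unfolding t by (rule second_commutator_trivial_near[OF \<psi> Ht H_closed(3,4) that])
  have standard: "\<exists>h h'. homeomorphism UNIV UNIV h h' \<and> (\<forall>g\<in>carrier \<Gamma>. h \<circ> g = \<rho> g \<circ> h)"
    if act: "circle_action \<Gamma> \<rho>" and prox: "proximal \<Gamma> \<rho>" for \<rho>
  proof -
    interpret rigid_action G Y \<rho> y
    proof unfold_locales
      show "\<rho> g \<in> Homeo" if "g \<in> G" for g
        using act that carrier unfolding circle_action_def hom_def by auto
      show "\<rho> (f \<circ> g) = \<rho> f \<circ> \<rho> g" if "f \<in> G" "g \<in> G" for f g
        using act that carrier mult unfolding circle_action_def hom_def by auto
      show "\<exists>g\<in>G. \<rho> g ` J \<subseteq> I"
        if "open I" "I \<noteq> {}" "open J" "J \<noteq> {}" "closure J \<noteq> UNIV" for I J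
        using prox that unfolding proximal_def carrier by blast
      show "y \<in> Y" by (rule y(1))
      show "trivial_near y (com (com a b) (com c d))"
        if "a \<in> H y" "b \<in> H y" "c \<in> H y" "d \<in> H y" for a b c d
        using second[OF that] .
    qed
    show ?thesis using conjugate_to_standard carrier by metis
  qed
  have "circle_action \<Gamma> (\<lambda>g. g)"
    unfolding circle_action_def hom_def carrier using G_Homeo by (auto simp: mult)
  moreover have "proximal \<Gamma> (\<lambda>g. g)"
    unfolding proximal_def carrier using standard_proximal by metis
  moreover have "conjugate_actions \<Gamma> \<rho> \<sigma>"
    if acts: "circle_action \<Gamma> \<rho>" "proximal \<Gamma> \<rho>" "circle_action \<Gamma> \<sigma>" "proximal \<Gamma> \<sigma>" for \<rho> \<sigma>
  proof -
    obtain h h' where h: "homeomorphism UNIV UNIV h h'" "\<And>g. g \<in> carrier \<Gamma> \<Longrightarrow> h \<circ> g = \<rho> g \<circ> h"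
      using standard[OF acts(1,2)] by blast
    obtain k k' where k: "homeomorphism UNIV UNIV k k'" "\<And>g. g \<in> carrier \<Gamma> \<Longrightarrow> k \<circ> g = \<sigma> g \<circ> k"
      using standard[OF acts(3,4)] by blast
    show ?thesis by (rule conjugate_actions_via_standard[OF h k])
  qed
  ultimately show ?thesis by blast
qed

end
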